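(* Let $n\ge1$ be an integer, $h\ge0$, $a>0$, and let $\Gamma$ be an $(n,h)$ subset of the open cylinder $\mathcal{C}_1(0)=\{z\in\mathbf{R}^{n+1}:|z'|<1\}$ such that $\mathscr{H}^n(\Gamma)<\infty$. Then for every closed set $C\subseteq\mathbf{B}^n(0,1)$ such that $\varnothing\ne A_a(\Gamma;C)\subseteq\Gamma\times\mathbf{S}^n$, one has $$\mathscr{H}^n(C)\le\gamma\,(1+a+ha^{-1})^n\,(1+4a^2)^{1/2}\,\mathscr{H}^n(A'_a(\Gamma;C)),$$ where $\gamma=(2n+4h)^n$.
   Context: Notation: points of $\mathbf{R}^{n+1}\cong\mathbf{R}^n\times\mathbf{R}$ are written $z=(z',z_{n+1})$; $\mathbf{B}^n(x,\rho)$ is the closed ball of $\mathbf{R}^n$; $\mathbf{S}^n$ is the unit sphere of $\mathbf{R}^{n+1}$; $\mathscr{H}^n$ is the $n$-dimensional Hausdorff measure (equal to Lebesgue measure on $\mathbf{R}^n$); $\overline{\Gamma}$ is the closure of $\Gamma$ in $\mathbf{R}^{n+1}$. $(n,h)$ subsets: let $\Omega\subseteq\mathbf{R}^{n+1}$ be open, $\Gamma$ relatively closed in $\Omega$ and $h\ge0$. $\Gamma$ is an $(n,h)$ subset of $\Omega$ if: whenever $x\in\Gamma$ and $f$ is a real-valued $\mathscr{C}^2$ function on a neighbourhood of $x$ such that $f|\Gamma$ has a local maximum at $x$ and $\nabla f(x)\ne0$, then $\operatorname{trace}_n D^2f(x)\le h|\nabla f(x)|$, where $\operatorname{trace}_n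 D^2f(x)$ is the sum of the lowest $n$ (of the $n+1$) eigenvalues, with multiplicity, of the Hessian $D^2f(x)$. Touching paraboloids: for $a>0$ and $x\in\mathbf{R}^n$, a paraboloid of center $x$ and opening $a$ is a function $P:\mathbf{R}^n\to\mathbf{R}$ of the form $P(y)=(a/2)|y-x|^2+t$ with $t\in\mathbf{R}$. For $f:\mathbf{R}^n\to\mathbf{R}$ put $\Sigma(f)=\{(x,f(x)):x\in\mathbf{R}^n\}$ and $\Sigma^+(f)=\{(x,y):y>f(x)\}$. A continuous $f$ touches a closed set $K\subseteq\mathbf{R}^{n+1}$ from above if $\Sigma(f)\cap K\ne\varnothing$ and $\Sigma^+(f)\cap K=\varnothing$. For $\Gamma$ relatively closed in $\mathcal{C}_1(0)$, let $P_{a,x}$ be the (unique, when it exists) paraboloid of opening $a$ and center $x$ touching $\overline{\Gamma}$ from above. Touching sets: for a closed set $C\subseteq\mathbf{B}^n(0,1)$, $A_a(\Gamma;C)$ is the set of pairs $(z,\eta)$ such that for some $x\in C$ one has $z\in\Sigma(P_{a,x})\cap\overline{\Gamma}$ and $\eta$ is a normal vector to the hypersurface $\Sigma(P_{a,x})$ at $z$ with $|\eta|=1$ and $\eta_{n+1}>0$. Moreover $A'_a(\Gamma;C)=\{z': (z,\eta)\in A_a(\Gamma;C)\text{ for some }\eta\in\mathbf{S}^n\}\subseteq\mathbf{R}^n$. *)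

theory Defs
  imports "HOL-Analysis.Analysis" "HOL-Library.Multiset"
begin

text \<open>
  \<open>\<R>\<^sup>n\<close> is \<open>real ^ 'n\<close> with \<open>n = CARD('n)\<close>, and \<open>\<R>\<^sup>n\<^sup>+\<^sup>1 = \<R>\<^sup>n \<times> \<R>\<close> is the product type
  \<open>(real ^ 'n) \<times> real\<close>, whose norm and inner product are the Euclidean ones;
  \<open>z' = fst z\<close> and \<open>z\<^sub>n\<^sub>+\<^sub>1 = snd z\<close>.
\<close>


subsection \<open>Hausdorff measure\<close>

text \<open>
  The factor \<open>unit_ball_vol d\<close> is the normalisation for which the measure coincides with Lebesgue
  measure on \<open>d\<close>-dimensional Euclidean space.  Intended for \<open>d \<ge> 1\<close>, where empty covering
  sets contribute \<open>0\<close>.  The sets are required to be bounded because \<open>diameter\<close> is not meaningful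
  for unbounded sets.
\<close>

definition hausdorff_premeasure :: "nat \<Rightarrow> real \<Rightarrow> 'a::metric_space set \<Rightarrow> ennreal" where
  "hausdorff_premeasure d \<delta> A =
     (INF E \<in> {E :: nat \<Rightarrow> 'a set. A \<subseteq> (\<Union>i. E i) \<and> (\<forall>i. bounded (E i) \<and> diameter (E i) \<le> \<delta>)}.
        \<Sum>i. ennreal (unit_ball_vol (real d) * (diameter (E i) / 2) ^ d))"

definition hausdorff_measure :: "nat \<Rightarrow> 'a::metric_space set \<Rightarrow> ennreal" where
  "hausdorff_measure d A = (SUP \<delta> \<in> {0<..}. hausdorff_premeasure d \<delta> A)"


subsection \<open>Functions of class \<open>C\<^sup>2\<close> and eigenvalues of the Hessian\<close>

text \<open>\<open>f\<close> is of class \<open>C\<^sup>2\<close> on the open set \<open>U\<close>, with gradient \<open>g\<close> and Hessian \<open>H\<close> there.\<close>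

definition C2_on ::
  "'a::euclidean_space set \<Rightarrow> ('a \<Rightarrow> real) \<Rightarrow> ('a \<Rightarrow> 'a) \<Rightarrow> ('a \<Rightarrow> 'a \<Rightarrow>\<^sub>L 'a) \<Rightarrow> bool" where
  "C2_on U f g H \<longleftrightarrow>
     open U \<and>
     (\<forall>y\<in>U. GDERIV f y :> g y) \<and>
     (\<forall>y\<in>U. (g has_derivative blinfun_apply (H y)) (at y)) \<and>
     continuous_on U H"

text \<open>
  The eigenvalues in increasing order, each repeated according to the dimension of its eigenspace.
  For a self-adjoint operator this is the algebraic multiplicity, and the list has
  length \<open>DIM('a)\<close>.
\<close>

definition eigenvalue_list :: "('a::euclidean_space \<Rightarrow> 'a) \<Rightarrow> real list" where
  "eigenvalue_list L =
     (THE ls. sorted ls \<and> (\<forall>c. count_list ls c = dim {v. L v = c *\<^sub>R v}))"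

lemma eigenvalue_list_ex1:
  fixes L :: "'a::euclidean_space \<Rightarrow> 'a"
  assumes "\<And>v w. L v \<bullet> w = v \<bullet> L w"
  shows "\<exists>!ls. sorted ls \<and> (\<forall>c. count_list ls c = dim {v. L v = c *\<^sub>R v})"
proof -
  define S where "S c = {v. L v = c *\<^sub>R v}" for c
  define E where "E = {c. dim (S c) \<noteq> 0}"
  have "\<exists>v. v \<noteq> 0 \<and> v \<in> S c" if "c \<in> E" for c
    using that by (auto simp: E_def)
  then have "\<forall>c\<in>E. \<exists>v. v \<noteq> 0 \<and> L v = c *\<^sub>R v"
    unfolding S_def by blast
  then obtain w where w: "\<And>c. c \<in> E \<Longrightarrow> w c \<noteq> 0 \<and> L (w c) = c *\<^sub>R w c"
    using bchoice[of E "\<lambda>c v. v \<noteq> 0 \<and> L v = c *\<^sub>R v"] by blast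
  have ortho: "w c \<bullet> w d = 0" if "c \<in> E" "d \<in> E" "c \<noteq> d" for c d
  proof -
    have "c * (w c \<bullet> w d) = d * (w c \<bullet> w d)"
      using assms[of "w c" "w d"] w that by simp
    then show ?thesis using that by simp
  qed
  have inj: "inj_on w E"
  proof (rule inj_onI)
    fix c d assume cd: "c \<in> E" "d \<in> E" "w c = w d"
    show "c = d"
    proof (rule ccontr)
      assume "c \<noteq> d"
      from ortho[OF cd(1,2) this] cd(3) have "w d = 0" by simp
      then show False using w[OF cd(2)] by simp
    qed
  qed
  have "pairwise orthogonal (w ` E)"
    unfolding pairwise_def orthogonal_def using ortho by auto
  moreover have "0 \<notin> w ` E" using w by auto
  ultimately have "finite (w ` E)"
    using pairwise_orthogonal_independent independent_imp_finite by blast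
  then have fin: "finite E" using inj finite_imageD by blast
  define M where "M = Abs_multiset (\<lambda>c. dim (S c))"
  have cnt: "count M c = dim (S c)" for c
    unfolding M_def using fin
    by (subst count_Abs_multiset) (simp_all only: E_def neq0_conv)
  have cl: "count_list xs c = count (mset xs) c" for xs :: "real list" and c
    by (induction xs) auto
  show ?thesis
  proof (rule ex1I[of _ "sorted_list_of_multiset M"])
    show "sorted (sorted_list_of_multiset M) \<and>
      (\<forall>c. count_list (sorted_list_of_multiset M) c = dim {v. L v = c *\<^sub>R v})"
      using cnt by (simp add: cl S_def)
  next
    fix ls :: "real list" assume a: "sorted ls \<and> (\<forall>c. count_list ls c = dim {v. L v = c *\<^sub>R v})"
    then have "mset ls = M" by (intro multiset_eqI) (simp add: cnt S_def flip: cl)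
    then show "ls = sorted_list_of_multiset M"
      using a by (auto simp: sorted_sort_id)
  qed
qed

definition lower_trace :: "nat \<Rightarrow> ('a::euclidean_space \<Rightarrow> 'a) \<Rightarrow> real" where
  "lower_trace m L = sum_list (take m (eigenvalue_list L))"


subsection \<open>\<open>(n,h)\<close> subsets\<close>

definition nh_subset ::
  "real \<Rightarrow> ((real ^ 'n) \<times> real) set \<Rightarrow> ((real ^ 'n) \<times> real) set \<Rightarrow> bool" where
  "nh_subset h \<Omega> \<Gamma> \<longleftrightarrow>
     0 \<le> h \<and> open \<Omega> \<and> closedin (top_of_set \<Omega>) \<Gamma> \<and>
     (\<forall>x\<in>\<Gamma>. \<forall>U f g H.
        x \<in> U \<longrightarrow> C2_on U f g H \<longrightarrow>
        (\<forall>\<^sub>F y in at x within \<Gamma>. f y \<le> f x) \<longrightarrow>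
        g x \<noteq> 0 \<longrightarrow>
        lower_trace CARD('n) (blinfun_apply (H x)) \<le> h * norm (g x))"

definition unit_cylinder :: "((real ^ 'n) \<times> real) set" where
  "unit_cylinder = {z. norm (fst z) < 1}"


subsection \<open>Touching paraboloids\<close>

definition graph_of :: "('a \<Rightarrow> real) \<Rightarrow> ('a \<times> real) set" where
  "graph_of f = {(x, y). y = f x}"

definition supergraph :: "('a \<Rightarrow> real) \<Rightarrow> ('a \<times> real) set" where
  "supergraph f = {(x, y). y > f x}"

definition touches_from_above :: "('a \<Rightarrow> real) \<Rightarrow> ('a \<times> real) set \<Rightarrow> bool" where
  "touches_from_above f K \<longleftrightarrow> graph_of f \<inter> K \<noteq> {} \<and> supergraph f \<inter> K = {}"

definition paraboloid :: "real \<Rightarrow> 'a::real_normed_vector \<Rightarrow> real \<Rightarrow> 'a \<Rightarrow> real" where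
  "paraboloid a x t y = a / 2 * (norm (y - x))\<^sup>2 + t"

text \<open>Orthogonality to the tangent space of the graph of a differentiable \<open>f\<close> at \<open>z\<close>.\<close>

definition normal_to_graph :: "('a::real_inner \<Rightarrow> real) \<Rightarrow> 'a \<times> real \<Rightarrow> 'a \<times> real \<Rightarrow> bool" where
  "normal_to_graph f z \<eta> \<longleftrightarrow> (\<forall>v. \<eta> \<bullet> (v, frechet_derivative f (at (fst z)) v) = 0)"

text \<open>
  For given \<open>a\<close> and \<open>x\<close> at most one \<open>t\<close> satisfies the touching condition below, so
  \<open>paraboloid a x t\<close> is the touching paraboloid of opening \<open>a\<close> and center \<open>x\<close>, if there is one.
\<close>

definition touching_set ::
  "real \<Rightarrow> ((real ^ 'n) \<times> real) set \<Rightarrow> (real ^ 'n) set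
     \<Rightarrow> (((real ^ 'n) \<times> real) \<times> ((real ^ 'n) \<times> real)) set" where
  "touching_set a \<Gamma> C =
     {(z, \<eta>). \<exists>x\<in>C. \<exists>t.
        touches_from_above (paraboloid a x t) (closure \<Gamma>) \<and>
        z \<in> graph_of (paraboloid a x t) \<inter> closure \<Gamma> \<and>
        normal_to_graph (paraboloid a x t) z \<eta> \<and> norm \<eta> = 1 \<and> snd \<eta> > 0}"

definition touching_set_proj ::
  "real \<Rightarrow> ((real ^ 'n) \<times> real) set \<Rightarrow> (real ^ 'n) set \<Rightarrow> (real ^ 'n) set" where
  "touching_set_proj a \<Gamma> C = {fst z |z. \<exists>\<eta> \<in> sphere 0 1. (z, \<eta>) \<in> touching_set a \<Gamma> C}"

end

theory Submission
  imports Defs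
begin

text \<open>
  Let \<open>K\<close> be the closure of \<open>\<Gamma>\<close> and \<open>v z = z\<^sub>n\<^sub>+\<^sub>1 / a - norm z' ^ 2 / 2\<close>.  The paraboloid of center \<open>x\<close> touches
  \<open>K\<close> at \<open>z\<close> exactly when \<open>z\<close> maximises \<open>v z + z' \<bullet> x\<close> over \<open>K\<close>.  The maximum \<open>W x\<close> is a convex function of
  \<open>x\<close>, and \<open>z'\<close> is a subgradient of \<open>W\<close> at the center \<open>x\<close>.  So the theorem is a lower bound for the
  Lebesgue measure of the image of \<open>C\<close> under the multivalued gradient of \<open>W\<close>.

  To differentiate this relation it is parametrised by \<open>p = x + z'\<close>.  With the proximal map of \<open>W\<close>
  one has \<open>x = prox p\<close> and \<open>z' = resid p = p - prox p\<close>, and both maps are Lipschitz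
  (\<open>resid_lipschitz\<close>).  Moreover \<open>resid\<close> is the gradient of the Moreau envelope \<open>env\<close>.  By Rademacher's
  theorem \<open>resid\<close> is differentiable at almost every \<open>p\<close>; its derivative \<open>A\<close> is symmetric with
  eigenvalues \<open>g i\<close> in \<open>[0,1]\<close>, and that of \<open>prox\<close> is \<open>1 - A\<close>.  Lipschitz maps preserve null sets, so by
  the area formula (\<open>emeasure_image_le_eigenvalues\<close>) everything reduces to the pointwise estimate
  \<open>\<Prod> (1 - g i) \<le> c * \<Prod> g i\<close> at points where \<open>resid\<close> is differentiable; it comes with
  \<open>g i > 0\<close>, which makes \<open>resid\<close> injective on these points (\<open>resid_inj_at\<close>).

  The pointwise estimate (\<open>contact_eigenvalue_product\<close>) comes from the \<open>(n,h)\<close> condition.  The envelope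
  satisfies \<open>v y \<le> env p - y' \<bullet> p + norm y' ^ 2 / 2\<close> for all \<open>y \<in> K\<close> and all \<open>p\<close>, with equality at the contact
  point.  Inserting the second-order expansion of \<open>env\<close> and choosing the best \<open>p\<close> for each \<open>y'\<close> produces a
  quadratic function of \<open>y'\<close> that touches \<open>\<Gamma>\<close> from above and whose Hessian is
  \<open>a (2 - A\<^sup>-\<^sup>1)\<close>, after replacing \<open>A\<close> by \<open>A + 2 \<epsilon>\<close>.  The \<open>(n,h)\<close> condition bounds minus its tangential
  trace (\<open>nh_subset_touching_trace\<close>).  The bound is independent of \<open>\<epsilon>\<close>, which forces \<open>g i > 0\<close>, and it
  controls a weighted sum of the \<open>1 / g i - 1\<close>, hence their product.

  Rademacher's theorem is deduced from the differentiability of Lipschitz functions on lines and from the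
  fact that porous points of a closed set form a null set (\<open>negligible_porous\<close>).  Hausdorff and
  Lebesgue measure are compared in \<open>hausdorff_measure_le_if_lebesgue_le\<close>: the same constant appears in
  the bounds from below and from above, and so it cancels.
\<close>

section \<open>Fine coverings by balls\<close>

abbreviation finely_covered :: "('a::metric_space \<Rightarrow> real \<Rightarrow> bool) \<Rightarrow> 'a set" where
  "finely_covered Q \<equiv> {x. \<forall>d>0. \<exists>y r. 0 < r \<and> r < d \<and> x \<in> ball y r \<and> Q y r}"

lemma finely_covered_in_borel:
  fixes Q :: "'a::euclidean_space \<Rightarrow> real \<Rightarrow> bool"
  shows "finely_covered Q \<in> sets borel"
proof -
  define O' where "O' n = \<Union>{ball y r | y r. 0 < r \<and> r < 1 / real (Suc n) \<and> Q y r}" for n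
  have "finely_covered Q = (\<Inter>n. O' n)"
  proof (intro equalityI subsetI)
    fix x assume x: "x \<in> finely_covered Q"
    show "x \<in> (\<Inter>n. O' n)"
    proof
      fix n
      have "0 < 1 / real (Suc n)" by simp
      then show "x \<in> O' n" using x unfolding O'_def by blast
    qed
  next
    fix x assume x: "x \<in> (\<Inter>n. O' n)"
    show "x \<in> finely_covered Q"
    proof (intro CollectI allI impI)
      fix d :: real assume "d > 0"
      then obtain n where n: "1 / real (Suc n) < d"
        using reals_Archimedean inverse_eq_divide by metis
      have "x \<in> O' n" using x by blast
      then obtain y r where "x \<in> ball y r" "0 < r" "r < 1 / real (Suc n)" "Q y r"
        unfolding O'_def by blast
      then show "\<exists>y r. 0 < r \<and> r < d \<and> x \<in> ball y r \<and> Q y r"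
        using n by (meson less_trans)
    qed
  qed
  moreover have "open (O' n)" for n
    unfolding O'_def by (rule open_Union) auto
  ultimately show ?thesis by auto
qed

text \<open>
  An inequality between two measures on arbitrarily small balls around the points of \<open>P\<close> passes to an
  open set that contains almost all of \<open>P\<close>: by Vitali's theorem these balls contain a countable
  disjoint family covering almost all of \<open>P\<close>, and both measures are additive on it.  The set \<open>U\<close>
  serves to keep the open set close to \<open>P\<close>.
\<close>

lemma Vitali_measure_comparison:
  fixes P :: "'a::euclidean_space set"
  assumes M: "sets M = sets borel" and N: "sets N = sets borel"
    and U: "open U" "P \<subseteq> U"
    and cov: "\<And>x d. x \<in> P \<Longrightarrow> d > 0 \<Longrightarrow>
      \<exists>y r. 0 < r \<and> r < d \<and> x \<in> ball y r \<and> emeasure M (ball y r) \<le> c * emeasure N (ball y r)"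
  obtains V where "open V" "V \<subseteq> U" "negligible (P - V)" "emeasure M V \<le> c * emeasure N V"
proof -
  define K where "K = {i :: 'a \<times> real. ball (fst i) (snd i) \<subseteq> U \<and>
    emeasure M (ball (fst i) (snd i)) \<le> c * emeasure N (ball (fst i) (snd i))}"
  obtain C where C: "countable C" "C \<subseteq> K"
    "pairwise (\<lambda>i j. disjnt (ball (fst i) (snd i)) (ball (fst j) (snd j))) C"
    "negligible (P - (\<Union>i\<in>C. ball (fst i) (snd i)))"
  proof (rule Vitali_covering_theorem_balls[of P K fst snd])
    fix x and d :: real assume x: "x \<in> P" and d: "0 < d"
    obtain e where e: "e > 0" "ball x e \<subseteq> U" using U x openE by blast
    obtain y r where yr: "0 < r" "r < min d (e/2)" "x \<in> ball y r"
      "emeasure M (ball y r) \<le> c * emeasure N (ball y r)"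
      using cov[OF x, of "min d (e/2)"] d e by auto
    have "ball y r \<subseteq> ball x e"
    proof
      fix z assume "z \<in> ball y r"
      then have "dist y z < r" "dist y x < r" using yr(3) by (auto simp: dist_commute)
      then have "dist x z < r + r" using dist_triangle[of x z y] by (simp add: dist_commute)
      then show "z \<in> ball x e" using yr(2) by simp
    qed
    then show "\<exists>i. i \<in> K \<and> x \<in> ball (fst i) (snd i) \<and> snd i < d"
      using yr e unfolding K_def by (intro exI[of _ "(y, r)"]) auto
  qed
  have disj: "disjoint_family_on (\<lambda>i. ball (fst i) (snd i)) C"
    using C(3) unfolding disjoint_family_on_def pairwise_def disjnt_def by blast
  let ?V = "\<Union>i\<in>C. ball (fst i) (snd i)"
  show ?thesis
  proof
    show "open ?V" by auto
    show "?V \<subseteq> U" using C(2) K_def by auto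
    show "negligible (P - ?V)" by (rule C(4))
    have "emeasure M ?V = (\<integral>\<^sup>+i. emeasure M (ball (fst i) (snd i)) \<partial>count_space C)"
      using C(1) disj by (intro emeasure_UN_countable) (auto simp: M)
    also have "\<dots> \<le> (\<integral>\<^sup>+i. c * emeasure N (ball (fst i) (snd i)) \<partial>count_space C)"
      by (intro nn_integral_mono) (use C(2) K_def in auto)
    also have "\<dots> = c * (\<integral>\<^sup>+i. emeasure N (ball (fst i) (snd i)) \<partial>count_space C)"
      by (intro nn_integral_cmult) auto
    also have "(\<integral>\<^sup>+i. emeasure N (ball (fst i) (snd i)) \<partial>count_space C) = emeasure N ?V"
      using C(1) disj by (intro emeasure_UN_countable[symmetric]) (auto simp: N)
    finally show "emeasure M ?V \<le> c * emeasure N ?V" .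
  qed
qed

lemma emeasure_le_of_negligible_diff:
  assumes "P \<in> sets borel" "V \<in> sets borel" "negligible (P - V)"
  shows "emeasure lborel P \<le> emeasure lborel (P \<inter> V)"
proof -
  have "P - V \<in> null_sets lborel"
    using assms by (auto simp: null_sets_completion_iff negligible_iff_null_sets)
  then have "emeasure lborel ((P \<inter> V) \<union> (P - V)) = emeasure lborel (P \<inter> V)"
    using assms by (intro emeasure_Un_null_set) auto
  moreover have "(P \<inter> V) \<union> (P - V) = P" by blast
  ultimately show ?thesis by simp
qed

text \<open>
  Outer regularity lets \<open>U\<close> shrink to \<open>P\<close>, so that \<open>q |P| \<le> p |P|\<close> with \<open>p < q\<close>.
\<close>

lemma negligible_if_open_superset_ratio:
  fixes P :: "'a::euclidean_space set"
  assumes P: "P \<in> sets borel" "bounded P" and pq: "0 \<le> p" "p < q"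
    and le: "\<And>U. open U \<Longrightarrow> P \<subseteq> U \<Longrightarrow> ennreal q * emeasure lborel P \<le> ennreal p * emeasure lborel U"
  shows "negligible P"
proof -
  have fin: "emeasure lborel P < \<infinity>" using P(2) by (rule emeasure_bounded_finite)
  define m where "m = measure lborel P"
  have m: "emeasure lborel P = ennreal m" "m \<ge> 0"
    using fin by (auto simp: m_def emeasure_eq_ennreal_measure)
  have "q * m \<le> p * (m + e)" if e: "e > 0" for e
  proof -
    obtain U where U: "open U" "P \<subseteq> U" "emeasure lborel (U - P) < e"
      using outer_regular_lborel[OF P(1) e] by blast
    have "emeasure lborel U = emeasure lborel P + emeasure lborel (U - P)"
      using U P by (subst plus_emeasure) (auto intro!: arg_cong2[where f=emeasure])
    also have "\<dots> \<le> ennreal (m + e)"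
      using U(3) m e by (simp add: ennreal_plus)
    finally have "ennreal q * ennreal m \<le> ennreal p * ennreal (m + e)"
      using le[OF U(1,2)] m by (metis mult_left_mono order_trans zero_le)
    then have "ennreal (q * m) \<le> ennreal (p * (m + e))"
      using pq m e by (simp add: ennreal_mult)
    then show ?thesis using pq m e by (simp add: ennreal_le_iff)
  qed
  then have *: "(q - p) * m \<le> p * e" if "e > 0" for e using that by (simp add: algebra_simps)
  have "(q - p) * m \<le> 0"
  proof (rule field_le_epsilon)
    fix e :: real assume "e > 0"
    have "(q - p) * m \<le> p * (e / (p + 1))" by (rule *) (use pq \<open>e > 0\<close> in simp)
    also have "\<dots> \<le> e" using pq \<open>e > 0\<close> by (simp add: field_simps)
    finally show "(q - p) * m \<le> 0 + e" by simp
  qed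
  then have "m = 0" using pq m by (simp add: mult_le_0_iff)
  then show ?thesis using m P by (auto simp: negligible_iff_null_sets null_sets_completion_iff null_sets_def)
qed

lemma negligible_from_balls:
  fixes P :: "'a::euclidean_space set"
  assumes "\<And>R::nat. negligible (P \<inter> ball 0 (real R))"
  shows "negligible P"
proof -
  have "P = (\<Union>R::nat. P \<inter> ball 0 (real R))"
    using reals_Archimedean2 by auto
  moreover have "negligible (\<Union>R::nat. P \<inter> ball 0 (real R))"
    using assms by (intro negligible_countable_Union) auto
  ultimately show ?thesis by simp
qed

text \<open>
  At a point of this set \<open>E\<close> misses a fixed proportion of arbitrarily small balls, hence fills at
  most the fraction \<open>1 - \<delta> ^ DIM('a)\<close> of them; at a density point of \<open>E\<close> this is impossible.
\<close>

lemma negligible_porous: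
  fixes E :: "'a::euclidean_space set"
  assumes "closed E" "0 < \<delta>" "\<delta> \<le> 1"
  shows "negligible (E \<inter> finely_covered (\<lambda>y r. ball y (\<delta> * r) \<inter> E = {}))"
    (is "negligible (E \<inter> ?P)")
proof (rule negligible_from_balls)
  fix R :: nat
  let ?B = "E \<inter> ?P \<inter> ball 0 (real R)"
  define p where "p = 1 - \<delta> ^ DIM('a)"
  have p: "0 \<le> p" "p < 1" using assms by (auto simp: p_def power_le_one)
  let ?M = "density lborel (indicator E)"
  have PB: "?P \<in> sets borel" by (rule finely_covered_in_borel)
  have EB: "E \<in> sets borel" using assms(1) by auto
  show "negligible ?B"
  proof (rule negligible_if_open_superset_ratio[OF _ _ p])
    show B: "?B \<in> sets borel" using PB EB by auto
    show "bounded ?B" by (rule bounded_subset[of "ball 0 (real R)"]) auto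
    fix U :: "'a set" assume U: "open U" "?B \<subseteq> U"
    obtain V where V: "open V" "V \<subseteq> U" "negligible (?B - V)"
      "emeasure ?M V \<le> ennreal p * emeasure lborel V"
    proof (rule Vitali_measure_comparison[of ?M lborel U ?B])
      fix x and d :: real assume x: "x \<in> ?B" and d: "d > 0"
      then obtain y r where yr: "0 < r" "r < d" "x \<in> ball y r" "ball y (\<delta> * r) \<inter> E = {}" by blast
      have sub: "ball y (\<delta> * r) \<subseteq> ball y r" using assms yr by (intro subset_ball) (simp add: mult_left_le_one_le)
      have "emeasure ?M (ball y r) = emeasure lborel (E \<inter> ball y r)"
        using EB by (intro emeasure_restricted) auto
      also have "\<dots> \<le> emeasure lborel (ball y r - ball y (\<delta> * r))"
        using yr(4) by (intro emeasure_mono) auto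
      also have "\<dots> = emeasure lborel (ball y r) - emeasure lborel (ball y (\<delta> * r))"
        using sub emeasure_lborel_ball_finite[of y "\<delta> * r"] by (intro emeasure_Diff) auto
      also have "\<dots> = ennreal (unit_ball_vol DIM('a) * r ^ DIM('a) - unit_ball_vol DIM('a) * (\<delta> * r) ^ DIM('a))"
        using yr assms by (simp add: emeasure_ball ennreal_minus)
      also have "\<dots> = ennreal p * emeasure lborel (ball y r)"
        using yr p by (simp add: emeasure_ball p_def power_mult_distrib algebra_simps flip: ennreal_mult)
      finally show "\<exists>y r. 0 < r \<and> r < d \<and> x \<in> ball y r \<and>
          emeasure ?M (ball y r) \<le> ennreal p * emeasure lborel (ball y r)"
        using yr by blast
    qed (use U in auto)
    have "ennreal 1 * emeasure lborel ?B \<le> emeasure lborel (?B \<inter> V)"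
      using emeasure_le_of_negligible_diff[OF B _ V(3)] V(1) by simp
    also have "\<dots> \<le> emeasure lborel (E \<inter> V)"
      using EB V(1) by (intro emeasure_mono) auto
    also have "\<dots> = emeasure ?M V" using EB V(1) by (subst emeasure_restricted) auto
    also have "\<dots> \<le> ennreal p * emeasure lborel V" by (rule V(4))
    also have "\<dots> \<le> ennreal p * emeasure lborel U"
      using V(2) U(1) by (intro mult_left_mono emeasure_mono) auto
    finally show "ennreal 1 * emeasure lborel ?B \<le> ennreal p * emeasure lborel U" .
  qed
qed

section \<open>Slopes of Lipschitz functions on the line\<close>

lemma emeasure_interval_measure_ball:
  assumes mono: "\<And>x y. x \<le> y \<Longrightarrow> F x \<le> F y" and cont: "continuous_on UNIV F" and "0 < r"
  shows "emeasure (interval_measure F) (ball c r) = ennreal (F (c + r) - F (c - r))"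
proof -
  let ?M = "interval_measure F"
  have rc: "continuous (at_right a) F" for a
    using cont by (auto intro: continuous_within_subset simp: continuous_on_eq_continuous_within)
  have pt: "emeasure ?M {c + r} = 0"
    using emeasure_interval_measure_Icc[of "c+r" "c+r", OF _ mono cont] by simp
  have "ball c r = {c - r<..c + r} - {c + r}"
    using assms(3) by (auto simp: ball_def dist_real_def)
  moreover have "emeasure ?M ({c - r<..c + r} - {c + r}) = emeasure ?M {c - r<..c + r}"
    using pt by (intro emeasure_Diff_null_set) auto
  ultimately show ?thesis
    using emeasure_interval_measure_Ioc[of "c-r" "c+r" F, OF _ mono rc] assms(3) by simp
qed

text \<open>
  This is the core of Lebesgue's differentiation theorem.  The Stieltjes measure \<open>\<mu>\<close> of \<open>F\<close> satisfies
  \<open>\<mu> \<le> p\<cdot>Lebesgue\<close> on an open set containing almost all of the exceptional set, and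
  \<open>\<mu> \<ge> q\<cdot>Lebesgue\<close> on a smaller open set that still contains almost all of it.
\<close>

lemma negligible_slope_oscillation:
  fixes F :: "real \<Rightarrow> real"
  assumes mono: "\<And>x y. x \<le> y \<Longrightarrow> F x \<le> F y" and cont: "continuous_on UNIV F"
    and pq: "0 \<le> p" "p < q"
  shows "negligible (finely_covered (\<lambda>y r. F (y + r) - F (y - r) \<le> p * (2 * r))
    \<inter> finely_covered (\<lambda>y r. q * (2 * r) \<le> F (y + r) - F (y - r)))"
    (is "negligible (?P \<inter> ?Q)")
proof (rule negligible_from_balls)
  fix R :: nat
  let ?B = "?P \<inter> ?Q \<inter> ball 0 (real R)"
  let ?M = "interval_measure F"
  have PQ: "?P \<in> sets borel" "?Q \<in> sets borel" by (rule finely_covered_in_borel)+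
  have lb: "emeasure lborel (ball y r) = ennreal (2 * r)" if "r > 0" for y r :: real
    using that by (simp add: emeasure_ball)
  show "negligible ?B"
  proof (rule negligible_if_open_superset_ratio[OF _ _ pq])
    show B: "?B \<in> sets borel" using PQ by auto
    show "bounded ?B" by (rule bounded_subset[of "ball 0 (real R)"]) auto
    fix U :: "real set" assume U: "open U" "?B \<subseteq> U"
    obtain V where V: "open V" "V \<subseteq> U" "negligible (?B - V)"
      "emeasure ?M V \<le> ennreal p * emeasure lborel V"
    proof (rule Vitali_measure_comparison[of ?M lborel U ?B])
      fix x and d :: real assume x: "x \<in> ?B" and d: "d > 0"
      then obtain y r where yr: "0 < r" "r < d" "x \<in> ball y r" "F (y + r) - F (y - r) \<le> p * (2 * r)" by blast
      then have "emeasure ?M (ball y r) \<le> ennreal p * emeasure lborel (ball y r)"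
        using pq by (simp add: emeasure_interval_measure_ball[OF mono cont] lb ennreal_leI flip: ennreal_mult)
      with yr show "\<exists>y r. 0 < r \<and> r < d \<and> x \<in> ball y r \<and>
          emeasure ?M (ball y r) \<le> ennreal p * emeasure lborel (ball y r)" by blast
    qed (use U in auto)
    obtain V' where V': "open V'" "V' \<subseteq> V" "negligible (?B \<inter> V - V')"
      "emeasure (density lborel (\<lambda>_. ennreal q)) V' \<le> 1 * emeasure ?M V'"
    proof (rule Vitali_measure_comparison[of "density lborel (\<lambda>_. ennreal q)" ?M V "?B \<inter> V"])
      fix x and d :: real assume x: "x \<in> ?B \<inter> V" and d: "d > 0"
      then obtain y r where yr: "0 < r" "r < d" "x \<in> ball y r" "q * (2 * r) \<le> F (y + r) - F (y - r)" by blast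
      then have "emeasure (density lborel (\<lambda>_. ennreal q)) (ball y r) \<le> 1 * emeasure ?M (ball y r)"
        using pq by (simp add: emeasure_interval_measure_ball[OF mono cont] emeasure_density_const lb ennreal_leI flip: ennreal_mult)
      with yr show "\<exists>y r. 0 < r \<and> r < d \<and> x \<in> ball y r \<and>
          emeasure (density lborel (\<lambda>_. ennreal q)) (ball y r) \<le> 1 * emeasure ?M (ball y r)" by blast
    qed (use V in auto)
    have "emeasure lborel ?B \<le> emeasure lborel (?B \<inter> V)"
      using emeasure_le_of_negligible_diff[OF B _ V(3)] V(1) by simp
    also have "\<dots> \<le> emeasure lborel (?B \<inter> V \<inter> V')"
      using B V(1) V'(1,3) by (intro emeasure_le_of_negligible_diff) auto
    also have "\<dots> \<le> emeasure lborel V'" using V'(1) by (intro emeasure_mono) auto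
    finally have "ennreal q * emeasure lborel ?B \<le> ennreal q * emeasure lborel V'"
      by (intro mult_left_mono) auto
    also have "\<dots> \<le> emeasure ?M V'" using V'(1,4) by (simp add: emeasure_density_const)
    also have "\<dots> \<le> emeasure ?M V" using V'(1,2) V(1) by (intro emeasure_mono) auto
    also have "\<dots> \<le> ennreal p * emeasure lborel V" by (rule V(4))
    also have "\<dots> \<le> ennreal p * emeasure lborel U"
      using V(2) U(1) by (intro mult_left_mono emeasure_mono) auto
    finally show "ennreal q * emeasure lborel ?B \<le> ennreal p * emeasure lborel U" .
  qed
qed

text \<open>
  The slopes are compared with the grid \<open>\<epsilon> * k\<close>.  Outside countably many negligible sets a point has,
  for each \<open>k\<close>, either all small difference quotients above \<open>\<epsilon> * k\<close> or all of them below
  \<open>\<epsilon> * (k + 1)\<close>.  If \<open>k\<close> is the first index for which they stay below \<open>\<epsilon> * k\<close>, then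
  \<open>\<epsilon> * (k - 1)\<close> is the slope up to \<open>\<epsilon>\<close>.
  The accuracy is kept fixed because only countably many accuracies are needed later.
\<close>

lemma negligible_no_slope_mono:
  fixes F :: "real \<Rightarrow> real"
  assumes mono: "\<And>x y. x \<le> y \<Longrightarrow> F x \<le> F y"
    and lip: "\<And>x y. \<bar>F x - F y\<bar> \<le> L * \<bar>x - y\<bar>" and e: "\<epsilon> > 0"
  shows "negligible {t. \<not> (\<exists>q. \<exists>d>0. \<forall>s. \<bar>s\<bar> < d \<longrightarrow> \<bar>F (t + s) - F t - q * s\<bar> \<le> \<epsilon> * \<bar>s\<bar>)}"
    (is "negligible ?N")
proof -
  have "L-lipschitz_on UNIV F"
    by (rule lipschitz_onI) (use lip[of 1 0] lip in \<open>auto simp: dist_real_def\<close>)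
  then have cont: "continuous_on UNIV F" by (rule lipschitz_on_continuous_on)
  define P where "P p = finely_covered (\<lambda>y r. F (y + r) - F (y - r) \<le> p * (2 * r))" for p
  define Q where "Q q = finely_covered (\<lambda>y r. q * (2 * r) \<le> F (y + r) - F (y - r))" for q
  define E where "E k = P (\<epsilon> * real k) \<inter> Q (\<epsilon> * real (Suc k))" for k :: nat
  have neg: "negligible (E k)" for k
    unfolding E_def P_def Q_def
    by (rule negligible_slope_oscillation[OF mono cont]) (use e in auto)
  have "?N \<subseteq> (\<Union>k. E k)"
  proof (rule ccontr)
    assume "\<not> ?N \<subseteq> (\<Union>k. E k)"
    then obtain t where t: "t \<in> ?N" "\<And>k. t \<notin> E k" by blast
    have alt: "t \<notin> P (\<epsilon> * real k) \<or> t \<notin> Q (\<epsilon> * real (Suc k))" for k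
      using t(2)[of k] by (auto simp: E_def)
    obtain m :: nat where m: "L < \<epsilon> * real m"
      using reals_Archimedean3[OF e] by (metis mult.commute)
    have mQ: "t \<notin> Q (\<epsilon> * real m)"
    proof
      assume "t \<in> Q (\<epsilon> * real m)"
      then obtain y r where yr: "0 < r" "\<epsilon> * real m * (2 * r) \<le> F (y + r) - F (y - r)"
        unfolding Q_def by (auto dest!: spec[of _ 1])
      have "F (y + r) - F (y - r) \<le> L * (2 * r)"
        using lip[of "y + r" "y - r"] yr(1) by simp
      then have "\<epsilon> * real m * (2 * r) \<le> L * (2 * r)" using yr by linarith
      then show False using m yr(1) by simp
    qed
    define k where "k = (LEAST k. t \<notin> Q (\<epsilon> * real k))"
    have k: "t \<notin> Q (\<epsilon> * real k)" unfolding k_def using mQ by (rule LeastI[of "\<lambda>k. t \<notin> Q (\<epsilon> * real k)"])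
    have kl: "t \<in> Q (\<epsilon> * real j)" if "j < k" for j using not_less_Least that k_def by blast
    have k0: "k \<noteq> 0"
    proof
      assume "k = 0"
      moreover have "t \<in> Q 0"
        unfolding Q_def
      proof (intro CollectI allI impI)
        fix d :: real assume "d > 0"
        then show "\<exists>y r. 0 < r \<and> r < d \<and> t \<in> ball y r \<and> 0 * (2 * r) \<le> F (y + r) - F (y - r)"
          by (intro exI[of _ t] exI[of _ "d/2"]) (auto intro: mono)
      qed
      ultimately show False using k by simp
    qed
    define q where "q = \<epsilon> * real (k - 1)"
    have qk: "\<epsilon> * real k = q + \<epsilon>" using k0 by (cases k) (auto simp: q_def algebra_simps)
    \<comment> \<open>all small balls containing \<open>t\<close> have quotients between \<open>q - \<epsilon>\<close> and \<open>q + \<epsilon>\<close>\<close>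
    obtain d1 where d1: "d1 > 0" "\<And>y r. 0 < r \<Longrightarrow> r < d1 \<Longrightarrow> t \<in> ball y r \<Longrightarrow>
        F (y + r) - F (y - r) \<le> (q + \<epsilon>) * (2 * r)"
      using k unfolding Q_def qk by (smt (verit) mem_Collect_eq)
    obtain d2 where d2: "d2 > 0" "\<And>y r. 0 < r \<Longrightarrow> r < d2 \<Longrightarrow> t \<in> ball y r \<Longrightarrow>
        (q - \<epsilon>) * (2 * r) \<le> F (y + r) - F (y - r)"
    proof (cases "k = 1")
      case True
      then have "q = 0" by (simp add: q_def)
      show ?thesis
      proof (rule that[of 1])
        fix y r :: real assume "0 < r"
        have "(q - \<epsilon>) * (2 * r) \<le> 0" using \<open>q = 0\<close> \<open>0 < r\<close> e by simp
        also have "0 \<le> F (y + r) - F (y - r)" using mono[of "y - r" "y + r"] \<open>0 < r\<close> by simp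
        finally show "(q - \<epsilon>) * (2 * r) \<le> F (y + r) - F (y - r)" .
      qed auto
    next
      case False
      then have k2: "k = Suc (Suc (k - 2))" using k0 by simp
      have "t \<in> Q (\<epsilon> * real (Suc (k - 2)))" using k2 by (intro kl) simp
      then have "t \<notin> P (\<epsilon> * real (k - 2))" using alt by blast
      moreover have "\<epsilon> * real (k - 2) = q - \<epsilon>" using k2 by (subst q_def, subst k2) (simp add: algebra_simps)
      ultimately show ?thesis using that unfolding P_def by (smt (verit) mem_Collect_eq)
    qed
    have fwd: "\<bar>F v - F u - q * (v - u)\<bar> \<le> \<epsilon> * (v - u)"
      if "u < t" "t < v" "v - u < min d1 d2" for u v
    proof -
      let ?y = "(u + v) / 2" and ?r = "(v - u) / 2"
      have 1: "?y + ?r = v" "?y - ?r = u" "2 * ?r = v - u" by (simp_all add: field_simps)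
      have 2: "0 < ?r" "t \<in> ball ?y ?r" "?r < d1" "?r < d2"
        using that by (auto simp: dist_real_def abs_if field_simps)
      have "F v - F u \<le> (q + \<epsilon>) * (v - u)" "(q - \<epsilon>) * (v - u) \<le> F v - F u"
        using d1(2)[OF 2(1,3,2)] d2(2)[OF 2(1,4,2)] unfolding 1 by blast+
      then show ?thesis by (simp add: algebra_simps abs_le_iff)
    qed
    \<comment> \<open>The balls contain \<open>t\<close> in the interior; by continuity \<open>t\<close> may also be an end point.\<close>
    have "\<bar>F v - F u - q * (v - u)\<bar> \<le> \<epsilon> * (v - u)"
      if uv: "u \<le> t" "t \<le> v" "v - u < min d1 d2" for u v
    proof -
      have lim: "((\<lambda>h. \<epsilon> * ((v + h) - (u - h)) - \<bar>F (v + h) - F (u - h) - q * ((v + h) - (u - h))\<bar>)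
         \<longlongrightarrow> \<epsilon> * ((v + 0) - (u - 0)) - \<bar>F (v + 0) - F (u - 0) - q * ((v + 0) - (u - 0))\<bar>) (at_right 0)"
      proof (intro tendsto_intros)
        have ci: "isCont F x" for x using cont by (simp add: continuous_on_eq_continuous_at)
        show "((\<lambda>h. F (v + h)) \<longlongrightarrow> F (v + 0)) (at_right 0)"
          by (rule isCont_tendsto_compose[OF ci]) (intro tendsto_intros)
        show "((\<lambda>h. F (u - h)) \<longlongrightarrow> F (u - 0)) (at_right 0)"
          by (rule isCont_tendsto_compose[OF ci]) (intro tendsto_intros)
      qed
      have ev: "eventually (\<lambda>h. 0 \<le> \<epsilon> * ((v + h) - (u - h)) - \<bar>F (v + h) - F (u - h) - q * ((v + h) - (u - h))\<bar>) (at_right 0)"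
        unfolding eventually_at_right_field
      proof (intro exI[of _ "(min d1 d2 - (v - u)) / 2"] conjI allI impI)
        show "0 < (min d1 d2 - (v - u)) / 2" using uv by simp
        fix h assume h: "0 < h" "h < (min d1 d2 - (v - u)) / 2"
        then have "(v + h) - (u - h) < min d1 d2" by (simp add: field_simps del: min_less_iff_conj)
        with h show "0 \<le> \<epsilon> * ((v + h) - (u - h)) - \<bar>F (v + h) - F (u - h) - q * ((v + h) - (u - h))\<bar>"
          using fwd[of "u - h" "v + h"] uv by (simp add: algebra_simps)
      qed
      show ?thesis using tendsto_lowerbound[OF lim ev] by simp
    qed
    note two = this
    have "\<bar>F (t + s) - F t - q * s\<bar> \<le> \<epsilon> * \<bar>s\<bar>" if "\<bar>s\<bar> < min d1 d2" for s
    proof (cases "s \<ge> 0")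
      case True
      then show ?thesis using two[of t "t + s"] that by simp
    next
      case False
      then show ?thesis using two[of "t + s" t] that by (simp add: abs_minus_commute algebra_simps abs_if split: if_splits)
    qed
    moreover have "min d1 d2 > 0" using d1(1) d2(1) by simp
    ultimately have "t \<notin> ?N" by blast
    then show False using t(1) by blast
  qed
  moreover have "negligible (\<Union>k. E k)" using neg by (intro negligible_countable_Union) auto
  ultimately show ?thesis by (rule negligible_subset[rotated])
qed

lemma negligible_no_slope_Lipschitz:
  fixes F :: "real \<Rightarrow> real"
  assumes lip: "\<And>x y. \<bar>F x - F y\<bar> \<le> L * \<bar>x - y\<bar>" and e: "\<epsilon> > 0"
  shows "negligible {t. \<not> (\<exists>q. \<exists>d>0. \<forall>s. \<bar>s\<bar> < d \<longrightarrow> \<bar>F (t + s) - F t - q * s\<bar> \<le> \<epsilon> * \<bar>s\<bar>)}"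
    (is "negligible ?N")
proof (rule negligible_subset[OF negligible_no_slope_mono[where F="\<lambda>t. F t + L * t" and L="2*L"]])
  have L: "L \<ge> 0" using lip[of 1 0] by simp
  show "F x + L * x \<le> F y + L * y" if "x \<le> y" for x y
    using lip[of x y] that by (simp add: algebra_simps abs_le_iff)
  show "\<bar>F x + L * x - (F y + L * y)\<bar> \<le> 2 * L * \<bar>x - y\<bar>" for x y
  proof -
    have "\<bar>F x + L * x - (F y + L * y)\<bar> \<le> \<bar>F x - F y\<bar> + \<bar>L * (x - y)\<bar>"
      by (simp add: algebra_simps)
    then show ?thesis using lip[of x y] L by (simp add: abs_mult)
  qed
  show "0 < \<epsilon>" by fact
  show "?N \<subseteq> {t. \<not> (\<exists>q. \<exists>d>0. \<forall>s. \<bar>s\<bar> < d \<longrightarrow> \<bar>F (t + s) + L * (t + s) - (F t + L * t) - q * s\<bar> \<le> \<epsilon> * \<bar>s\<bar>)}"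
  proof (intro subsetI CollectI notI)
    fix t assume t: "t \<in> ?N" and "\<exists>q. \<exists>d>0. \<forall>s. \<bar>s\<bar> < d \<longrightarrow> \<bar>F (t + s) + L * (t + s) - (F t + L * t) - q * s\<bar> \<le> \<epsilon> * \<bar>s\<bar>"
    then obtain q d where d: "d > 0" "\<And>s. \<bar>s\<bar> < d \<Longrightarrow> \<bar>F (t + s) + L * (t + s) - (F t + L * t) - q * s\<bar> \<le> \<epsilon> * \<bar>s\<bar>" by blast
    have "\<bar>F (t + s) - F t - (q - L) * s\<bar> \<le> \<epsilon> * \<bar>s\<bar>" if "\<bar>s\<bar> < d" for s
      using d(2)[OF that] by (simp add: algebra_simps)
    then show False using t d(1) by blast
  qed
qed

section \<open>Rademacher's theorem\<close>

text \<open>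
  Averaging the translates of \<open>B\<close> along the direction \<open>e\<close> and exchanging the two integrations replaces
  a choice of coordinates adapted to \<open>e\<close>.
\<close>

lemma negligible_if_lines_negligible:
  fixes B :: "'a::euclidean_space set"
  assumes B: "B \<in> sets borel" and lines: "\<And>x. negligible {t. x + t *\<^sub>R e \<in> B}"
  shows "negligible B"
proof -
  have meas: "(\<lambda>(x, t). indicator B (x + t *\<^sub>R e) :: ennreal) \<in> borel_measurable (lborel \<Otimes>\<^sub>M lborel)"
  proof -
    have "(\<lambda>p. fst p + snd p *\<^sub>R e) \<in> borel_measurable (lborel \<Otimes>\<^sub>M (lborel :: real measure))" by measurable
    then show ?thesis using B by (simp add: case_prod_beta) 
  qed
  have "(\<integral>\<^sup>+x. \<integral>\<^sup>+t. indicator B (x + t *\<^sub>R e) \<partial>lborel \<partial>lborel) = (\<integral>\<^sup>+x. 0 \<partial>(lborel :: 'a measure))"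
  proof (rule nn_integral_cong)
    fix x :: 'a
    have S: "{t. x + t *\<^sub>R e \<in> B} \<in> sets borel"
      using measurable_sets_borel[of "\<lambda>t. x + t *\<^sub>R e" borel B] B by (simp add: vimage_def)
    have "(\<integral>\<^sup>+t. indicator B (x + t *\<^sub>R e) \<partial>lborel) = (\<integral>\<^sup>+t. indicator {t. x + t *\<^sub>R e \<in> B} t \<partial>lborel)"
      by (intro nn_integral_cong) (simp add: indicator_def)
    also have "\<dots> = emeasure lborel {t. x + t *\<^sub>R e \<in> B}" using S by simp
    also have "\<dots> = 0"
      using lines[of x] S by (simp add: negligible_iff_null_sets null_sets_completion_iff null_sets_def)
    finally show "(\<integral>\<^sup>+t. indicator B (x + t *\<^sub>R e) \<partial>lborel) = 0" .
  qed
  moreover have "(\<integral>\<^sup>+x. \<integral>\<^sup>+t. indicator B (x + t *\<^sub>R e) \<partial>lborel \<partial>lborel)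
    = (\<integral>\<^sup>+t. \<integral>\<^sup>+x. indicator B (x + t *\<^sub>R e) \<partial>lborel \<partial>(lborel :: real measure))"
    using lborel_pair.Fubini'[OF meas] by simp
  moreover have "(\<integral>\<^sup>+x. indicator B (x + t *\<^sub>R e) \<partial>lborel) = emeasure lborel B" for t :: real
  proof -
    have "emeasure lborel B = (\<integral>\<^sup>+x. indicator B x \<partial>(distr lborel borel ((+) (t *\<^sub>R e))))"
      using B by (simp add: lborel_distr_plus)
    also have "\<dots> = (\<integral>\<^sup>+x. indicator B (t *\<^sub>R e + x) \<partial>lborel)"
      using B by (subst nn_integral_distr) auto
    finally show ?thesis by (simp add: add.commute)
  qed
  ultimately have "emeasure lborel B * emeasure lborel (UNIV :: real set) = 0" by simp
  then have "emeasure lborel B = 0" by simp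
  then show ?thesis using B by (simp add: negligible_iff_null_sets null_sets_completion_iff null_sets_def)
qed

text \<open>
  Almost every point lies in one of countably many closed sets on each of which the slope in
  direction \<open>b\<close> is, up to \<open>\<epsilon>\<close>, one constant \<open>q\<close> at one scale \<open>d\<close>.  Closedness comes from the
  continuity of \<open>f\<close>, and countability from taking \<open>q\<close> and \<open>d\<close> rational.
\<close>

lemma closed_cover_by_directional_slope:
  fixes f :: "'a::euclidean_space \<Rightarrow> real"
  assumes lip: "L-lipschitz_on UNIV f" and e: "\<epsilon> > 0"
  obtains \<E> where "countable \<E>"
    "\<And>E. E \<in> \<E> \<Longrightarrow> closed E \<and> (\<exists>q. \<exists>d>0. \<forall>x\<in>E. \<forall>s. \<bar>s\<bar> < d \<longrightarrow> \<bar>f (x + s *\<^sub>R b) - f x - q * s\<bar> \<le> \<epsilon> * \<bar>s\<bar>)"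
    "negligible (- \<Union>\<E>)"
proof -
  define E where "E = (\<lambda>(q, d). {x. \<forall>s. \<bar>s\<bar> < d \<longrightarrow> \<bar>f (x + s *\<^sub>R b) - f x - q * s\<bar> \<le> \<epsilon> * \<bar>s\<bar>})"
  define I :: "(real \<times> real) set" where "I = \<rat> \<times> (\<rat> \<inter> {0<..})"
  have cont: "continuous_on UNIV f" using lip by (rule lipschitz_on_continuous_on)
  have "closed (E (q, d))" for q d
  proof -
    have "E (q, d) = (\<Inter>s\<in>{s. \<bar>s\<bar> < d}. {x. \<bar>f (x + s *\<^sub>R b) - f x - q * s\<bar> \<le> \<epsilon> * \<bar>s\<bar>})"
      by (auto simp: E_def)
    moreover have "closed {x. \<bar>f (x + s *\<^sub>R b) - f x - q * s\<bar> \<le> \<epsilon> * \<bar>s\<bar>}" for s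
      by (intro closed_Collect_le continuous_intros continuous_on_compose2[OF cont]) auto
    ultimately show ?thesis by auto
  qed
  then have closed: "closed A" if "A \<in> E ` I" for A using that by auto
  have count: "countable (E ` I)" unfolding I_def by (intro countable_image countable_SIGMA countable_rat countable_Int1)
  show ?thesis
  proof
    show "countable (E ` I)" by fact
    show "closed A \<and> (\<exists>q. \<exists>d>0. \<forall>x\<in>A. \<forall>s. \<bar>s\<bar> < d \<longrightarrow> \<bar>f (x + s *\<^sub>R b) - f x - q * s\<bar> \<le> \<epsilon> * \<bar>s\<bar>)"
      if "A \<in> E ` I" for A
      using that closed[OF that] by (fastforce simp: E_def I_def)
    show "negligible (- \<Union>(E ` I))"
    proof (rule negligible_if_lines_negligible)
      have "\<Union>(E ` I) \<in> sets borel" using count closed by (intro sets.countable_Union) auto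
      then show "- \<Union>(E ` I) \<in> sets borel" by (rule borel_comp)
      fix x
      let ?F = "\<lambda>t. f (x + t *\<^sub>R b)"
      have "\<bar>?F u - ?F v\<bar> \<le> (L * norm b) * \<bar>u - v\<bar>" for u v
        using lipschitz_onD[OF lip, of "x + u *\<^sub>R b" "x + v *\<^sub>R b"]
        by (simp add: dist_norm flip: scaleR_left_diff_distrib) (simp add: mult_ac)
      then have "negligible {t. \<not> (\<exists>q. \<exists>d>0. \<forall>s. \<bar>s\<bar> < d \<longrightarrow> \<bar>?F (t + s) - ?F t - q * s\<bar> \<le> \<epsilon>/2 * \<bar>s\<bar>)}"
        by (rule negligible_no_slope_Lipschitz) (use e in auto)
      then show "negligible {t. x + t *\<^sub>R b \<in> - \<Union> (E ` I)}"
      proof (rule negligible_subset, intro subsetI CollectI notI)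
        fix t assume t: "t \<in> {t. x + t *\<^sub>R b \<in> - \<Union> (E ` I)}"
          and "\<exists>q. \<exists>d>0. \<forall>s. \<bar>s\<bar> < d \<longrightarrow> \<bar>?F (t + s) - ?F t - q * s\<bar> \<le> \<epsilon>/2 * \<bar>s\<bar>"
        then obtain q d where qd: "d > 0" "\<And>s. \<bar>s\<bar> < d \<Longrightarrow> \<bar>?F (t + s) - ?F t - q * s\<bar> \<le> \<epsilon>/2 * \<bar>s\<bar>" by blast
        obtain q' where q': "q' \<in> \<rat>" "q < q'" "q' < q + \<epsilon>/2" using Rats_dense_in_real[of q "q + \<epsilon>/2"] e by auto
        obtain d' where d': "d' \<in> \<rat>" "0 < d'" "d' < d" using Rats_dense_in_real[of 0 d] qd by auto
        have "\<bar>?F (t + s) - ?F t - q' * s\<bar> \<le> \<epsilon> * \<bar>s\<bar>" if "\<bar>s\<bar> < d'" for s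
        proof -
          have "\<bar>?F (t + s) - ?F t - q' * s\<bar> \<le> \<bar>?F (t + s) - ?F t - q * s\<bar> + \<bar>(q' - q) * s\<bar>"
            by (simp add: algebra_simps)
          also have "\<dots> \<le> \<epsilon>/2 * \<bar>s\<bar> + \<epsilon>/2 * \<bar>s\<bar>"
            using qd(2)[of s] that d' q' unfolding abs_mult by (intro add_mono mult_right_mono) auto
          finally show ?thesis by simp
        qed
        then have "x + t *\<^sub>R b \<in> E (q', d')" by (simp add: E_def algebra_simps)
        moreover have "(q', d') \<in> I" using q' d' by (simp add: I_def)
        ultimately show False using t by blast
      qed
    qed
  qed
qed

text \<open>
  Linear approximations with errors \<open>1 / (n + 1)\<close> differ by at most the sum of the errors, so they
  converge.
\<close>

lemma differentiable_if_approx_linear: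
  fixes f :: "'a::euclidean_space \<Rightarrow> real"
  assumes ap: "\<And>\<eta>. \<eta> > 0 \<Longrightarrow> \<exists>g. \<exists>d>0. \<forall>h. norm h < d \<longrightarrow> \<bar>f (x + h) - f x - g \<bullet> h\<bar> \<le> \<eta> * norm h"
  shows "f differentiable (at x)"
proof -
  have "\<exists>g. \<forall>n::nat. \<exists>d>0. \<forall>h. norm h < d \<longrightarrow> \<bar>f (x + h) - f x - g n \<bullet> h\<bar> \<le> inverse (real (Suc n)) * norm h"
    by (rule choice, rule allI, rule ap) simp
  then obtain g where g: "\<And>n::nat. \<exists>d>0. \<forall>h. norm h < d \<longrightarrow> \<bar>f (x + h) - f x - g n \<bullet> h\<bar> \<le> inverse (real (Suc n)) * norm h" by blast
  have diff: "norm (g m - g n) \<le> inverse (real (Suc m)) + inverse (real (Suc n))" for m n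
  proof (cases "g m = g n")
    case False
    obtain d where d: "d > 0" "\<And>h. norm h < d \<Longrightarrow> \<bar>f (x + h) - f x - g m \<bullet> h\<bar> \<le> inverse (real (Suc m)) * norm h" using g by blast
    obtain d' where d': "d' > 0" "\<And>h. norm h < d' \<Longrightarrow> \<bar>f (x + h) - f x - g n \<bullet> h\<bar> \<le> inverse (real (Suc n)) * norm h" using g by blast
    let ?w = "g m - g n"
    define h where "h = (min d d' / 2 / norm ?w) *\<^sub>R ?w"
    have nh: "norm h = min d d' / 2" using False d d' by (simp add: h_def)
    have "norm ?w * norm h = ?w \<bullet> h"
      using False d d' by (simp add: h_def power2_norm_eq_inner[symmetric] power2_eq_square)
    also have "\<dots> \<le> \<bar>f (x + h) - f x - g m \<bullet> h\<bar> + \<bar>f (x + h) - f x - g n \<bullet> h\<bar>"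
      by (simp add: inner_diff_left)
    also have "\<dots> \<le> (inverse (real (Suc m)) + inverse (real (Suc n))) * norm h"
    proof -
      have "norm h < d" "norm h < d'" using nh d(1) d'(1) by auto
      from d(2)[OF this(1)] d'(2)[OF this(2)] show ?thesis unfolding distrib_right by (rule add_mono)
    qed
    finally show ?thesis using nh d(1) d'(1) by simp
  qed simp
  have "Cauchy g"
  proof (rule CauchyI)
    fix e :: real assume "e > 0"
    then obtain N where N: "inverse (real (Suc N)) < e / 2" using reals_Archimedean[of "e/2"] by auto
    have "norm (g m - g n) < e" if "m \<ge> N" "n \<ge> N" for m n
    proof -
      have "inverse (real (Suc m)) \<le> inverse (real (Suc N))" "inverse (real (Suc n)) \<le> inverse (real (Suc N))"
        using that by (auto intro: le_imp_inverse_le)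
      then show ?thesis using diff[of m n] N by linarith
    qed
    then show "\<exists>M. \<forall>m\<ge>M. \<forall>n\<ge>M. norm (g m - g n) < e" by blast
  qed
  then obtain G where G: "g \<longlonglongrightarrow> G" using Cauchy_convergent convergent_def by blast
  have gG: "norm (g m - G) \<le> inverse (real (Suc m))" for m
  proof (rule tendsto_le[OF _ _ _ diff[of m, THEN always_eventually[OF allI]]])
    show "(\<lambda>n. norm (g m - g n)) \<longlonglongrightarrow> norm (g m - G)" by (intro tendsto_intros G)
    show "(\<lambda>n. inverse (real (Suc m)) + inverse (real (Suc n))) \<longlonglongrightarrow> inverse (real (Suc m))"
      using tendsto_add[OF tendsto_const LIMSEQ_inverse_real_of_nat, of "inverse (real (Suc m))"] by simp
  qed simp
  have "(f has_derivative (\<lambda>h. G \<bullet> h)) (at x)"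
    unfolding has_derivative_at_alt
  proof (intro conjI allI impI)
    show "bounded_linear (\<lambda>h. G \<bullet> h)" by (rule bounded_linear_inner_right)
    fix e :: real assume "e > 0"
    then obtain N where N: "inverse (real (Suc N)) < e / 2" using reals_Archimedean[of "e/2"] by auto
    obtain d where d: "d > 0" "\<And>h. norm h < d \<Longrightarrow> \<bar>f (x + h) - f x - g N \<bullet> h\<bar> \<le> inverse (real (Suc N)) * norm h" using g by blast
    have "norm (f y - f x - G \<bullet> (y - x)) \<le> e * norm (y - x)" if "norm (y - x) < d" for y
    proof -
      have "\<bar>f y - f x - G \<bullet> (y - x)\<bar> \<le> \<bar>f y - f x - g N \<bullet> (y - x)\<bar> + \<bar>(g N - G) \<bullet> (y - x)\<bar>"
        by (simp add: inner_diff_left)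
      also have "\<dots> \<le> e/2 * norm (y - x) + e/2 * norm (y - x)"
      proof (rule add_mono)
        show "\<bar>f y - f x - g N \<bullet> (y - x)\<bar> \<le> e/2 * norm (y - x)"
          using d(2)[OF that] N by (intro order_trans[OF _ mult_right_mono[of "inverse (real (Suc N))" "e/2"]]) auto
        show "\<bar>(g N - G) \<bullet> (y - x)\<bar> \<le> e/2 * norm (y - x)"
          using gG[of N] N by (intro order_trans[OF Cauchy_Schwarz_ineq2 mult_right_mono]) auto
      qed
      finally show ?thesis by simp
    qed
    then show "\<exists>d>0. \<forall>y. norm (y - x) < d \<longrightarrow> norm (f y - f x - G \<bullet> (y - x)) \<le> e * norm (y - x)"
      using d(1) by blast
  qed
  then show ?thesis by (auto simp: differentiable_def)
qed

text \<open>
  Let \<open>x\<close> be a non-porous point, for every basis vector \<open>b\<close>, of a closed set on which the slope in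
  direction \<open>b\<close> is nearly a constant \<open>q b\<close>.  A displacement \<open>h\<close> is made one coordinate at a time.  Each
  intermediate point is closer than a small multiple of \<open>norm h\<close> to the closed set belonging to the
  next direction, where the increment is known, and the Lipschitz bound controls the difference.
  Hence \<open>f\<close> is nearly linear near \<open>x\<close>.
\<close>

theorem Rademacher_real:
  fixes f :: "'a::euclidean_space \<Rightarrow> real"
  assumes lip: "L-lipschitz_on UNIV f"
  shows "negligible {x. \<not> f differentiable (at x)}"
proof -
  define slope where "slope \<epsilon> b E \<longleftrightarrow> closed E \<and> (\<exists>q. \<exists>d>0. \<forall>x\<in>E. \<forall>s. \<bar>s\<bar> < d \<longrightarrow> \<bar>f (x + s *\<^sub>R b) - f x - q * s\<bar> \<le> \<epsilon> * \<bar>s\<bar>)"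
    for \<epsilon> :: real and b and E
  define ev where "ev k = inverse (real (Suc k))" for k
  have evpos: "ev k > 0" "ev k \<le> 1" for k by (auto simp: ev_def inverse_le_1_iff)
  have "\<forall>kb :: nat \<times> 'a. \<exists>\<E>. countable \<E> \<and> (\<forall>E\<in>\<E>. slope (ev (fst kb)) (snd kb) E) \<and> negligible (- \<Union>\<E>)"
  proof
    fix kb :: "nat \<times> 'a"
    show "\<exists>\<E>. countable \<E> \<and> (\<forall>E\<in>\<E>. slope (ev (fst kb)) (snd kb) E) \<and> negligible (- \<Union>\<E>)"
      by (rule closed_cover_by_directional_slope[OF lip evpos(1)[of "fst kb"], where b="snd kb"])
         (auto simp: slope_def)
  qed
  then obtain \<E> where E: "\<And>k b. countable (\<E> (k, b))" "\<And>k b E. E \<in> \<E> (k, b) \<Longrightarrow> slope (ev k) b E"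
     "\<And>k b. negligible (- \<Union>(\<E> (k, b)))"
    by (drule_tac choice) auto
  define por where "por \<delta> E = E \<inter> finely_covered (\<lambda>y r. ball y (\<delta> * r) \<inter> E = {})"
    for \<delta> and E :: "'a set"
  define N where "N = (\<Union>k. \<Union>b\<in>Basis. (- \<Union>(\<E> (k, b))) \<union> (\<Union>E\<in>\<E> (k, b). \<Union>j. por (ev j) E))"
  have "negligible (por (ev j) E)" if "E \<in> \<E> (k, b)" for j k b E
    unfolding por_def using E(2)[OF that] evpos by (intro negligible_porous) (auto simp: slope_def)
  then have "negligible (\<Union>j. por (ev j) E)" if "E \<in> \<E> (k, b)" for k b E
    using that by (intro negligible_countable_Union) auto
  then have "negligible (\<Union>E\<in>\<E> (k, b). \<Union>j. por (ev j) E)" for k b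
    using E(1)[of k b] by (intro negligible_countable_Union) auto
  then have "negligible ((- \<Union>(\<E> (k, b))) \<union> (\<Union>E\<in>\<E> (k, b). \<Union>j. por (ev j) E))" for k b
    using E(3)[of k b] by (intro negligible_Un) auto
  then have "negligible (\<Union>b\<in>Basis. (- \<Union>(\<E> (k, b))) \<union> (\<Union>E\<in>\<E> (k, b). \<Union>j. por (ev j) E))" for k
    by (intro negligible_Union) auto
  then have negN: "negligible N"
    unfolding N_def by (intro negligible_countable_Union) auto
  have L: "L \<ge> 0" using lip by (rule lipschitz_on_nonneg)
  let ?n = "real DIM('a)"
  have "f differentiable (at x)" if x: "x \<notin> N" for x
  proof (rule differentiable_if_approx_linear)
    fix \<eta> :: real assume eta: "\<eta> > 0"
    define \<kappa> where "\<kappa> = \<eta> / (?n * (1 + 2 * L * (?n + 1)))"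
    have n0: "?n > 0" by simp
    have den: "?n * (1 + 2 * L * (?n + 1)) > 0"
      using L n0 by (intro mult_pos_pos add_pos_nonneg) auto
    have den0: "1 + 2 * L * (?n + 1) > 0" using L by (intro add_pos_nonneg) auto
    have kap: "\<kappa> > 0" using eta den by (simp add: \<kappa>_def)
    obtain k where k: "ev k < \<kappa>" using reals_Archimedean[OF kap] by (auto simp: ev_def)
    have "\<exists>q. \<exists>d>0. \<forall>z s r. z \<in> ball x r \<longrightarrow> 0 < r \<longrightarrow> r < d \<longrightarrow> \<bar>s\<bar> < d \<longrightarrow>
        \<bar>f (z + s *\<^sub>R b) - f z - q * s\<bar> \<le> ev k * \<bar>s\<bar> + 2 * L * (ev k * r)" if b: "b \<in> Basis" for b
    proof -
      have "x \<in> \<Union>(\<E> (k, b))" and npor: "\<And>E j. E \<in> \<E> (k, b) \<Longrightarrow> x \<notin> por (ev j) E"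
        using x b unfolding N_def by auto
      then obtain E where Ex: "E \<in> \<E> (k, b)" "x \<in> E" by blast
      then obtain d1 where d1: "d1 > 0" "\<And>y r. 0 < r \<Longrightarrow> r < d1 \<Longrightarrow> x \<in> ball y r \<Longrightarrow> ball y (ev k * r) \<inter> E \<noteq> {}"
        using npor[OF Ex(1), of k] unfolding por_def by blast
      obtain q d2 where q: "d2 > 0" "\<And>y s. y \<in> E \<Longrightarrow> \<bar>s\<bar> < d2 \<Longrightarrow> \<bar>f (y + s *\<^sub>R b) - f y - q * s\<bar> \<le> ev k * \<bar>s\<bar>"
        using E(2)[OF Ex(1)] unfolding slope_def by blast
      have "\<bar>f (z + s *\<^sub>R b) - f z - q * s\<bar> \<le> ev k * \<bar>s\<bar> + 2 * L * (ev k * r)"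
        if z: "z \<in> ball x r" "0 < r" "r < min d1 d2" "\<bar>s\<bar> < min d1 d2" for z s r
      proof -
        obtain y where y: "y \<in> E" "dist z y < ev k * r"
          using d1(2)[of r z] z by (auto simp: dist_commute)
        have 1: "\<bar>f z - f y\<bar> \<le> L * (ev k * r)"
          using lipschitz_onD[OF lip, of z y] y(2) L
          by (auto simp: dist_real_def intro: order_trans[OF _ mult_left_mono])
        have 2: "\<bar>f (z + s *\<^sub>R b) - f (y + s *\<^sub>R b)\<bar> \<le> L * (ev k * r)"
          using lipschitz_onD[OF lip, of "z + s *\<^sub>R b" "y + s *\<^sub>R b"] y(2) L
          by (auto simp: dist_real_def dist_norm intro: order_trans[OF _ mult_left_mono])
        have 3: "\<bar>f (y + s *\<^sub>R b) - f y - q * s\<bar> \<le> ev k * \<bar>s\<bar>" using q(2)[OF y(1)] z by simp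
        show ?thesis using 1 2 3 by linarith
      qed
      then show ?thesis using d1(1) q(1) by (intro exI[of _ q] exI[of _ "min d1 d2"]) auto
    qed
    then obtain q where "\<forall>b\<in>Basis. \<exists>d>0. \<forall>z s r. z \<in> ball x r \<longrightarrow> 0 < r \<longrightarrow> r < d \<longrightarrow> \<bar>s\<bar> < d \<longrightarrow>
        \<bar>f (z + s *\<^sub>R b) - f z - q b * s\<bar> \<le> ev k * \<bar>s\<bar> + 2 * L * (ev k * r)"
      using bchoice[of Basis "\<lambda>b q. \<exists>d>0. \<forall>z s r. z \<in> ball x r \<longrightarrow> 0 < r \<longrightarrow> r < d \<longrightarrow> \<bar>s\<bar> < d \<longrightarrow>
        \<bar>f (z + s *\<^sub>R b) - f z - q * s\<bar> \<le> ev k * \<bar>s\<bar> + 2 * L * (ev k * r)"] by blast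
    from bchoice[OF this] obtain d where d: "\<And>b. b \<in> Basis \<Longrightarrow> d b > 0"
      "\<And>b z s r. b \<in> Basis \<Longrightarrow> z \<in> ball x r \<Longrightarrow> 0 < r \<Longrightarrow> r < d b \<Longrightarrow> \<bar>s\<bar> < d b \<Longrightarrow>
        \<bar>f (z + s *\<^sub>R b) - f z - q b * s\<bar> \<le> ev k * \<bar>s\<bar> + 2 * L * (ev k * r)" by blast
    define D where "D = Min (d ` Basis)"
    have D: "D > 0" "\<And>b. b \<in> Basis \<Longrightarrow> D \<le> d b" using d(1) by (auto simp: D_def)
    define G where "G = (\<Sum>b\<in>Basis. q b *\<^sub>R b)"
    show "\<exists>g. \<exists>d>0. \<forall>h. norm h < d \<longrightarrow> \<bar>f (x + h) - f x - g \<bullet> h\<bar> \<le> \<eta> * norm h"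
    proof (intro exI[of _ G] exI[of _ "D / (?n + 1)"] conjI allI impI)
      show "D / (?n + 1) > 0" using D by (intro divide_pos_pos) auto
      fix h :: 'a assume h: "norm h < D / (?n + 1)"
      show "\<bar>f (x + h) - f x - G \<bullet> h\<bar> \<le> \<eta> * norm h"
      proof (cases "h = 0")
        case False
        define r where "r = (?n + 1) * norm h"
        have r: "0 < r" "r < D" using False h n0 by (auto simp: r_def pos_less_divide_eq mult.commute)
        have hr: "norm h \<le> r" using False by (simp add: r_def)
        define w where "w = 2 * L * (?n + 1) + 1"
        have step: "\<bar>f (x + (\<Sum>b\<in>T. (h \<bullet> b) *\<^sub>R b)) - f x - (\<Sum>b\<in>T. q b * (h \<bullet> b))\<bar> \<le> real (card T) * (ev k * w * norm h)"
          if "finite T" "T \<subseteq> Basis" for T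
          using that
        proof (induction T rule: finite_induct)
          case (insert b T)
          let ?z = "x + (\<Sum>b\<in>T. (h \<bullet> b) *\<^sub>R b)"
          have bB: "b \<in> Basis" using insert by auto
          have "norm (\<Sum>b\<in>T. (h \<bullet> b) *\<^sub>R b) \<le> (\<Sum>b\<in>T. norm h)"
            using insert.prems by (intro sum_norm_le) (auto intro!: Basis_le_norm)
          also have "\<dots> \<le> ?n * norm h"
            using insert.prems by (auto intro!: mult_right_mono card_mono)
          also have "\<dots> < r" using False by (simp add: r_def)
          finally have z: "?z \<in> ball x r" by (simp add: dist_norm)
          have "\<bar>h \<bullet> b\<bar> < d b" using Basis_le_norm[OF bB, of h] hr r D(2)[OF bB] by linarith
          then have "\<bar>f (?z + (h \<bullet> b) *\<^sub>R b) - f ?z - q b * (h \<bullet> b)\<bar> \<le> ev k * \<bar>h \<bullet> b\<bar> + 2 * L * (ev k * r)"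
            using d(2)[OF bB z r(1)] r D(2)[OF bB] by simp
          also have "\<dots> \<le> ev k * norm h + 2 * L * (ev k * r)"
            using Basis_le_norm[OF bB, of h] evpos[of k] by simp
          also have "\<dots> = ev k * w * norm h" by (simp add: w_def r_def algebra_simps)
          finally have a: "\<bar>f (?z + (h \<bullet> b) *\<^sub>R b) - f ?z - q b * (h \<bullet> b)\<bar> \<le> ev k * w * norm h" .
          have ih: "\<bar>f ?z - f x - (\<Sum>b\<in>T. q b * (h \<bullet> b))\<bar> \<le> real (card T) * (ev k * w * norm h)"
            using insert by auto
          have eq: "x + (\<Sum>b\<in>insert b T. (h \<bullet> b) *\<^sub>R b) = ?z + (h \<bullet> b) *\<^sub>R b"
            using insert by (simp add: algebra_simps)
          have eq2: "(\<Sum>b\<in>insert b T. q b * (h \<bullet> b)) = q b * (h \<bullet> b) + (\<Sum>b\<in>T. q b * (h \<bullet> b))"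
            using insert by simp
          have eq3: "real (card (insert b T)) * (ev k * w * norm h) = ev k * w * norm h + real (card T) * (ev k * w * norm h)"
            using insert by (simp add: algebra_simps)
          show ?case unfolding eq eq2 eq3 using a ih by linarith
        qed simp
        have "G \<bullet> h = (\<Sum>b\<in>Basis. q b * (h \<bullet> b))"
          by (simp add: G_def inner_sum_left inner_commute[of h])
        then have "\<bar>f (x + h) - f x - G \<bullet> h\<bar> \<le> ?n * (ev k * w * norm h)"
          using step[of Basis] by (simp add: euclidean_representation)
        also have "\<dots> = ev k * (?n * w) * norm h" by simp
        also have "\<dots> \<le> \<kappa> * (?n * w) * norm h"
          using k L by (intro mult_right_mono) (auto simp: w_def)
        also have "\<kappa> * (?n * w) = \<eta>" using den0 n0 by (simp add: \<kappa>_def w_def add.commute[of _ 1])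
        finally show ?thesis by simp
      qed simp
    qed
  qed
  then show ?thesis using negN by (rule_tac negligible_subset[OF negN]) auto
qed

theorem Rademacher:
  fixes f :: "'a::euclidean_space \<Rightarrow> 'b::euclidean_space"
  assumes lip: "L-lipschitz_on UNIV f"
  shows "negligible {x. \<not> f differentiable (at x)}"
proof -
  have "negligible {x. \<not> (\<lambda>x. f x \<bullet> b) differentiable (at x)}" if "b \<in> Basis" for b
  proof (rule Rademacher_real[of L])
    show "L-lipschitz_on UNIV (\<lambda>x. f x \<bullet> b)"
    proof (rule lipschitz_onI)
      fix x y
      have "dist (f x \<bullet> b) (f y \<bullet> b) \<le> dist (f x) (f y)"
        using Basis_le_norm[OF that, of "f x - f y"] by (simp add: dist_norm inner_diff_left)
      also have "\<dots> \<le> L * dist x y" by (rule lipschitz_onD[OF lip]) auto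
      finally show "dist (f x \<bullet> b) (f y \<bullet> b) \<le> L * dist x y" .
    qed (rule lipschitz_on_nonneg[OF lip])
  qed
  then have "negligible (\<Union>b\<in>Basis. {x. \<not> (\<lambda>x. f x \<bullet> b) differentiable (at x)})"
    by (intro negligible_Union) auto
  moreover have "f differentiable (at x)" if "\<And>b. b \<in> Basis \<Longrightarrow> (\<lambda>x. f x \<bullet> b) differentiable (at x)" for x
    using that differentiable_componentwise_within[of f x UNIV] by auto
  ultimately show ?thesis by (rule_tac negligible_subset) auto
qed

section \<open>Second derivatives and the Moreau envelope\<close>

text \<open>
  The second difference of \<open>e\<close> along \<open>s k\<close> and \<open>s l\<close> is symmetric in \<open>k\<close> and \<open>l\<close>, and the mean value
  theorem in the direction \<open>l\<close> shows that it is \<open>s\<^sup>2 (A k \<bullet> l)\<close> up to \<open>o(s\<^sup>2)\<close>.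
\<close>

lemma second_derivative_symmetric:
  fixes e :: "'a::euclidean_space \<Rightarrow> real" and g :: "'a \<Rightarrow> 'a"
  assumes e: "\<And>x. (e has_derivative (\<lambda>v. g x \<bullet> v)) (at x)" and A: "(g has_derivative A) (at p)"
  shows "A k \<bullet> l = A l \<bullet> k"
proof -
  interpret A: bounded_linear A using A by (rule has_derivative_bounded_linear)
  let ?\<Delta> = "\<lambda>k l s. e (p + s *\<^sub>R k + s *\<^sub>R l) - e (p + s *\<^sub>R k) - e (p + s *\<^sub>R l) + e p"
  have main: "\<exists>d>0. \<forall>s. 0 < s \<longrightarrow> s < d \<longrightarrow>
      \<bar>?\<Delta> k l s - s\<^sup>2 * (A k \<bullet> l)\<bar> \<le> s\<^sup>2 * (2 * \<epsilon> * (norm k + norm l) * norm l)"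
    if eps: "\<epsilon> > 0" for \<epsilon> k l
  proof -
    obtain d where d: "d > 0" "\<And>y. norm (y - p) < d \<Longrightarrow> norm (g y - g p - A (y - p)) \<le> \<epsilon> * norm (y - p)"
      using A eps unfolding has_derivative_at_alt by blast
    let ?n = "norm k + norm l"
    have app: "norm (g (p + v) - g p - A v) \<le> \<epsilon> * norm v" if "norm v < d" for v
      using d(2)[of "p + v"] that by simp
    show ?thesis
    proof (intro exI[of _ "d / (?n + 1)"] conjI allI impI)
      show "d / (?n + 1) > 0" using d by (intro divide_pos_pos add_nonneg_pos) auto
      fix s :: real assume s: "0 < s" "s < d / (?n + 1)"
      have sn: "s * ?n < d"
      proof -
        have "s * ?n \<le> s * (?n + 1)" using s by simp
        also have "\<dots> < d" using s(2) by (simp add: pos_less_divide_eq add_nonneg_pos)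
        finally show ?thesis .
      qed
      define \<phi> where "\<phi> \<tau> = e (p + s *\<^sub>R k + \<tau> *\<^sub>R l) - e (p + \<tau> *\<^sub>R l)" for \<tau>
      have "DERIV \<phi> \<tau> :> (g (p + s *\<^sub>R k + \<tau> *\<^sub>R l) - g (p + \<tau> *\<^sub>R l)) \<bullet> l" for \<tau>
      proof -
        have "(\<phi> has_derivative (\<lambda>t. g (p + s *\<^sub>R k + \<tau> *\<^sub>R l) \<bullet> (t *\<^sub>R l) - g (p + \<tau> *\<^sub>R l) \<bullet> (t *\<^sub>R l))) (at \<tau>)"
          unfolding \<phi>_def
          by (intro has_derivative_diff has_derivative_compose[OF _ e])
             (auto intro!: derivative_eq_intros)
        then show ?thesis unfolding has_field_derivative_def
          by (rule has_derivative_eq_rhs) (auto simp: fun_eq_iff inner_diff_left algebra_simps)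
      qed
      then obtain \<theta> where th: "0 < \<theta>" "\<theta> < s" "\<phi> s - \<phi> 0 = (s - 0) * ((g (p + s *\<^sub>R k + \<theta> *\<^sub>R l) - g (p + \<theta> *\<^sub>R l)) \<bullet> l)"
        using MVT2[of 0 s \<phi> "\<lambda>\<tau>. (g (p + s *\<^sub>R k + \<tau> *\<^sub>R l) - g (p + \<tau> *\<^sub>R l)) \<bullet> l"] s(1) by blast
      let ?v1 = "s *\<^sub>R k + \<theta> *\<^sub>R l" and ?v2 = "\<theta> *\<^sub>R l"
      have n1: "norm ?v1 \<le> s * ?n"
        using norm_triangle_ineq[of "s *\<^sub>R k" "\<theta> *\<^sub>R l"] th s mult_right_mono[of \<theta> s "norm l"]
        by (simp add: algebra_simps)
      have n2: "norm ?v2 \<le> s * ?n"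
        proof -
        have "\<theta> * norm l \<le> s * norm l" using th by (intro mult_right_mono) auto
        moreover have "0 \<le> s * norm k" using s by simp
        moreover have "norm ?v2 = \<theta> * norm l" using th by simp
        ultimately show ?thesis unfolding distrib_left by linarith
      qed
      have a1: "norm (g (p + ?v1) - g p - A ?v1) \<le> \<epsilon> * (s * ?n)"
        using app[of ?v1] n1 sn eps by (auto intro: order_trans[OF _ mult_left_mono])
      have a2: "norm (g (p + ?v2) - g p - A ?v2) \<le> \<epsilon> * (s * ?n)"
        using app[of ?v2] n2 sn eps by (auto intro: order_trans[OF _ mult_left_mono])
      have "g (p + ?v1) - g (p + ?v2) - s *\<^sub>R A k = (g (p + ?v1) - g p - A ?v1) - (g (p + ?v2) - g p - A ?v2)"
        by (simp add: A.add A.scaleR)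
      then have "norm (g (p + ?v1) - g (p + ?v2) - s *\<^sub>R A k) = norm ((g (p + ?v1) - g p - A ?v1) - (g (p + ?v2) - g p - A ?v2))"
        by (rule arg_cong)
      also have "\<dots> \<le> norm (g (p + ?v1) - g p - A ?v1) + norm (g (p + ?v2) - g p - A ?v2)"
        by (rule norm_triangle_ineq4)
      also have "\<dots> \<le> \<epsilon> * (s * ?n) + \<epsilon> * (s * ?n)" by (rule add_mono[OF a1 a2])
      finally have "norm (g (p + ?v1) - g (p + ?v2) - s *\<^sub>R A k) \<le> 2 * (\<epsilon> * (s * ?n))" by simp
      then have "\<bar>(g (p + ?v1) - g (p + ?v2) - s *\<^sub>R A k) \<bullet> l\<bar> \<le> 2 * (\<epsilon> * (s * ?n)) * norm l"
        by (intro order_trans[OF Cauchy_Schwarz_ineq2 mult_right_mono]) auto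
      then have "s * \<bar>(g (p + ?v1) - g (p + ?v2) - s *\<^sub>R A k) \<bullet> l\<bar> \<le> s * (2 * (\<epsilon> * (s * ?n)) * norm l)"
        using s by (intro mult_left_mono) auto
      moreover have "?\<Delta> k l s - s\<^sup>2 * (A k \<bullet> l)
         = s * ((g (p + ?v1) - g (p + ?v2) - s *\<^sub>R A k) \<bullet> l)"
        using th(3) by (simp add: \<phi>_def inner_diff_left power2_eq_square add.assoc algebra_simps)
      ultimately show "\<bar>?\<Delta> k l s - s\<^sup>2 * (A k \<bullet> l)\<bar> \<le> s\<^sup>2 * (2 * \<epsilon> * (norm k + norm l) * norm l)"
        using s(1) by (simp add: abs_mult power2_eq_square mult_ac)
    qed
  qed
  have bnd: "\<bar>A k \<bullet> l - A l \<bullet> k\<bar> \<le> \<eta>" if eta: "\<eta> > 0" for \<eta>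
  proof -
    let ?n = "norm k + norm l"
    define \<epsilon> where "\<epsilon> = \<eta> / (2 * ?n * ?n + 1)"
    have den: "2 * ?n * ?n + 1 > 0" by (intro add_nonneg_pos) auto
    have eps: "\<epsilon> > 0" using eta den by (simp add: \<epsilon>_def)
    obtain d1 where d1: "d1 > 0" "\<And>s. 0 < s \<Longrightarrow> s < d1 \<Longrightarrow>
      \<bar>?\<Delta> k l s - s\<^sup>2 * (A k \<bullet> l)\<bar> \<le> s\<^sup>2 * (2 * \<epsilon> * (norm k + norm l) * norm l)"
      using main[OF eps, of k l] by blast
    obtain d2 where d2: "d2 > 0" "\<And>s. 0 < s \<Longrightarrow> s < d2 \<Longrightarrow>
      \<bar>?\<Delta> l k s - s\<^sup>2 * (A l \<bullet> k)\<bar> \<le> s\<^sup>2 * (2 * \<epsilon> * (norm l + norm k) * norm k)"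
      using main[OF eps, of l k] by blast
    define s where "s = min d1 d2 / 2"
    have s: "0 < s" "s < d1" "s < d2" using d1(1) d2(1) by (auto simp: s_def)
    have comm: "p + s *\<^sub>R l + s *\<^sub>R k = p + s *\<^sub>R k + s *\<^sub>R l" by simp
    have "\<bar>s\<^sup>2 * (A k \<bullet> l) - s\<^sup>2 * (A l \<bullet> k)\<bar> \<le> s\<^sup>2 * (2 * \<epsilon> * ?n * norm l) + s\<^sup>2 * (2 * \<epsilon> * (norm l + norm k) * norm k)"
      using d1(2)[OF s(1,2)] d2(2)[OF s(1,3)] unfolding comm by linarith
    also have "\<dots> = s\<^sup>2 * (\<epsilon> * (2 * ?n * ?n))" by (simp add: algebra_simps)
    finally have "s\<^sup>2 * \<bar>A k \<bullet> l - A l \<bullet> k\<bar> \<le> s\<^sup>2 * (\<epsilon> * (2 * ?n * ?n))"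
      by (simp add: abs_mult flip: right_diff_distrib)
    then have "\<bar>A k \<bullet> l - A l \<bullet> k\<bar> \<le> \<epsilon> * (2 * ?n * ?n)" using s(1) by simp
    also have "\<dots> \<le> \<epsilon> * (2 * ?n * ?n + 1)" using eps by simp
    also have "\<dots> = \<eta>" using den by (simp add: \<epsilon>_def)
    finally show ?thesis .
  qed
  have "\<bar>A k \<bullet> l - A l \<bullet> k\<bar> \<le> 0"
  proof (rule field_le_epsilon)
    fix \<eta> :: real assume "\<eta> > 0"
    from bnd[OF this] show "\<bar>A k \<bullet> l - A l \<bullet> k\<bar> \<le> 0 + \<eta>" by (simp only: add_0_left)
  qed
  then show ?thesis by simp
qed

lemma second_order_expansion:
  fixes e :: "'a::euclidean_space \<Rightarrow> real" and g :: "'a \<Rightarrow> 'a"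
  assumes e: "\<And>x. (e has_derivative (\<lambda>v. g x \<bullet> v)) (at x)" and A: "(g has_derivative A) (at p)" and eps: "\<epsilon> > 0"
  obtains d where "d > 0" "\<And>k. norm k < d \<Longrightarrow> \<bar>e (p + k) - e p - g p \<bullet> k - (A k \<bullet> k) / 2\<bar> \<le> \<epsilon> * (k \<bullet> k)"
proof -
  interpret A: bounded_linear A using A by (rule has_derivative_bounded_linear)
  obtain d where d: "d > 0" "\<And>y. norm (y - p) < d \<Longrightarrow> norm (g y - g p - A (y - p)) \<le> \<epsilon> * norm (y - p)"
    using A eps unfolding has_derivative_at_alt by blast
  have "\<bar>e (p + k) - e p - g p \<bullet> k - (A k \<bullet> k) / 2\<bar> \<le> \<epsilon> * (k \<bullet> k)" if k: "norm k < d" for k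
  proof -
    define \<phi> where "\<phi> s = e (p + s *\<^sub>R k) - s * (g p \<bullet> k) - s\<^sup>2 * (A k \<bullet> k) / 2" for s
    have "DERIV \<phi> s :> (g (p + s *\<^sub>R k) - g p - A (s *\<^sub>R k)) \<bullet> k" for s
    proof -
      have "((\<lambda>s. e (p + s *\<^sub>R k)) has_derivative (\<lambda>t. g (p + s *\<^sub>R k) \<bullet> (t *\<^sub>R k))) (at s)"
        by (rule has_derivative_compose[OF _ e]) (auto intro!: derivative_eq_intros)
      then have 1: "DERIV (\<lambda>s. e (p + s *\<^sub>R k)) s :> g (p + s *\<^sub>R k) \<bullet> k"
        unfolding has_field_derivative_def by (rule has_derivative_eq_rhs) (auto simp: fun_eq_iff)
      show ?thesis unfolding \<phi>_def
        by (rule DERIV_cong, (rule derivative_intros 1)+) (auto simp: inner_diff_left A.scaleR)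
    qed
    then obtain s where s: "0 < s" "s < 1" "\<phi> 1 - \<phi> 0 = (1 - 0) * ((g (p + s *\<^sub>R k) - g p - A (s *\<^sub>R k)) \<bullet> k)"
      using MVT2[of 0 1 \<phi> "\<lambda>s. (g (p + s *\<^sub>R k) - g p - A (s *\<^sub>R k)) \<bullet> k"] by auto
    have sk: "norm (s *\<^sub>R k) \<le> norm k" using s by (simp add: mult_left_le_one_le)
    have "norm (g (p + s *\<^sub>R k) - g p - A (s *\<^sub>R k)) \<le> \<epsilon> * norm (s *\<^sub>R k)"
      using d(2)[of "p + s *\<^sub>R k"] sk k by simp
    also have "\<dots> \<le> \<epsilon> * norm k" using sk eps by (intro mult_left_mono) auto
    finally have "\<bar>(g (p + s *\<^sub>R k) - g p - A (s *\<^sub>R k)) \<bullet> k\<bar> \<le> \<epsilon> * norm k * norm k"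
      by (intro order_trans[OF Cauchy_Schwarz_ineq2 mult_right_mono]) auto
    moreover have "\<phi> 1 - \<phi> 0 = e (p + k) - e p - g p \<bullet> k - (A k \<bullet> k) / 2" by (simp add: \<phi>_def)
    ultimately show ?thesis using s(3) by (simp add: power2_norm_eq_inner[symmetric] power2_eq_square)
  qed
  with d(1) that show ?thesis by blast
qed

text \<open>
  The resolvent of a convex function.  It turns the multivalued gradient of \<open>W\<close> into two Lipschitz
  maps: \<open>resid p\<close> is a subgradient of \<open>W\<close> at \<open>prox p\<close>, and their sum is \<open>p\<close>.
\<close>

locale Moreau =
  fixes W :: "'a::euclidean_space \<Rightarrow> real" and L :: real
  assumes conv: "convex_on UNIV W" and lip: "L-lipschitz_on UNIV W"
begin

definition prox :: "'a \<Rightarrow> 'a" where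
  "prox p = (SOME x. \<forall>y. W x + (norm (x - p))\<^sup>2 / 2 \<le> W y + (norm (y - p))\<^sup>2 / 2)"

definition resid :: "'a \<Rightarrow> 'a" where "resid p = p - prox p"

definition env :: "'a \<Rightarrow> real" where "env p = W (prox p) + (norm (prox p - p))\<^sup>2 / 2"

text \<open>
  The Lipschitz bound makes the functional coercive, so that a minimiser exists.
\<close>

lemma prox_min: "W (prox p) + (norm (prox p - p))\<^sup>2 / 2 \<le> W y + (norm (y - p))\<^sup>2 / 2"
proof -
  let ?F = "\<lambda>x. W x + (norm (x - p))\<^sup>2 / 2"
  have L: "L \<ge> 0" using lip by (rule lipschitz_on_nonneg)
  have cont: "continuous_on UNIV W" using lip by (rule lipschitz_on_continuous_on)
  have "\<exists>x\<in>cball p (2 * L). \<forall>y\<in>cball p (2 * L). ?F x \<le> ?F y"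
    by (rule continuous_attains_inf)
       (use L in \<open>auto intro!: continuous_intros continuous_on_subset[OF cont]\<close>)
  then obtain x where x: "\<And>y. y \<in> cball p (2 * L) \<Longrightarrow> ?F x \<le> ?F y" by blast
  have "?F x \<le> ?F y" for y
  proof (cases "y \<in> cball p (2 * L)")
    case False
    let ?r = "norm (y - p)"
    have r: "?r > 2 * L" using False by (simp add: dist_norm norm_minus_commute)
    have "\<bar>W y - W p\<bar> \<le> L * ?r" using lipschitz_onD[OF lip, of y p] by (simp add: dist_norm dist_real_def)
    moreover have "2 * L * ?r \<le> ?r\<^sup>2" using r L by (simp add: power2_eq_square mult_right_mono)
    moreover have "?F x \<le> ?F p" using x[of p] L by simp
    ultimately show ?thesis by simp
  qed (rule x)
  then have "\<exists>x. \<forall>y. ?F x \<le> ?F y" by blast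
  from someI_ex[OF this] show ?thesis unfolding prox_def by blast
qed

lemma prox_subgradient: "W (prox p) + resid p \<bullet> (y - prox p) \<le> W y"
proof -
  let ?x = "prox p"
  define b where "b = W y - W ?x - (p - ?x) \<bullet> (y - ?x)"
  define c where "c = (norm (y - ?x))\<^sup>2 / 2"
  have ineq: "0 \<le> b + t * c" if t: "0 < t" "t \<le> 1" for t
  proof -
    let ?z = "(1 - t) *\<^sub>R ?x + t *\<^sub>R y"
    have z: "?z - p = (?x - p) + t *\<^sub>R (y - ?x)" by (simp add: algebra_simps)
    have "W ?x + (norm (?x - p))\<^sup>2 / 2 \<le> W ?z + (norm (?z - p))\<^sup>2 / 2" by (rule prox_min)
    also have "W ?z \<le> (1 - t) * W ?x + t * W y"
      using convex_onD[OF conv, of t ?x y] t by simp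
    also have "(norm (?z - p))\<^sup>2 = (norm (?x - p))\<^sup>2 + 2 * t * ((?x - p) \<bullet> (y - ?x)) + t\<^sup>2 * (norm (y - ?x))\<^sup>2"
      unfolding z power2_norm_eq_inner by (simp add: inner_add_left inner_add_right inner_commute power2_eq_square)
    finally have *: "W ?x + (norm (?x - p))\<^sup>2 / 2 \<le> (1 - t) * W ?x + t * W y +
      ((norm (?x - p))\<^sup>2 + 2 * t * ((?x - p) \<bullet> (y - ?x)) + t\<^sup>2 * (norm (y - ?x))\<^sup>2) / 2" by simp
    have lin: "0 \<le> t * (v - u + D + t * (n2 / 2))"
      if "u + n1 / 2 \<le> (1 - t) * u + t * v + (n1 + 2 * t * D + t\<^sup>2 * n2) / 2" for u v n1 n2 D :: real
      using that by (simp add: field_simps power2_eq_square)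
    have "(?x - p) \<bullet> (y - ?x) = - ((p - ?x) \<bullet> (y - ?x))" by (simp add: inner_diff_left)
    then have "0 \<le> t * (b + t * c)" using lin[OF *] by (simp add: b_def c_def)
    then show ?thesis using t by (simp add: zero_le_mult_iff)
  qed
  have "0 \<le> b"
  proof (rule ccontr)
    assume "\<not> 0 \<le> b"
    then have b: "b < 0" by simp
    have c: "c \<ge> 0" by (simp add: c_def)
    let ?t = "min 1 (- b / (2 * (c + 1)))"
    have t0: "0 < - b / (2 * (c + 1))" using b c by (intro divide_pos_pos) auto
    then have t: "0 < ?t" "?t \<le> 1" by auto
    have "?t * c \<le> - b / (2 * (c + 1)) * (c + 1)"
      using t0 c by (intro mult_mono) auto
    also have "\<dots> = - b / 2" using c by (simp add: field_simps)
    finally show False using ineq[OF t] b by linarith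
  qed
  then show ?thesis by (simp add: b_def resid_def)
qed

text \<open>
  Conversely every subgradient arises in this way: if \<open>g\<close> is a subgradient at \<open>x\<close>, then \<open>p = x + g\<close>
  has \<open>prox p = x\<close> and \<open>resid p = g\<close>.
\<close>

lemma prox_eqI:
  assumes "\<And>y. W x + (p - x) \<bullet> (y - x) \<le> W y"
  shows "prox p = x"
proof -
  have "W x + (p - x) \<bullet> (prox p - x) \<le> W (prox p)" by (rule assms)
  moreover have "W (prox p) + (p - prox p) \<bullet> (x - prox p) \<le> W x"
    using prox_subgradient[of p x] by (simp add: resid_def)
  moreover have "(p - x) \<bullet> (prox p - x) + (p - prox p) \<bullet> (x - prox p) = (prox p - x) \<bullet> (prox p - x)"
    by (simp add: inner_diff_left inner_diff_right inner_commute)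
  ultimately have "(prox p - x) \<bullet> (prox p - x) \<le> 0" by linarith
  then show ?thesis by (metis eq_iff_diff_eq_0 inner_eq_zero_iff inner_ge_zero order_antisym)
qed

text \<open>
  Monotonicity of the subgradient, written in terms of \<open>p\<close>.
\<close>

lemma resid_firm: "(norm (resid p - resid q))\<^sup>2 \<le> (resid p - resid q) \<bullet> (p - q)"
proof -
  have "W (prox p) + resid p \<bullet> (prox q - prox p) \<le> W (prox q)"
    "W (prox q) + resid q \<bullet> (prox p - prox q) \<le> W (prox p)" by (rule prox_subgradient)+
  then have "0 \<le> (resid p - resid q) \<bullet> (prox p - prox q)"
    by (simp add: inner_diff_left inner_diff_right)
  moreover have "prox p - prox q = (p - q) - (resid p - resid q)" by (simp add: resid_def)
  ultimately show ?thesis by (simp add: inner_diff_right power2_norm_eq_inner)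
qed

lemma resid_lipschitz: "1-lipschitz_on UNIV resid"
proof (rule lipschitz_onI)
  fix p q :: 'a
  have "(norm (resid p - resid q))\<^sup>2 \<le> norm (resid p - resid q) * norm (p - q)"
    using resid_firm[of p q] norm_cauchy_schwarz[of "resid p - resid q" "p - q"] by linarith
  then show "dist (resid p) (resid q) \<le> 1 * dist p q"
    by (cases "resid p = resid q") (auto simp: dist_norm power2_eq_square)
qed simp

lemma env_upper: "env q \<le> env p + resid p \<bullet> (q - p) + (norm (q - p))\<^sup>2 / 2"
proof -
  have "env q \<le> W (prox p) + (norm (prox p - q))\<^sup>2 / 2" unfolding env_def by (rule prox_min)
  moreover have "(norm (prox p - q))\<^sup>2 = (norm (prox p - p))\<^sup>2 + 2 * (resid p \<bullet> (q - p)) + (norm (q - p))\<^sup>2"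
    unfolding power2_norm_eq_inner resid_def by (simp add: inner_diff_left inner_diff_right inner_commute)
  ultimately show ?thesis unfolding env_def[of p] by linarith
qed

lemma env_lower: "env p + resid p \<bullet> (q - p) \<le> env q"
proof -
  have 1: "W (prox p) + resid p \<bullet> (prox q - prox p) \<le> W (prox q)" by (rule prox_subgradient)
  have 2: "prox q - prox p = (q - p) - (resid q - resid p)" by (simp add: resid_def)
  have 3: "prox r - r = - resid r" for r by (simp add: resid_def)
  have "0 \<le> (norm (resid q - resid p))\<^sup>2" by simp
  then have "2 * (resid p \<bullet> resid q) \<le> (norm (resid q))\<^sup>2 + (norm (resid p))\<^sup>2"
    unfolding power2_norm_eq_inner by (simp add: inner_diff_left inner_diff_right inner_commute)
  with 1 show ?thesis unfolding 2 env_def 3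
    by (simp add: inner_diff_right power2_norm_eq_inner) 
qed

lemma env_derivative: "(env has_derivative (\<lambda>v. resid p \<bullet> v)) (at p)"
  unfolding has_derivative_at_alt
proof (intro conjI allI impI)
  show "bounded_linear (\<lambda>v. resid p \<bullet> v)" by (rule bounded_linear_inner_right)
  fix \<epsilon> :: real assume eps: "\<epsilon> > 0"
  have "norm (env y - env p - resid p \<bullet> (y - p)) \<le> \<epsilon> * norm (y - p)" if "norm (y - p) < 2 * \<epsilon>" for y
  proof -
    have "norm (y - p) * norm (y - p) \<le> 2 * \<epsilon> * norm (y - p)" using that by (intro mult_right_mono) auto
    then show ?thesis using env_upper[of y p] env_lower[of p y] by (simp add: power2_eq_square)
  qed
  then show "\<exists>d>0. \<forall>y. norm (y - p) < d \<longrightarrow> norm (env y - env p - resid p \<bullet> (y - p)) \<le> \<epsilon> * norm (y - p)"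
    using eps by (intro exI[of _ "2 * \<epsilon>"]) auto
qed

lemma resid_derivative_limit:
  assumes "(resid has_derivative A) (at p)"
  shows "(\<lambda>n. real (Suc n) *\<^sub>R (resid (p + (1 / real (Suc n)) *\<^sub>R v) - resid p)) \<longlonglongrightarrow> A v"
proof -
  interpret A: bounded_linear A using assms by (rule has_derivative_bounded_linear)
  have "((\<lambda>t. p + t *\<^sub>R v) has_derivative (\<lambda>t. t *\<^sub>R v)) (at 0)" by (auto intro!: derivative_eq_intros)
  from has_derivative_compose[OF this, of resid A] assms
  have "((\<lambda>t. resid (p + t *\<^sub>R v)) has_derivative (\<lambda>t. t *\<^sub>R A v)) (at 0)" by (simp add: A.scaleR)
  then have "((\<lambda>t. norm (resid (p + t *\<^sub>R v) - resid p - t *\<^sub>R A v) / norm t) \<longlongrightarrow> 0) (at 0)"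
    unfolding has_derivative_at by simp
  moreover have "filterlim (\<lambda>n. 1 / real (Suc n)) (at 0) sequentially"
    unfolding filterlim_at using LIMSEQ_inverse_real_of_nat
    by (intro conjI always_eventually allI) (simp_all add: inverse_eq_divide del: of_nat_Suc)
  ultimately have lim: "(\<lambda>n. norm (resid (p + (1 / real (Suc n)) *\<^sub>R v) - resid p - (1 / real (Suc n)) *\<^sub>R A v) / norm (1 / real (Suc n))) \<longlonglongrightarrow> 0"
    by (rule filterlim_compose)
  have "norm (x - (1 / real (Suc n)) *\<^sub>R A v) / norm (1 / real (Suc n)) = norm (real (Suc n) *\<^sub>R x - A v)" for x n
  proof -
    have "real (Suc n) *\<^sub>R x - A v = real (Suc n) *\<^sub>R (x - (1 / real (Suc n)) *\<^sub>R A v)"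
      by (simp add: scaleR_diff_right)
    then show ?thesis by (simp only: norm_scaleR) (simp add: field_simps)
  qed
  then have "(\<lambda>n. norm (real (Suc n) *\<^sub>R (resid (p + (1 / real (Suc n)) *\<^sub>R v) - resid p) - A v)) \<longlonglongrightarrow> 0"
    using lim by simp
  from LIM_zero_cancel[OF tendsto_norm_zero_cancel[OF this]] show ?thesis .
qed

lemma resid_derivative_firm:
  assumes A: "(resid has_derivative A) (at p)"
  shows "A v \<bullet> A v \<le> A v \<bullet> v"
proof -
  define d where "d n = real (Suc n) *\<^sub>R (resid (p + (1 / real (Suc n)) *\<^sub>R v) - resid p)" for n
  have lim: "d \<longlonglongrightarrow> A v" unfolding d_def by (rule resid_derivative_limit[OF A])
  have "d n \<bullet> d n \<le> d n \<bullet> v" for n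
  proof -
    let ?t = "1 / real (Suc n)"
    let ?R = "resid (p + ?t *\<^sub>R v) - resid p"
    have "?R \<bullet> ?R \<le> ?R \<bullet> (?t *\<^sub>R v)" using resid_firm[of "p + ?t *\<^sub>R v" p] by (simp add: power2_norm_eq_inner)
    then have "(real (Suc n))\<^sup>2 * (?R \<bullet> ?R) \<le> (real (Suc n))\<^sup>2 * (?R \<bullet> (?t *\<^sub>R v))"
      by (intro mult_left_mono) auto
    moreover have "(real (Suc n))\<^sup>2 * (?R \<bullet> (?t *\<^sub>R v)) = d n \<bullet> v" by (simp add: d_def power2_eq_square)
    moreover have "(real (Suc n))\<^sup>2 * (?R \<bullet> ?R) = d n \<bullet> d n" by (simp add: d_def power2_eq_square)
    ultimately show ?thesis by simp
  qed
  then show ?thesis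
    by (intro LIMSEQ_le[OF tendsto_inner[OF lim lim] tendsto_inner[OF lim tendsto_const]]) auto
qed

text \<open>
  If \<open>resid\<close> takes the same value at two points, then firm monotonicity at both ends makes it constant
  on the segment between them, so the derivative vanishes in that direction.
\<close>

lemma resid_inj_at:
  assumes A: "(resid has_derivative A) (at p)" and inj: "\<And>v. A v = 0 \<Longrightarrow> v = 0" and eq: "resid q = resid p"
  shows "q = p"
proof -
  have "resid (p + s *\<^sub>R (q - p)) = resid p" if s: "0 < s" "s \<le> 1" for s
  proof (cases "s = 1")
    case False
    then have s1: "s < 1" using s by simp
    let ?R = "resid (p + s *\<^sub>R (q - p)) - resid p"
    have 1: "(norm ?R)\<^sup>2 \<le> s * (?R \<bullet> (q - p))" using resid_firm[of "p + s *\<^sub>R (q - p)" p] by simp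
    have "p + s *\<^sub>R (q - p) - q = (s - 1) *\<^sub>R (q - p)" by (simp add: algebra_simps)
    then have 2: "(norm ?R)\<^sup>2 \<le> (s - 1) * (?R \<bullet> (q - p))" using resid_firm[of "p + s *\<^sub>R (q - p)" q] eq by simp
    have "?R \<bullet> (q - p) \<ge> 0" using order_trans[OF zero_le_power2 1] s by (simp add: zero_le_mult_iff)
    then have "(s - 1) * (?R \<bullet> (q - p)) \<le> 0" using s1 by (simp add: mult_nonpos_nonneg)
    then have "(norm ?R)\<^sup>2 \<le> 0" using 2 by linarith
    then show ?thesis by simp
  qed (use eq in simp)
  then have "(\<lambda>n. real (Suc n) *\<^sub>R (resid (p + (1 / real (Suc n)) *\<^sub>R (q - p)) - resid p)) = (\<lambda>n. 0)"
    by (auto simp: fun_eq_iff)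
  then have "(\<lambda>n. 0 :: 'a) \<longlonglongrightarrow> A (q - p)" using resid_derivative_limit[OF A, of "q - p"] by simp
  then have "A (q - p) = 0" by (simp add: LIMSEQ_const_iff)
  then have "q - p = 0" by (rule inj)
  then show ?thesis by simp
qed

end

section \<open>Eigenvalues of self-adjoint operators\<close>

text \<open>
  A maximiser of the quadratic form on the unit sphere of \<open>S\<close> is an eigenvector: otherwise moving it
  in the direction of \<open>u = L v - c v\<close> would increase the form to first order.
\<close>

lemma self_adjoint_max_eigenvector:
  fixes L :: "'a::euclidean_space \<Rightarrow> 'a"
  assumes lin: "linear L" and sa: "\<And>v w. L v \<bullet> w = v \<bullet> L w"
    and S: "subspace S" "S \<noteq> {0}" "\<And>v. v \<in> S \<Longrightarrow> L v \<in> S"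
  obtains v where "v \<in> S" "norm v = 1" "L v = (L v \<bullet> v) *\<^sub>R v"
proof -
  interpret linear L by fact
  have cL: "continuous_on A L" for A using linear_continuous_on[OF linear_conv_bounded_linear[THEN iffD1, OF lin]] .
  obtain x where x: "x \<in> S" "x \<noteq> 0" using S subspace_0[OF S(1)] by blast
  then have "x /\<^sub>R norm x \<in> S \<inter> sphere 0 1" using S(1) by (simp add: subspace_scale)
  then have ne: "S \<inter> sphere 0 1 \<noteq> {}" by blast
  have comp: "compact (S \<inter> sphere 0 1)"
    using S(1) closed_subspace by (intro closed_Int_compact) auto
  have "continuous_on (S \<inter> sphere 0 1) (\<lambda>v. L v \<bullet> v)"
    by (intro continuous_intros cL)
  from continuous_attains_sup[OF comp ne this] obtain v where v: "v \<in> S" "norm v = 1"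
    and max: "\<And>w. w \<in> S \<Longrightarrow> norm w = 1 \<Longrightarrow> L w \<bullet> w \<le> L v \<bullet> v" by auto
  define c where "c = L v \<bullet> v"
  have max': "L w \<bullet> w \<le> c * (w \<bullet> w)" if "w \<in> S" for w
  proof (cases "w = 0")
    case False
    have "L (w /\<^sub>R norm w) \<bullet> (w /\<^sub>R norm w) \<le> c"
      using max[of "w /\<^sub>R norm w"] that False S(1) by (simp add: c_def subspace_scale)
    then have "(L w \<bullet> w) / (norm w * norm w) \<le> c" by (simp add: scale divide_inverse mult_ac)
    then show ?thesis using False by (simp add: divide_le_eq power2_norm_eq_inner[symmetric] power2_eq_square mult.commute)
  qed (simp add: zero)
  define u where "u = L v - c *\<^sub>R v"
  have uS: "u \<in> S" using v S by (simp add: u_def subspace_diff subspace_scale)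
  define M where "M = c * (u \<bullet> u) - L u \<bullet> u"
  have quad: "2 * t * (u \<bullet> u) \<le> t\<^sup>2 * M" for t
  proof -
    have vt: "v + t *\<^sub>R u \<in> S" using v uS S(1) by (simp add: subspace_add subspace_scale)
    have "L u \<bullet> v = L v \<bullet> u" using sa[of u v] by (simp add: inner_commute)
    then have 1: "L (v + t *\<^sub>R u) \<bullet> (v + t *\<^sub>R u) = c + 2 * t * (L v \<bullet> u) + t\<^sup>2 * (L u \<bullet> u)"
      by (simp add: add scale inner_add_left inner_add_right c_def power2_eq_square algebra_simps)
    have 2: "(v + t *\<^sub>R u) \<bullet> (v + t *\<^sub>R u) = 1 + 2 * t * (v \<bullet> u) + t\<^sup>2 * (u \<bullet> u)"
      using v(2) by (simp add: inner_add_left inner_add_right power2_eq_square algebra_simps inner_commute norm_eq_1)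
    have 3: "u \<bullet> u = L v \<bullet> u - c * (v \<bullet> u)" by (simp add: u_def inner_diff_left)
    have "c + 2 * t * (L v \<bullet> u) + t\<^sup>2 * (L u \<bullet> u) \<le> c * (1 + 2 * t * (v \<bullet> u) + t\<^sup>2 * (u \<bullet> u))"
      using max'[OF vt] unfolding 1 2 .
    then have "2 * t * (L v \<bullet> u - c * (v \<bullet> u)) \<le> t\<^sup>2 * M" by (simp add: M_def algebra_simps)
    then show ?thesis by (simp only: 3)
  qed
  have "u = 0"
  proof (rule ccontr)
    assume "u \<noteq> 0"
    then have up: "u \<bullet> u > 0" by simp
    show False
    proof (cases "M \<le> 0")
      case True then show False using quad[of 1] up by simp
    next
      case False
      have "2 * ((u \<bullet> u) * (u \<bullet> u)) / M \<le> ((u \<bullet> u) * (u \<bullet> u)) / M"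
        using quad[of "(u \<bullet> u) / M"] False by (simp add: power2_eq_square)
      then show False using mult_pos_pos[OF up up] False by (simp add: divide_le_cancel)
    qed
  qed
  then show ?thesis using that v unfolding u_def c_def by simp
qed

lemma self_adjoint_eigenbasis_subspace:
  fixes L :: "'a::euclidean_space \<Rightarrow> 'a"
  assumes lin: "linear L" and sa: "\<And>v w. L v \<bullet> w = v \<bullet> L w"
    and "subspace S" "\<And>v. v \<in> S \<Longrightarrow> L v \<in> S"
  shows "\<exists>B. B \<subseteq> S \<and> pairwise orthogonal B \<and> (\<forall>b\<in>B. norm b = 1 \<and> L b = (L b \<bullet> b) *\<^sub>R b) \<and> span B = S"
  using assms(3,4)
proof (induction "dim S" arbitrary: S rule: less_induct)
  case less
  interpret linear L by fact
  show ?case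
  proof (cases "S = {0}")
    case True
    then show ?thesis by (intro exI[of _ "{}"]) auto
  next
    case False
    obtain v where v: "v \<in> S" "norm v = 1" "L v = (L v \<bullet> v) *\<^sub>R v"
      using self_adjoint_max_eigenvector[OF lin sa less(2) False less(3)] by blast
    let ?T = "S \<inter> {w. v \<bullet> w = 0}"
    have T: "subspace ?T" by (rule subspace_inter[OF less(2) subspace_hyperplane])
    have vT: "v \<notin> ?T" using v by auto
    have "dim ?T < dim S"
    proof (rule dim_psubset)
      have "span ?T = ?T" "span S = S" using T less(2) by (auto simp: span_eq_iff)
      then show "span ?T \<subset> span S" using v(1) vT by blast
    qed
    moreover have "L w \<in> ?T" if "w \<in> ?T" for w
    proof -
      have "v \<bullet> L w = L v \<bullet> w" using sa by simp
      also have "\<dots> = (L v \<bullet> v) * (v \<bullet> w)" by (subst v(3)) simp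
      finally show ?thesis using that less(3) by simp
    qed
    ultimately obtain B where B: "B \<subseteq> ?T" "pairwise orthogonal B" "\<forall>b\<in>B. norm b = 1 \<and> L b = (L b \<bullet> b) *\<^sub>R b" "span B = ?T"
      using less(1)[OF _ T] by blast
    have "span (insert v B) = S"
    proof
      show "span (insert v B) \<subseteq> S" using v(1) B(1) less(2) by (intro span_minimal) auto
      show "S \<subseteq> span (insert v B)"
      proof
        fix w assume w: "w \<in> S"
        have "w - (v \<bullet> w) *\<^sub>R v \<in> ?T"
          using w v less(2) by (simp add: subspace_diff subspace_scale inner_diff_right norm_eq_1)
        then have "w - (v \<bullet> w) *\<^sub>R v \<in> span (insert v B)"
          using B(4) span_mono[of B "insert v B"] by auto
        then have "w - (v \<bullet> w) *\<^sub>R v + (v \<bullet> w) *\<^sub>R v \<in> span (insert v B)"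
          by (rule span_add) (simp add: span_scale span_base)
        then show "w \<in> span (insert v B)" by simp
      qed
    qed
    moreover have "pairwise orthogonal (insert v B)"
      using B(1,2) by (auto simp: pairwise_insert orthogonal_def inner_commute)
    ultimately show ?thesis
      using v B(1,3) by (intro exI[of _ "insert v B"]) auto
  qed
qed

theorem self_adjoint_eigenbasis:
  fixes L :: "'a::euclidean_space \<Rightarrow> 'a"
  assumes lin: "linear L" and sa: "\<And>v w. L v \<bullet> w = v \<bullet> L w"
  obtains B where "finite B" "card B = DIM('a)" "\<And>b. b \<in> B \<Longrightarrow> b \<bullet> b = 1" 
    "\<And>b b'. b \<in> B \<Longrightarrow> b' \<in> B \<Longrightarrow> b \<noteq> b' \<Longrightarrow> b \<bullet> b' = 0"
    "\<And>b. b \<in> B \<Longrightarrow> L b = (L b \<bullet> b) *\<^sub>R b" "\<And>v. v = (\<Sum>b\<in>B. (v \<bullet> b) *\<^sub>R b)" "independent B"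
proof -
  obtain B where B: "pairwise orthogonal B" "\<forall>b\<in>B. norm b = 1 \<and> L b = (L b \<bullet> b) *\<^sub>R b" "span B = UNIV"
    using self_adjoint_eigenbasis_subspace[OF lin sa, of UNIV] by auto
  have "0 \<notin> B" using B(2) by force
  then have ind: "independent B" using B(1) pairwise_orthogonal_independent by blast
  have fin: "finite B" using ind independent_imp_finite by blast
  have card: "card B = DIM('a)" using ind B(3) by (metis dim_eq_card_independent dim_span dim_UNIV)
  have orth: "b \<bullet> b' = 0" if "b \<in> B" "b' \<in> B" "b \<noteq> b'" for b b'
    using B(1) that by (auto simp: pairwise_def orthogonal_def)
  have rep: "v = (\<Sum>b\<in>B. (v \<bullet> b) *\<^sub>R b)" for v
  proof -
    have "v - (\<Sum>b\<in>B. (v \<bullet> b) *\<^sub>R b) = 0"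
    proof (rule vector_eq_dot_span)
      show "v - (\<Sum>b\<in>B. (v \<bullet> b) *\<^sub>R b) \<in> span B" "0 \<in> span B" using B(3) by auto
      fix b assume b: "b \<in> B"
      have "(\<Sum>b'\<in>B. (v \<bullet> b') * (b' \<bullet> b)) = (\<Sum>b'\<in>B. if b' = b then v \<bullet> b else 0)"
        using b orth B(2) by (intro sum.cong) (auto simp: norm_eq_1)
      then show "b \<bullet> (v - (\<Sum>b\<in>B. (v \<bullet> b) *\<^sub>R b)) = b \<bullet> 0"
        using b fin by (simp add: inner_diff_right inner_sum_right inner_commute)
    qed
    then show ?thesis by simp
  qed
  show ?thesis
    using that[OF fin card _ orth _ rep ind] B(2) by (auto simp: norm_eq_1)
qed

text \<open>
  The sum of all but the largest eigenvalue is the trace minus the largest eigenvalue.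
\<close>

lemma lower_trace_ge_trace_minus_bound:
  fixes L :: "'a::euclidean_space \<Rightarrow> 'a"
  assumes lin: "linear L" and sa: "\<And>v w. L v \<bullet> w = v \<bullet> L w"
    and dim: "DIM('a) = Suc m" and bd: "\<And>v. L v \<bullet> v \<le> \<mu> * (v \<bullet> v)"
  shows "(\<Sum>i\<in>Basis. L i \<bullet> i) - \<mu> \<le> lower_trace m L"
proof -
  interpret linear L by fact
  obtain B where B: "finite B" "card B = DIM('a)" "\<And>b. b \<in> B \<Longrightarrow> b \<bullet> b = 1" 
    "\<And>b b'. b \<in> B \<Longrightarrow> b' \<in> B \<Longrightarrow> b \<noteq> b' \<Longrightarrow> b \<bullet> b' = 0"
    "\<And>b. b \<in> B \<Longrightarrow> L b = (L b \<bullet> b) *\<^sub>R b" "\<And>v. v = (\<Sum>b\<in>B. (v \<bullet> b) *\<^sub>R b)" "independent B"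
    using self_adjoint_eigenbasis[OF lin sa] by blast
  define c where "c b = L b \<bullet> b" for b
  have Lrep: "L v = (\<Sum>b\<in>B. (c b * (v \<bullet> b)) *\<^sub>R b)" for v
  proof -
    have "L v = L (\<Sum>b\<in>B. (v \<bullet> b) *\<^sub>R b)" using B(6)[of v] by simp
    also have "\<dots> = (\<Sum>b\<in>B. (v \<bullet> b) *\<^sub>R L b)" by (simp add: sum scale)
    also have "\<dots> = (\<Sum>b\<in>B. (c b * (v \<bullet> b)) *\<^sub>R b)"
      by (rule sum.cong[OF refl], subst B(5)) (simp_all add: c_def)
    finally show ?thesis .
  qed
  have coord: "(\<Sum>b\<in>B. f b *\<^sub>R b) \<bullet> b' = f b'" if "b' \<in> B" for f b'
  proof -
    have "(\<Sum>b\<in>B. f b *\<^sub>R b) \<bullet> b' = (\<Sum>b\<in>B. if b = b' then f b' else 0)"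
      unfolding inner_sum_left using that B(3,4) by (intro sum.cong) auto
    then show ?thesis using that B(1) by simp
  qed
  have dimE: "dim {v. L v = d *\<^sub>R v} = card {b\<in>B. c b = d}" for d
  proof -
    have "{v. L v = d *\<^sub>R v} = span {b\<in>B. c b = d}"
    proof
      have "subspace {v. L v = d *\<^sub>R v}"
        by (auto simp: subspace_def add scale zero algebra_simps)
      moreover have "{b\<in>B. c b = d} \<subseteq> {v. L v = d *\<^sub>R v}" using B(5) by (auto simp: c_def)
      ultimately show "span {b\<in>B. c b = d} \<subseteq> {v. L v = d *\<^sub>R v}" by (intro span_minimal)
      show "{v. L v = d *\<^sub>R v} \<subseteq> span {b\<in>B. c b = d}"
      proof
        fix v assume "v \<in> {v. L v = d *\<^sub>R v}"
        then have Lv: "L v = d *\<^sub>R v" by simp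
        have "c b * (v \<bullet> b) = d * (v \<bullet> b)" if "b \<in> B" for b
          using coord[OF that, of "\<lambda>b. c b * (v \<bullet> b)"] unfolding Lrep[symmetric] Lv by auto
        then have 0: "v \<bullet> b = 0" if "b \<in> B" "c b \<noteq> d" for b using that by (metis mult_cancel_right)
        have "v = (\<Sum>b\<in>B. (v \<bullet> b) *\<^sub>R b)" by (rule B(6))
        also have "\<dots> = (\<Sum>b\<in>{b\<in>B. c b = d}. (v \<bullet> b) *\<^sub>R b)"
          using B(1) 0 by (intro sum.mono_neutral_right) auto
        also have "\<dots> \<in> span {b\<in>B. c b = d}" by (intro span_sum span_scale span_base)
        finally show "v \<in> span {b\<in>B. c b = d}" .
      qed
    qed
    moreover have "independent {b\<in>B. c b = d}" using B(7) by (rule independent_mono) auto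
    ultimately show ?thesis by (simp add: dim_eq_card_independent)
  qed
  define ls where "ls = sorted_list_of_multiset (image_mset c (mset_set B))"
  have cl: "count_list xs d = count (mset xs) d" for xs :: "real list" and d
    by (induction xs) auto
  have cnt: "count_list ls d = dim {v. L v = d *\<^sub>R v}" for d
  proof -
    have "count_list ls d = count (image_mset c (mset_set B)) d" by (simp add: cl ls_def)
    also have "\<dots> = card {b\<in>B. c b = d}"
      using B(1) by (simp add: count_image_mset' sum.If_cases eq_commute flip: sum.inter_filter)
    finally show ?thesis by (simp add: dimE)
  qed
  have sorted: "sorted ls" by (simp add: ls_def)
  have "eigenvalue_list L = ls"
    unfolding eigenvalue_list_def by (rule the1_equality[OF eigenvalue_list_ex1[OF sa]]) (use sorted cnt in auto)
  moreover have len: "length ls = Suc m"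
    using B(1,2) dim by (metis ls_def mset_sorted_list_of_multiset size_image_mset size_mset size_mset_set)
  moreover have ne: "ls \<noteq> []" using len by auto
  ultimately have lt: "lower_trace m L = sum_list ls - last ls"
    unfolding lower_trace_def
    by (metis add_diff_cancel_right' append_butlast_last_id butlast_conv_take diff_Suc_1 sum_list.append sum_list_simps(2) sum_list.Nil add_0_right sum_list.Cons)
  have "sum_list ls = sum_mset (image_mset c (mset_set B))"
    by (metis ls_def mset_sorted_list_of_multiset sum_mset_sum_list)
  also have "\<dots> = (\<Sum>b\<in>B. c b)" by (simp add: sum_unfold_sum_mset)
  also have "\<dots> = (\<Sum>b\<in>B. \<Sum>i\<in>Basis. c b * ((i \<bullet> b) * (i \<bullet> b)))"
  proof (rule sum.cong[OF refl])
    fix b assume b: "b \<in> B"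
    have "(\<Sum>i\<in>Basis. (i \<bullet> b) * (i \<bullet> b)) = b \<bullet> b"
      by (subst euclidean_inner[of b b]) (simp add: inner_commute)
    then show "c b = (\<Sum>i\<in>Basis. c b * ((i \<bullet> b) * (i \<bullet> b)))" using B(3)[OF b] by (simp flip: sum_distrib_left)
  qed
  also have "\<dots> = (\<Sum>i\<in>Basis. \<Sum>b\<in>B. c b * ((i \<bullet> b) * (i \<bullet> b)))" by (rule sum.swap)
  also have "\<dots> = (\<Sum>i\<in>Basis. L i \<bullet> i)"
  proof (rule sum.cong[OF refl])
    fix i :: 'a
    have "L i \<bullet> i = (\<Sum>b\<in>B. (c b * (i \<bullet> b)) *\<^sub>R b) \<bullet> i" by (subst Lrep) simp
    also have "\<dots> = (\<Sum>b\<in>B. c b * ((i \<bullet> b) * (i \<bullet> b)))"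
      unfolding inner_sum_left by (intro sum.cong) (auto simp: inner_commute)
    finally show "(\<Sum>b\<in>B. c b * ((i \<bullet> b) * (i \<bullet> b))) = L i \<bullet> i" by simp
  qed
  finally have tr: "sum_list ls = (\<Sum>i\<in>Basis. L i \<bullet> i)" .
  have "last ls \<in> set ls" using ne by simp
  also have "set ls = c ` B" using B(1) by (simp add: ls_def)
  finally obtain b where b: "b \<in> B" "last ls = c b" by blast
  have "last ls \<le> \<mu>" using bd[of b] B(3)[OF b(1)] b(2) by (simp add: c_def)
  then show ?thesis using lt tr by simp
qed

section \<open>Quadratic functions touching a set with curvature bound\<close>

lemma sum_Basis_prod:
  "(\<Sum>i\<in>(Basis :: ('a::euclidean_space \<times> real) set). f i) = (\<Sum>i\<in>Basis. f (i, 0)) + f (0, 1)"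
proof -
  have "(\<Sum>i\<in>(Basis :: ('a \<times> real) set). f i) = sum f ((\<lambda>i. (i, 0)) ` Basis) + sum f ((\<lambda>i. (0, i)) ` {1})"
    unfolding Basis_prod_def by (subst sum.union_disjoint) (auto simp: Basis_real_def)
  also have "sum f ((\<lambda>i::'a. (i, 0::real)) ` Basis) = (\<Sum>i\<in>Basis. f (i, 0))"
    by (subst sum.reindex) (auto intro: inj_onI)
  finally show ?thesis by simp
qed

text \<open>
  A quadratic function of \<open>y'\<close> with gradient \<open>q\<close> and Hessian \<open>- S\<close> touches \<open>\<Gamma>\<close> from above at \<open>z\<close>.
  The defining function \<open>\<psi>\<close> of its graph has Hessian \<open>S \<oplus> 0\<close> and gradient \<open>N0 = (-q, 1)\<close> at \<open>z\<close>, and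
  the conclusion is that the trace of \<open>S \<oplus> 0\<close> on the tangent hyperplane of the graph is at most
  \<open>h * norm N0\<close>.

  The lowest eigenvalues of the Hessian of \<open>\<psi>\<close> itself do not give that tangential trace, since the
  Hessian may mix normal and tangential directions.  Therefore \<open>\<psi>\<close> is multiplied by an affine function
  \<open>\<rho>\<close> with \<open>\<rho> z = 1\<close>.  Near \<open>z\<close> this keeps the sign of \<open>\<psi>\<close> and the gradient at \<open>z\<close>, and
  it adds \<open>N0 \<otimes> \<beta> + \<beta> \<otimes> N0\<close> to the Hessian.  The vector \<open>\<beta>\<close> is chosen so that the
  mixed terms cancel and \<open>N0\<close> becomes an eigenvector whose eigenvalue \<open>\<mu>\<close> dominates all the others;
  the lower trace is then the trace minus \<open>\<mu>\<close>.
\<close>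

theorem nh_subset_touching_trace:
  fixes \<Gamma> :: "((real ^ 'n) \<times> real) set" and S :: "real ^ 'n \<Rightarrow> real ^ 'n"
  assumes nh: "nh_subset h \<Omega> \<Gamma>" and z: "z \<in> \<Gamma>"
    and lin: "linear S" and sa: "\<And>v w. S v \<bullet> w = v \<bullet> S w"
    and r: "r > 0"
    and touch: "\<And>y. y \<in> \<Gamma> \<Longrightarrow> dist y z < r \<Longrightarrow>
      snd y \<le> snd z + q \<bullet> (fst y - fst z) - S (fst y - fst z) \<bullet> (fst y - fst z) / 2"
  shows "(\<Sum>i\<in>Basis. S i \<bullet> i) - S q \<bullet> q / (1 + q \<bullet> q) \<le> h * sqrt (1 + q \<bullet> q)"
proof -
  have blS: "bounded_linear S" using lin by (simp add: linear_conv_bounded_linear)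
  interpret S: bounded_linear S by fact
  define G where "G = 1 + q \<bullet> q"
  have G: "G \<ge> 1" by (simp add: G_def)
  define \<kappa> where "\<kappa> = onorm S"
  have kap0: "\<kappa> \<ge> 0" unfolding \<kappa>_def by (rule onorm_pos_le[OF blS])
  have kap: "S v \<bullet> v \<le> \<kappa> * (v \<bullet> v)" for v
  proof -
    have "S v \<bullet> v \<le> norm (S v) * norm v" by (rule norm_cauchy_schwarz)
    also have "\<dots> \<le> (\<kappa> * norm v) * norm v" unfolding \<kappa>_def by (intro mult_right_mono onorm[OF blS]) auto
    finally show ?thesis by (simp add: power2_norm_eq_inner[symmetric] power2_eq_square)
  qed
  define \<sigma> where "\<sigma> = S q \<bullet> q"
  define N where "N = (\<lambda>y :: (real^'n) \<times> real. (S (fst y - fst z) - q, 1 :: real))"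
  define N0 where "N0 = (- q, 1 :: real)"
  \<comment> \<open>The first summand cancels the mixed terms, the second makes the normal eigenvalue large.\<close>
  define \<beta> where "\<beta> = (1 / G) *\<^sub>R (S q, 0) + (\<kappa> / G) *\<^sub>R N0"
  define \<psi> where "\<psi> y = snd y - snd z - q \<bullet> (fst y - fst z) + S (fst y - fst z) \<bullet> (fst y - fst z) / 2" for y
  define \<rho> where "\<rho> y = 1 + \<beta> \<bullet> (y - z)" for y
  define f where "f y = \<psi> y * \<rho> y" for y
  define g where "g y = \<rho> y *\<^sub>R N y + \<psi> y *\<^sub>R \<beta>" for y
  define HH where "HH y v = (\<beta> \<bullet> v) *\<^sub>R N y + \<rho> y *\<^sub>R (S (fst v), 0) + (N y \<bullet> v) *\<^sub>R \<beta>" for y v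
  have bl: "bounded_linear (HH y)" for y
    unfolding HH_def
    by (intro bounded_linear_add bounded_linear_scaleR_const bounded_linear_inner_right
        bounded_linear_const_scaleR bounded_linear_Pair bounded_linear_zero
        bounded_linear_compose[OF blS bounded_linear_fst])
  define H where "H y = Blinfun (HH y)" for y
  have Happ: "blinfun_apply (H y) = HH y" for y
    unfolding H_def by (rule bounded_linear_Blinfun_apply[OF bl])
  have Nz: "N z = N0" "\<psi> z = 0" "\<rho> z = 1" by (simp_all add: N_def N0_def \<psi>_def \<rho>_def S.zero)
  have dpsi: "(\<psi> has_derivative (\<lambda>v. v \<bullet> N y)) (at y)" for y
  proof -
    have "(\<psi> has_derivative (\<lambda>v. snd v - q \<bullet> fst v + (S (fst y - fst z) \<bullet> fst v + S (fst v) \<bullet> (fst y - fst z)) / 2)) (at y)"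
      unfolding \<psi>_def
      by (auto intro!: derivative_eq_intros S.has_derivative simp: fun_eq_iff field_simps)
    moreover have "snd v - q \<bullet> fst v + (S (fst y - fst z) \<bullet> fst v + S (fst v) \<bullet> (fst y - fst z)) / 2 = v \<bullet> N y" for v
      using sa[of "fst v" "fst y - fst z"]
      by (cases v) (simp add: N_def inner_diff_right inner_commute)
    ultimately show ?thesis by simp
  qed
  have dell: "(\<rho> has_derivative (\<lambda>v. v \<bullet> \<beta>)) (at y)" for y
    unfolding \<rho>_def by (auto intro!: derivative_eq_intros simp: inner_commute)
  have dN: "(N has_derivative (\<lambda>v. (S (fst v), 0))) (at y)" for y
    unfolding N_def by (auto intro!: derivative_eq_intros S.has_derivative)
  have df: "GDERIV f y :> g y" for y
    unfolding gderiv_def f_def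
    by (rule has_derivative_eq_rhs[OF has_derivative_mult[OF dpsi dell]])
       (auto simp: g_def inner_add_right fun_eq_iff)
  have dg: "(g has_derivative blinfun_apply (H y)) (at y)" for y
    unfolding Happ g_def
    by (rule has_derivative_eq_rhs[OF has_derivative_add[OF has_derivative_scaleR[OF dell dN]
        has_derivative_scaleR[OF dpsi has_derivative_const]]])
       (auto simp: HH_def inner_commute fun_eq_iff)
  have cont: "continuous_on UNIV H"
  proof (rule continuous_on_blinfun_componentwise)
    fix i :: "(real^'n) \<times> real"
    have "continuous_on UNIV N" "continuous_on UNIV \<rho>"
      using dN dell by (auto intro!: continuous_at_imp_continuous_on has_derivative_continuous)
    then show "continuous_on UNIV (\<lambda>x. blinfun_apply (H x) i)"
      unfolding Happ HH_def by (intro continuous_intros)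
  qed
  have C2: "C2_on UNIV f g H" unfolding C2_on_def using df dg cont by auto
  have max: "\<forall>\<^sub>F y in at z within \<Gamma>. f y \<le> f z"
  proof -
    have "isCont \<rho> z" using dell by (rule has_derivative_continuous)
    then have "\<forall>\<^sub>F y in at z. \<rho> y > 0"
      using Nz(3) by (intro order_tendstoD(1)[of \<rho> "\<rho> z"]) (auto simp: isCont_def)
    then have "\<forall>\<^sub>F y in at z within \<Gamma>. \<rho> y > 0"
      by (rule filter_leD[OF at_le, rotated]) auto
    moreover have "\<forall>\<^sub>F y in at z within \<Gamma>. y \<in> \<Gamma> \<and> dist y z < r"
      using r by (auto simp: eventually_at)
    ultimately show ?thesis
    proof eventually_elim
      case (elim y)
      have "\<psi> y \<le> 0" using touch[of y] elim by (simp add: \<psi>_def)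
      then show ?case using elim by (simp add: f_def Nz mult_nonpos_nonneg)
    qed
  qed
  have gz: "g z = N0" by (simp add: g_def Nz)
  have norm_gz: "norm (g z) = sqrt (1 + q \<bullet> q)"
    by (simp add: gz N0_def norm_prod_def power2_norm_eq_inner add.commute)
  have "g z \<noteq> 0" by (simp add: gz N0_def zero_prod_def)
  then have visc: "lower_trace CARD('n) (HH z) \<le> h * sqrt (1 + q \<bullet> q)"
    using nh z C2 max norm_gz Happ[of z] unfolding nh_subset_def by (metis UNIV_I)
  have HHz: "HH z v = (\<beta> \<bullet> v) *\<^sub>R N0 + (S (fst v), 0) + (N0 \<bullet> v) *\<^sub>R \<beta>" for v
    by (simp add: HH_def Nz)
  have bN: "\<beta> \<bullet> N0 = \<kappa> - \<sigma> / G"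
  proof -
    have "N0 \<bullet> N0 = G" by (simp add: N0_def G_def)
    moreover have "(S q, 0) \<bullet> N0 = - \<sigma>" by (simp add: N0_def \<sigma>_def)
    ultimately show ?thesis using G by (simp add: \<beta>_def inner_add_left del: scaleR_Pair)
  qed
  have bv: "\<beta> \<bullet> v = (S q \<bullet> fst v + \<kappa> * (N0 \<bullet> v)) / G" for v
    by (cases v) (simp add: \<beta>_def inner_add_left add_divide_distrib)
  have tr: "(\<Sum>i\<in>Basis. HH z i \<bullet> i) = (\<Sum>i\<in>Basis. S i \<bullet> i) + 2 * (\<kappa> - \<sigma> / G)"
  proof -
    have "(\<Sum>i\<in>Basis. HH z i \<bullet> i) = (\<Sum>i\<in>Basis. 2 * ((\<beta> \<bullet> i) * (N0 \<bullet> i)) + (S (fst i), 0::real) \<bullet> i)"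
      unfolding HHz by (intro sum.cong refl) (simp add: inner_add_left)
    also have "\<dots> = 2 * (\<beta> \<bullet> N0) + (\<Sum>i\<in>Basis. (S (fst i), 0::real) \<bullet> i)"
      by (simp add: sum.distrib euclidean_inner[of \<beta> N0] sum_distrib_left)
    also have "(\<Sum>i\<in>(Basis :: ((real^'n) \<times> real) set). (S (fst i), 0 :: real) \<bullet> i) = (\<Sum>i\<in>Basis. S i \<bullet> i)"
      by (simp add: sum_Basis_prod)
    finally show ?thesis by (simp add: bN)
  qed
  define \<mu> where "\<mu> = 2 * \<kappa> - \<sigma> / G"
  have sG: "\<sigma> / G \<le> \<kappa>"
  proof -
    have "\<sigma> \<le> \<kappa> * (q \<bullet> q)" unfolding \<sigma>_def by (rule kap)
    also have "\<dots> \<le> \<kappa> * G" using kap0 by (intro mult_left_mono) (auto simp: G_def)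
    finally show ?thesis using G by (simp add: divide_le_eq)
  qed
  have bd: "HH z v \<bullet> v \<le> \<mu> * (v \<bullet> v)" for v
  proof -
    define m where "m = (N0 \<bullet> v) / G"
    define \<tau> where "\<tau> = v - m *\<^sub>R N0"
    have NN: "N0 \<bullet> N0 = G" by (simp add: N0_def G_def)
    have NvG: "N0 \<bullet> v = m * G" using G by (simp add: m_def)
    have tN: "N0 \<bullet> \<tau> = 0" by (simp add: \<tau>_def inner_diff_right NN NvG)
    have v: "v = \<tau> + m *\<^sub>R N0" by (simp add: \<tau>_def)
    have fv: "fst v = fst \<tau> - m *\<^sub>R q" unfolding v by (simp add: N0_def)
    have vv: "v \<bullet> v = \<tau> \<bullet> \<tau> + m\<^sup>2 * G"
      unfolding v using tN by (simp add: inner_add_left inner_add_right inner_commute NN power2_eq_square)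
    have Sqt: "S (fst \<tau>) \<bullet> q = S q \<bullet> fst \<tau>" using sa[of "fst \<tau>" q] by (simp add: inner_commute)
    have Sv: "S (fst v) \<bullet> fst v = S (fst \<tau>) \<bullet> fst \<tau> - 2 * m * (S q \<bullet> fst \<tau>) + m\<^sup>2 * \<sigma>"
      unfolding fv by (simp add: S.diff S.scaleR inner_diff_left inner_diff_right Sqt \<sigma>_def power2_eq_square algebra_simps)
    have Sqv: "S q \<bullet> fst v = S q \<bullet> fst \<tau> - m * \<sigma>" unfolding fv by (simp add: inner_diff_right \<sigma>_def)
    have "HH z v \<bullet> v = 2 * ((\<beta> \<bullet> v) * (N0 \<bullet> v)) + S (fst v) \<bullet> fst v"
      unfolding HHz by (cases v) (simp add: inner_add_left)
    also have "(\<beta> \<bullet> v) * (N0 \<bullet> v) = m * (S q \<bullet> fst \<tau> - m * \<sigma> + \<kappa> * (m * G))"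
      unfolding bv Sqv NvG using G by simp
    also have "2 * (m * (S q \<bullet> fst \<tau> - m * \<sigma> + \<kappa> * (m * G))) + S (fst v) \<bullet> fst v
      = S (fst \<tau>) \<bullet> fst \<tau> + (m\<^sup>2 * G) * \<mu>"
      unfolding Sv \<mu>_def using G by (simp add: power2_eq_square field_simps)
    also have "S (fst \<tau>) \<bullet> fst \<tau> \<le> \<mu> * (\<tau> \<bullet> \<tau>)"
    proof -
      have "S (fst \<tau>) \<bullet> fst \<tau> \<le> \<kappa> * (fst \<tau> \<bullet> fst \<tau>)" by (rule kap)
      also have "\<dots> \<le> \<mu> * (\<tau> \<bullet> \<tau>)"
        using sG kap0 by (intro mult_mono) (auto simp: \<mu>_def inner_prod_def)
      finally show ?thesis .
    qed
    finally show ?thesis unfolding vv by (simp add: algebra_simps)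
  qed
  have "linear (HH z)" using bl by (rule bounded_linear.linear)
  moreover have "HH z v \<bullet> w = v \<bullet> HH z w" for v w
    unfolding HHz by (cases v, cases w) (use sa in \<open>simp add: inner_add_left inner_add_right inner_commute\<close>)
  ultimately have "(\<Sum>i\<in>Basis. HH z i \<bullet> i) - \<mu> \<le> lower_trace CARD('n) (HH z)"
    by (rule lower_trace_ge_trace_minus_bound[OF _ _ _ bd]) auto
  then show ?thesis using visc unfolding tr \<mu>_def \<sigma>_def G_def by simp
qed

section \<open>Comparing the images of two differentiable maps\<close>

text \<open>
  The change of variables formula concerns coordinates indexed by a wellorder.  A finite index type is
  replaced by a copy that inherits a wellorder from an enumeration; renaming the coordinates preserves
  Lebesgue measure.
\<close>

typedef 'n wellordered_index = "UNIV :: 'n set" by auto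

instance wellordered_index :: (finite) finite
proof
  have "finite (range (Abs_wellordered_index :: 'a \<Rightarrow> 'a wellordered_index))" by simp
  then show "finite (UNIV :: 'a wellordered_index set)"
    unfolding type_definition.Abs_image[OF type_definition_wellordered_index] .
qed

instantiation wellordered_index :: (finite) wellorder
begin

definition index_rank :: "'a wellordered_index \<Rightarrow> nat" where
  "index_rank = (SOME f. inj f)"

definition less_eq_wellordered_index :: "'a wellordered_index \<Rightarrow> 'a wellordered_index \<Rightarrow> bool" where
  "x \<le> y \<longleftrightarrow> index_rank x \<le> index_rank y"

definition less_wellordered_index :: "'a wellordered_index \<Rightarrow> 'a wellordered_index \<Rightarrow> bool" where
  "x < y \<longleftrightarrow> index_rank x < index_rank y"

instance
proof
  have inj: "inj (index_rank :: 'a wellordered_index \<Rightarrow> nat)"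
  proof -
    obtain f :: "'a wellordered_index \<Rightarrow> nat" where "inj f"
      using finite_imp_inj_to_nat_seg[OF finite, of "UNIV :: 'a wellordered_index set"] by metis
    then show ?thesis unfolding index_rank_def by (rule someI[of inj])
  qed
  fix x y z :: "'a wellordered_index"
  show "x < y \<longleftrightarrow> x \<le> y \<and> \<not> y \<le> x" "x \<le> x"
    by (auto simp: less_eq_wellordered_index_def less_wellordered_index_def)
  show "x \<le> z" if "x \<le> y" "y \<le> z" using that by (simp add: less_eq_wellordered_index_def)
  show "x = y" if "x \<le> y" "y \<le> x" using that inj by (simp add: less_eq_wellordered_index_def inj_eq)
  show "x \<le> y \<or> y \<le> x" by (auto simp: less_eq_wellordered_index_def)
  fix P :: "'a wellordered_index \<Rightarrow> bool" and a :: "'a wellordered_index" assume step: "\<And>x. (\<And>y. y < x \<Longrightarrow> P y) \<Longrightarrow> P x"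
  show "P a"
    by (induction a rule: measure_induct_rule[of index_rank]) (rule step, simp add: less_wellordered_index_def)
qed

end

definition reindex :: "('m \<Rightarrow> 'n) \<Rightarrow> real ^ 'n \<Rightarrow> real ^ 'm" where
  "reindex p v = (\<chi> i. v $ p i)"

lemma linear_reindex: "linear (reindex p :: real ^ 'n \<Rightarrow> real ^ 'm)"
  by (rule linearI) (auto simp: reindex_def vec_eq_iff)

lemma reindex_reindex: "reindex p (reindex q v) = reindex (q \<circ> p) v"
  by (simp add: reindex_def vec_eq_iff)

lemma reindex_id: "reindex id v = v"
  by (simp add: reindex_def vec_eq_iff)

lemma inner_reindex:
  fixes v w :: "real ^ 'n" and p :: "'m::finite \<Rightarrow> 'n"
  assumes "bij p"
  shows "reindex p v \<bullet> reindex p w = v \<bullet> w"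
  unfolding inner_vec_def reindex_def using sum.reindex_bij_betw[OF assms, of "\<lambda>i. v $ i \<bullet> w $ i"] by simp

lemma prod_Basis_cart: "(\<Prod>b\<in>Basis. (v :: real ^ 'n) \<bullet> b) = (\<Prod>i\<in>UNIV. v $ i)"
proof -
  have B: "(Basis :: (real ^ 'n) set) = range (\<lambda>i. axis i 1)" by (auto simp: Basis_vec_def)
  have I: "inj (\<lambda>i. axis i (1::real) :: real ^ 'n)" by (auto intro!: injI simp: axis_eq_axis)
  show ?thesis unfolding B by (subst prod.reindex[OF I]) (simp add: inner_axis)
qed

lemma lebesgue_distr_reindex:
  fixes p :: "'m::finite \<Rightarrow> 'n::finite"
  assumes p: "bij p"
  shows "lebesgue = distr lebesgue lebesgue (reindex p)" "reindex p \<in> lebesgue \<rightarrow>\<^sub>M lebesgue"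
proof -
  let ?R = "reindex p :: real ^ 'n \<Rightarrow> real ^ 'm"
  have meas: "?R \<in> borel_measurable lborel"
    using linear_continuous_on[OF linear_conv_bounded_linear[THEN iffD1, OF linear_reindex[of p]], of UNIV]
    by (simp add: borel_measurable_continuous_onI)
  have lb: "lborel = distr lborel lborel ?R"
  proof -
    have "(lborel :: (real^'m) measure) = distr lborel borel ?R"
    proof (rule lborel_eqI)
      fix l u :: "real ^ 'm" assume lu: "\<And>b. b \<in> Basis \<Longrightarrow> l \<bullet> b \<le> u \<bullet> b"
      have lui: "l $ i \<le> u $ i" for i using lu[of "axis i 1"] by (simp add: inner_axis)
      let ?q = "inv p"
      have pq: "p (?q i) = i" "?q (p j) = j" for i j using p by (auto simp: bij_is_surj surj_f_inv_f bij_is_inj)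
      have "?R -` box l u = box (reindex ?q l) (reindex ?q u)"
      proof (intro set_eqI)
        fix x
        have "(\<forall>i. l $ i < x $ p i \<and> x $ p i < u $ i) \<longleftrightarrow> (\<forall>j. l $ ?q j < x $ j \<and> x $ j < u $ ?q j)"
        proof (intro iffI allI)
          fix j assume "\<forall>i. l $ i < x $ p i \<and> x $ p i < u $ i"
          from spec[OF this, of "?q j"] show "l $ ?q j < x $ j \<and> x $ j < u $ ?q j" by (simp add: pq)
        next
          fix i assume "\<forall>j. l $ ?q j < x $ j \<and> x $ j < u $ ?q j"
          from spec[OF this, of "p i"] show "l $ i < x $ p i \<and> x $ p i < u $ i" by (simp add: pq)
        qed
        then show "x \<in> ?R -` box l u \<longleftrightarrow> x \<in> box (reindex ?q l) (reindex ?q u)"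
          by (simp add: mem_box_cart reindex_def)
      qed
      then have "emeasure (distr lborel borel ?R) (box l u) = emeasure lborel (box (reindex ?q l) (reindex ?q u))"
        using meas by (subst emeasure_distr) auto
      also have "\<dots> = ennreal (\<Prod>b\<in>Basis. (reindex ?q u - reindex ?q l) \<bullet> b)"
        using lui by (subst emeasure_lborel_box) (auto simp: Basis_vec_def inner_axis reindex_def)
      also have "(\<Prod>b\<in>Basis. (reindex ?q u - reindex ?q l) \<bullet> b) = (\<Prod>i\<in>UNIV. u $ (?q i) - l $ (?q i))"
        by (subst prod_Basis_cart) (auto simp: reindex_def)
      also have "\<dots> = (\<Prod>i\<in>UNIV. u $ i - l $ i)"
        using prod.reindex_bij_betw[OF bij_imp_bij_inv[OF p], of "\<lambda>i. u $ i - l $ i"] by simp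
      also have "\<dots> = (\<Prod>b\<in>Basis. (u - l) \<bullet> b)"
        by (subst prod_Basis_cart) auto
      finally show "emeasure (distr lborel borel ?R) (box l u) = ennreal (\<Prod>b\<in>Basis. (u - l) \<bullet> b)" .
    qed simp
    also have "\<dots> = distr lborel lborel ?R" by (rule distr_cong) auto
    finally show ?thesis .
  qed
  have mlb: "?R \<in> lebesgue \<rightarrow>\<^sub>M lborel" using meas by (simp add: measurable_completion)
  have lb': "distr lebesgue lborel ?R = lborel"
    using meas lb by (simp add: distr_completion)
  show "reindex p \<in> lebesgue \<rightarrow>\<^sub>M lebesgue"
    by (rule completion.measurable_completion2[OF mlb]) (simp only: lb' order_refl)
  have "completion (distr lebesgue lborel ?R) = distr lebesgue lebesgue ?R"
    by (rule completion.completion_distr_eq[OF mlb]) (simp only: lb')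
  then show "lebesgue = distr lebesgue lebesgue (reindex p)" by (simp only: lb')
qed

lemma reindex_image:
  fixes p :: "'m::finite \<Rightarrow> 'n::finite"
  assumes p: "bij p"
  shows "S \<in> sets lebesgue \<Longrightarrow> reindex p ` S \<in> sets lebesgue"
    "S \<in> sets lebesgue \<Longrightarrow> emeasure lebesgue (reindex p ` S) = emeasure lebesgue S"
proof -
  assume S: "S \<in> sets lebesgue"
  have pq: "p (inv p i) = i" "inv p (p j) = j" for i j using p by (auto simp: bij_is_surj surj_f_inv_f bij_is_inj)
  have "p \<circ> inv p = id" "inv p \<circ> p = id" using pq by auto
  then have rr: "reindex (inv p) (reindex p v) = v" "reindex p (reindex (inv p) w) = w" for v :: "real ^ 'n" and w :: "real ^ 'm"
    by (simp_all add: reindex_reindex reindex_id)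
  have img: "reindex p ` S = reindex (inv p) -` S"
  proof (intro equalityI subsetI)
    fix x assume "x \<in> reindex p ` S" then show "x \<in> reindex (inv p) -` S" using rr(1) by auto
  next
    fix x assume "x \<in> reindex (inv p) -` S"
    then have "reindex p (reindex (inv p) x) \<in> reindex p ` S" by blast
    then show "x \<in> reindex p ` S" by (simp only: rr(2))
  qed
  have "reindex (inv p) -` S \<inter> space lebesgue \<in> sets lebesgue"
    using lebesgue_distr_reindex(2)[OF bij_imp_bij_inv[OF p]] S by (rule measurable_sets)
  then show m: "reindex p ` S \<in> sets lebesgue" by (simp add: img)
  have "emeasure lebesgue (reindex p ` S) = emeasure (distr lebesgue lebesgue (reindex p)) (reindex p ` S)"
    using lebesgue_distr_reindex(1)[OF p] by simp
  also have "\<dots> = emeasure lebesgue (reindex p -` (reindex p ` S) \<inter> space lebesgue)"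
    by (rule emeasure_distr[OF lebesgue_distr_reindex(2)[OF p] m])
  also have "reindex p -` (reindex p ` S) \<inter> space lebesgue = S"
    unfolding img using rr(1) by auto
  finally show "emeasure lebesgue (reindex p ` S) = emeasure lebesgue S" .
qed

lemma det_eq_prod_eigenvalues:
  fixes L :: "real ^ 'n \<Rightarrow> real ^ 'n" and b :: "'n \<Rightarrow> real ^ 'n"
  assumes lin: "linear L" and on: "\<And>i j. b i \<bullet> b j = (if i = j then 1 else 0)"
    and eig: "\<And>i. L (b i) = c i *\<^sub>R b i"
  shows "det (matrix L) = (\<Prod>i\<in>UNIV. c i)"
proof -
  define P where "P = (\<chi> i j. b j $ i)"
  define D where "D = (\<chi> i j. if i = j then c i else 0)"
  have "transpose P ** P = mat 1"
  proof -
    have "(transpose P ** P) $ i $ j = b i \<bullet> b j" for i j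
      by (simp add: matrix_matrix_mult_def transpose_def P_def inner_vec_def)
    then show ?thesis by (simp add: vec_eq_iff on mat_def)
  qed
  then have "det P * det P = 1" by (metis det_I det_mul det_transpose)
  then have P0: "det P \<noteq> 0" by auto
  have "matrix L ** P = P ** D"
  proof -
    have "(matrix L ** P) $ i $ j = (matrix L *v b j) $ i" for i j
      by (simp add: matrix_matrix_mult_def matrix_vector_mult_def P_def)
    moreover have "(P ** D) $ i $ j = (c j *\<^sub>R b j) $ i" for i j
      by (simp add: matrix_matrix_mult_def P_def D_def if_distrib[of "\<lambda>x. _ * x"] cong: if_cong)
    ultimately show ?thesis by (simp add: vec_eq_iff matrix_works[OF linear_matrix_vector_mul_eq[THEN iffD2, OF lin]] eig)
  qed
  then have "det (matrix L) * det P = det P * det D" by (metis det_mul)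
  then have "det (matrix L) = det D" using P0 by simp
  also have "\<dots> = (\<Prod>i\<in>UNIV. c i)" unfolding D_def by (subst det_diagonal) auto
  finally show ?thesis .
qed

lemma measure_image_le_det:
  fixes f g :: "real ^ 'n::{finite,wellorder} \<Rightarrow> real ^ 'n::_"
  assumes S: "S \<in> sets lebesgue"
    and f: "\<And>x. x \<in> S \<Longrightarrow> (f has_derivative f' x) (at x within S)"
    and g: "\<And>x. x \<in> S \<Longrightarrow> (g has_derivative g' x) (at x within S)"
    and inj: "inj_on g S" and gS: "g ` S \<in> lmeasurable"
    and le: "\<And>x. x \<in> S \<Longrightarrow> \<bar>det (matrix (f' x))\<bar> \<le> K * \<bar>det (matrix (g' x))\<bar>"
  shows "f ` S \<in> lmeasurable" "measure lebesgue (f ` S) \<le> K * measure lebesgue (g ` S)"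
proof -
  have ig: "(\<lambda>x. \<bar>det (matrix (g' x))\<bar>) integrable_on S"
    using measurable_differentiable_image_eq[OF S g inj] gS by blast
  have iKg: "(\<lambda>x. K * \<bar>det (matrix (g' x))\<bar>) integrable_on S"
    using ig by (rule integrable_on_mult_right)
  have "(\<lambda>x. \<bar>det (matrix (f' x))\<bar>) \<in> borel_measurable (lebesgue_on S)"
    using borel_measurable_det_Jacobian[OF S f] by auto
  then have i_f: "(\<lambda>x. \<bar>det (matrix (f' x))\<bar>) integrable_on S"
    by (rule measurable_bounded_by_integrable_imp_integrable[OF _ iKg]) (use le S in auto)
  show "f ` S \<in> lmeasurable" by (rule measurable_differentiable_image[OF S f i_f])
  have "measure lebesgue (f ` S) \<le> integral S (\<lambda>x. \<bar>det (matrix (f' x))\<bar>)"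
    by (rule measure_differentiable_image[OF S f i_f])
  also have "\<dots> \<le> integral S (\<lambda>x. K * \<bar>det (matrix (g' x))\<bar>)"
    by (rule integral_le[OF i_f iKg le])
  also have "\<dots> = K * integral S (\<lambda>x. \<bar>det (matrix (g' x))\<bar>)" by simp
  also have "integral S (\<lambda>x. \<bar>det (matrix (g' x))\<bar>) = measure lebesgue (g ` S)"
    by (rule measure_differentiable_image_eq[OF S g inj ig, symmetric])
  finally show "measure lebesgue (f ` S) \<le> K * measure lebesgue (g ` S)" .
qed

text \<open>
  By the area formula for \<open>g\<close> and the area inequality for \<open>f\<close> it is enough to compare the Jacobian
  determinants.  They are given through a common orthonormal eigenbasis of the two derivatives, a
  description that does not change when the coordinates are renamed.
\<close>

theorem emeasure_image_le_eigenvalues: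
  fixes f g :: "real ^ 'n \<Rightarrow> real ^ 'n"
  assumes S: "S \<in> sets lebesgue"
    and f: "\<And>x. x \<in> S \<Longrightarrow> (f has_derivative f' x) (at x within S)"
    and g: "\<And>x. x \<in> S \<Longrightarrow> (g has_derivative g' x) (at x within S)"
    and inj: "inj_on g S" and gS: "g ` S \<in> lmeasurable"
    and K: "K \<ge> 0"
    and le: "\<And>x. x \<in> S \<Longrightarrow> \<exists>b c d. (\<forall>i j. b i \<bullet> b j = (if i = j then 1 else 0)) \<and>
       (\<forall>i :: 'n. f' x (b i) = c i *\<^sub>R b i \<and> g' x (b i) = d i *\<^sub>R b i) \<and>
       \<bar>\<Prod>i\<in>UNIV. c i\<bar> \<le> K * \<bar>\<Prod>i\<in>UNIV. d i\<bar>"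
  shows "emeasure lebesgue (f ` S) \<le> ennreal K * emeasure lebesgue (g ` S)"
proof -
  let ?p = "Rep_wellordered_index :: 'n wellordered_index \<Rightarrow> 'n"
  let ?q = "Abs_wellordered_index :: 'n \<Rightarrow> 'n wellordered_index"
  let ?R = "reindex ?p" and ?Q = "reindex ?q"
  have pq: "?p \<circ> ?q = id" "?q \<circ> ?p = id"
    by (auto simp: fun_eq_iff Rep_wellordered_index_inverse Abs_wellordered_index_inverse)
  have bp: "bij ?p" and bq: "bij ?q" using pq o_bij by blast+
  have RQ: "?R (?Q v) = v" "?Q (?R w) = w" for v w
    by (simp_all add: reindex_reindex pq reindex_id)
  have blR: "bounded_linear ?R" and blQ: "bounded_linear ?Q"
    using linear_reindex linear_conv_bounded_linear by blast+
  define F where "F = ?R \<circ> f \<circ> ?Q"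
  define G where "G = ?R \<circ> g \<circ> ?Q"
  let ?T = "?R ` S"
  have QT: "?Q ` ?T = S" by (simp add: image_image RQ)
  have T: "?T \<in> sets lebesgue" by (rule reindex_image(1)[OF bp S])
  have der: "(?R \<circ> k \<circ> ?Q has_derivative ?R \<circ> k' (?Q y) \<circ> ?Q) (at y within ?T)"
    if k: "\<And>x. x \<in> S \<Longrightarrow> (k has_derivative k' x) (at x within S)" and y: "y \<in> ?T" for k k' y
  proof -
    have "?Q y \<in> S" using y RQ by auto
    then have "(k has_derivative k' (?Q y)) (at (?Q y) within ?Q ` ?T)" using k QT by simp
    then have "(k \<circ> ?Q has_derivative k' (?Q y) \<circ> ?Q) (at y within ?T)"
      by (rule diff_chain_within[OF bounded_linear_imp_has_derivative[OF blQ]])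
    then have "(?R \<circ> (k \<circ> ?Q) has_derivative ?R \<circ> (k' (?Q y) \<circ> ?Q)) (at y within ?T)"
      by (rule diff_chain_within) (rule bounded_linear_imp_has_derivative[OF blR])
    then show ?thesis by (simp add: comp_assoc)
  qed
  have linR: "linear ?R" and linQ: "linear ?Q" by (rule linear_reindex)+
  have FT: "F ` ?T = ?R ` (f ` S)" and GT: "G ` ?T = ?R ` (g ` S)"
    by (simp_all add: F_def G_def image_image RQ)
  have GTm: "G ` ?T \<in> lmeasurable"
    using reindex_image[OF bp, of "g ` S"] gS unfolding GT by (auto simp: fmeasurable_def)
  have injG: "inj_on G ?T"
  proof (rule inj_onI)
    fix x y assume xy: "x \<in> ?T" "y \<in> ?T" "G x = G y"
    then have "?Q (G x) = ?Q (G y)" "?Q x \<in> S" "?Q y \<in> S" using QT by auto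
    then have "?Q x = ?Q y" using inj by (auto simp: G_def RQ inj_on_def)
    then have "?R (?Q x) = ?R (?Q y)" by simp
    then show "x = y" by (simp only: RQ)
  qed
  have det_le: "\<bar>det (matrix (?R \<circ> f' (?Q y) \<circ> ?Q))\<bar> \<le> K * \<bar>det (matrix (?R \<circ> g' (?Q y) \<circ> ?Q))\<bar>"
    if y: "y \<in> ?T" for y
  proof -
    have Qy: "?Q y \<in> S" using y RQ by auto
    obtain b c d where b: "\<And>i j. b i \<bullet> b j = (if i = j then 1 else 0)"
      "\<And>i :: 'n. f' (?Q y) (b i) = c i *\<^sub>R b i" "\<And>i. g' (?Q y) (b i) = d i *\<^sub>R b i"
      "\<bar>\<Prod>i\<in>UNIV. c i\<bar> \<le> K * \<bar>\<Prod>i\<in>UNIV. d i\<bar>"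
      using le[OF Qy] by blast
    define b' where "b' i = ?R (b (?p i))" for i
    have inj_p: "?p i = ?p j \<longleftrightarrow> i = j" for i j by (simp add: Rep_wellordered_index_inject)
    have on: "b' i \<bullet> b' j = (if i = j then 1 else 0)" for i j
      by (simp add: b'_def inner_reindex[OF bp] b inj_p)
    have lf: "linear (?R \<circ> f' (?Q y) \<circ> ?Q)" "linear (?R \<circ> g' (?Q y) \<circ> ?Q)"
      using has_derivative_linear[OF f[OF Qy]] has_derivative_linear[OF g[OF Qy]] linR linQ
      by (auto intro!: linear_compose)
    have e: "(?R \<circ> f' (?Q y) \<circ> ?Q) (b' i) = c (?p i) *\<^sub>R b' i" "(?R \<circ> g' (?Q y) \<circ> ?Q) (b' i) = d (?p i) *\<^sub>R b' i" for i
      by (simp_all add: b'_def RQ b linear_scale[OF linR])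
    have "(\<Prod>i\<in>UNIV. k (?p i)) = (\<Prod>i\<in>UNIV. k i)" for k :: "'n \<Rightarrow> real"
      by (rule prod.reindex_bij_betw[OF bp])
    then have 1: "det (matrix (?R \<circ> f' (?Q y) \<circ> ?Q)) = prod c UNIV" "det (matrix (?R \<circ> g' (?Q y) \<circ> ?Q)) = prod d UNIV"
      using det_eq_prod_eigenvalues[OF lf(1) on e(1)] det_eq_prod_eigenvalues[OF lf(2) on e(2)] by metis+
    show ?thesis unfolding 1 by (rule b(4))
  qed
  note main = measure_image_le_det[OF T der[OF f, folded F_def] der[OF g, folded G_def] injG GTm det_le]
  have mF: "F ` ?T \<in> lmeasurable" and le': "measure lebesgue (F ` ?T) \<le> K * measure lebesgue (G ` ?T)"
    using main by auto
  have "emeasure lebesgue (F ` ?T) \<le> ennreal K * emeasure lebesgue (G ` ?T)"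
    using le' K mF GTm by (simp add: emeasure_eq_measure2 ennreal_leI flip: ennreal_mult)
  moreover have "emeasure lebesgue (G ` ?T) = emeasure lebesgue (g ` S)"
    unfolding GT using gS by (intro reindex_image(2)[OF bp]) auto
  moreover have "emeasure lebesgue (F ` ?T) = emeasure lebesgue (f ` S)"
  proof -
    have "f ` S = ?Q ` (F ` ?T)" by (simp only: FT) (simp add: image_image RQ)
    then show ?thesis using reindex_image(2)[OF bq, of "F ` ?T"] mF by auto
  qed
  ultimately show ?thesis by simp
qed

section \<open>Hausdorff measure and Lebesgue measure\<close>

text \<open>
  The volume of a ball with the diameter of \<open>E\<close>: the contribution of \<open>E\<close> to the Hausdorff premeasure.
\<close>

definition hvol :: "'a::euclidean_space set \<Rightarrow> real" where
  "hvol E = unit_ball_vol (real DIM('a)) * (diameter E / 2) ^ DIM('a)"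

lemma hvol_nonneg: "hvol (E :: 'a::euclidean_space set) \<ge> 0" if "bounded E"
  unfolding hvol_def using diameter_ge_0[OF that] by simp

lemma hvol_empty: "hvol ({} :: 'a::euclidean_space set) = 0"
  by (simp add: hvol_def)

text \<open>
  Coverings are countable sets of sets here, not sequences, because unions of coverings are then coverings.
\<close>

definition hcover :: "real \<Rightarrow> 'a::euclidean_space set \<Rightarrow> ennreal \<Rightarrow> bool" where
  "hcover \<delta> A m \<longleftrightarrow> (\<exists>\<E>. countable \<E> \<and> A \<subseteq> \<Union>\<E> \<and> (\<forall>E\<in>\<E>. bounded E \<and> diameter E \<le> \<delta>) \<and>
     (\<integral>\<^sup>+E. ennreal (hvol E) \<partial>count_space \<E>) \<le> m)"

lemma hausdorff_premeasure_le_if_hcover: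
  assumes "hcover \<delta> A m" and \<delta>: "\<delta> \<ge> 0"
  shows "hausdorff_premeasure DIM('a) \<delta> (A :: 'a::euclidean_space set) \<le> m"
proof -
  obtain \<E> where E: "countable \<E>" "A \<subseteq> \<Union>\<E>" "\<And>E. E \<in> \<E> \<Longrightarrow> bounded E \<and> diameter E \<le> \<delta>"
    "(\<integral>\<^sup>+E. ennreal (hvol E) \<partial>count_space \<E>) \<le> m" using assms(1) unfolding hcover_def by blast
  let ?I = "to_nat_on \<E> ` \<E>"
  define F where "F n = (if n \<in> ?I then from_nat_into \<E> n else {})" for n
  have F: "F (to_nat_on \<E> E) = E" if "E \<in> \<E>" for E using that E(1) by (simp add: F_def)
  have Fin: "F n \<in> \<E> \<or> F n = {}" for n using E(1) by (auto simp: F_def)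
  have "(\<Sum>n. ennreal (hvol (F n))) = (\<integral>\<^sup>+n. ennreal (hvol (F n)) \<partial>count_space UNIV)"
    by (simp add: nn_integral_count_space_nat)
  also have "\<dots> = (\<integral>\<^sup>+n. ennreal (hvol (F n)) * indicator ?I n \<partial>count_space UNIV)"
    by (intro nn_integral_cong) (auto simp: F_def hvol_empty indicator_def)
  also have "\<dots> = (\<integral>\<^sup>+n. ennreal (hvol (F n)) \<partial>count_space ?I)"
    by (simp add: nn_integral_count_space_indicator)
  also have "\<dots> = (\<integral>\<^sup>+E. ennreal (hvol (F (to_nat_on \<E> E))) \<partial>count_space \<E>)"
    using E(1) by (intro nn_integral_bij_count_space[symmetric] bij_betw_imageI) (auto simp: inj_on_to_nat_on)
  also have "\<dots> = (\<integral>\<^sup>+E. ennreal (hvol E) \<partial>count_space \<E>)"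
    by (intro nn_integral_cong) (simp add: F)
  finally have sum: "(\<Sum>n. ennreal (hvol (F n))) \<le> m" using E(4) by simp
  have "A \<subseteq> (\<Union>n. F n)"
  proof
    fix x assume "x \<in> A"
    then obtain X where "X \<in> \<E>" "x \<in> X" using E(2) by blast
    then show "x \<in> (\<Union>n. F n)" using F by (metis UN_iff UNIV_I)
  qed
  moreover have "bounded (F n) \<and> diameter (F n) \<le> \<delta>" for n
    using Fin[of n] E(3) \<delta> by auto
  ultimately have "hausdorff_premeasure DIM('a) \<delta> A \<le> (\<Sum>n. ennreal (hvol (F n)))"
    unfolding hausdorff_premeasure_def hvol_def by (intro INF_lower) auto
  then show ?thesis using sum by simp
qed

lemma hcover_mono:
  assumes "hcover \<delta> A m" "B \<subseteq> A" "m \<le> m'"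
  shows "hcover \<delta> B m'"
proof -
  obtain \<E> where E: "countable \<E>" "A \<subseteq> \<Union>\<E>" "\<forall>E\<in>\<E>. bounded E \<and> diameter E \<le> \<delta>"
    "(\<integral>\<^sup>+E. ennreal (hvol E) \<partial>count_space \<E>) \<le> m" using assms(1) unfolding hcover_def by blast
  have "B \<subseteq> \<Union>\<E>" using assms(2) E(2) by blast
  moreover have "(\<integral>\<^sup>+E. ennreal (hvol E) \<partial>count_space \<E>) \<le> m'" using E(4) assms(3) by (rule order_trans)
  ultimately show ?thesis unfolding hcover_def using E(1,3) by (intro exI[of _ \<E>]) simp
qed

lemma hcover_Union:
  assumes "\<And>n::nat. hcover \<delta> (A n) (m n)"
  shows "hcover \<delta> (\<Union>n. A n) (\<Sum>n. m n)"
proof -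
  have "\<forall>n. \<exists>\<E>. countable \<E> \<and> A n \<subseteq> \<Union>\<E> \<and> (\<forall>E\<in>\<E>. bounded E \<and> diameter E \<le> \<delta>) \<and>
     (\<integral>\<^sup>+E. ennreal (hvol E) \<partial>count_space \<E>) \<le> m n" using assms unfolding hcover_def by blast
  from choice[OF this] obtain \<E> where EE: "\<forall>n. countable (\<E> n) \<and> A n \<subseteq> \<Union>(\<E> n) \<and> (\<forall>E\<in>\<E> n. bounded E \<and> diameter E \<le> \<delta>) \<and>
     (\<integral>\<^sup>+E. ennreal (hvol E) \<partial>count_space (\<E> n)) \<le> m n" ..
  have E: "countable (\<E> n)" "A n \<subseteq> \<Union>(\<E> n)" "\<forall>E\<in>\<E> n. bounded E \<and> diameter E \<le> \<delta>"
    "(\<integral>\<^sup>+E. ennreal (hvol E) \<partial>count_space (\<E> n)) \<le> m n" for n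
    using spec[OF EE, of n] by - (elim conjE, assumption)+
  have "(\<integral>\<^sup>+E. ennreal (hvol E) \<partial>count_space (\<Union>n. \<E> n))
     = (\<integral>\<^sup>+E. ennreal (hvol E) * indicator (\<Union>n. \<E> n) E \<partial>count_space UNIV)"
    by (simp add: nn_integral_count_space_indicator)
  also have "\<dots> \<le> (\<integral>\<^sup>+E. (\<Sum>n. ennreal (hvol E) * indicator (\<E> n) E) \<partial>count_space UNIV)"
  proof (rule nn_integral_mono)
    fix E :: "'a set"
    show "ennreal (hvol E) * indicator (\<Union>n. \<E> n) E \<le> (\<Sum>n. ennreal (hvol E) * indicator (\<E> n) E)"
    proof (cases "E \<in> (\<Union>n. \<E> n)")
      case True
      then obtain k where k: "E \<in> \<E> k" by blast
      have "(\<Sum>n\<in>{k}. ennreal (hvol E) * indicator (\<E> n) E) \<le> (\<Sum>n. ennreal (hvol E) * indicator (\<E> n) E)"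
        by (rule sum_le_suminf) auto
      then show ?thesis using True k by simp
    qed simp
  qed
  also have "\<dots> = (\<Sum>n. \<integral>\<^sup>+E. ennreal (hvol E) * indicator (\<E> n) E \<partial>count_space UNIV)"
    by (rule nn_integral_suminf) auto
  also have "\<dots> = (\<Sum>n. \<integral>\<^sup>+E. ennreal (hvol E) \<partial>count_space (\<E> n))"
    by (simp add: nn_integral_count_space_indicator)
  also have "\<dots> \<le> (\<Sum>n. m n)" by (intro suminf_le E(4)) auto
  finally show ?thesis unfolding hcover_def
  proof (intro exI[of _ "\<Union>n. \<E> n"] conjI)
    show "countable (\<Union>n. \<E> n)" using E(1) by simp
    show "(\<Union>n. A n) \<subseteq> \<Union>(\<Union>n. \<E> n)" using E(2) by blast
    show "\<forall>E\<in>\<Union>n. \<E> n. bounded E \<and> diameter E \<le> \<delta>" using E(3) by blast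
  qed
qed

lemma hcover_empty: "hcover \<delta> {} 0"
  unfolding hcover_def by (intro exI[of _ "{}"]) (auto simp: nn_integral_count_space_indicator)

lemma hcover_Un:
  assumes "hcover \<delta> A m" "hcover \<delta> B k"
  shows "hcover \<delta> (A \<union> B) (m + k)"
proof -
  let ?A = "\<lambda>n::nat. if n = 0 then A else if n = 1 then B else {}"
  let ?m = "\<lambda>n::nat. if n = 0 then m else if n = 1 then k else 0"
  have "hcover \<delta> (\<Union>n. ?A n) (\<Sum>n. ?m n)"
    by (rule hcover_Union) (use assms hcover_empty in auto)
  moreover have "(\<Union>n. ?A n) = A \<union> B" by (auto split: if_splits)
  moreover have "(\<Sum>n. ?m n) = m + k"
    by (subst suminf_finite[of "{0,1}"]) auto
  ultimately show ?thesis by simp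
qed

lemma hcover_family:
  assumes I: "countable I" and A: "A \<subseteq> (\<Union>i\<in>I. E i)" and E: "\<And>i. i \<in> I \<Longrightarrow> bounded (E i) \<and> diameter (E i) \<le> \<delta>"
  shows "hcover \<delta> A (\<integral>\<^sup>+i. ennreal (hvol (E i)) \<partial>count_space I)"
proof -
  obtain J where J: "J \<subseteq> I" "inj_on E J" "E ` I = E ` J" using subset_image_inj[of "E ` I" E I] by auto
  have "(\<integral>\<^sup>+X. ennreal (hvol X) \<partial>count_space (E ` I)) = (\<integral>\<^sup>+i. ennreal (hvol (E i)) \<partial>count_space J)"
    unfolding J(3) using J(2) by (intro nn_integral_bij_count_space[symmetric] bij_betw_imageI) auto
  also have "\<dots> \<le> (\<integral>\<^sup>+i. ennreal (hvol (E i)) \<partial>count_space I)"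
    using J(1) by (auto simp: nn_integral_count_space_indicator indicator_def intro!: nn_integral_mono)
  finally show ?thesis unfolding hcover_def using I A E by (intro exI[of _ "E ` I"]) auto
qed

text \<open>
  Vitali's covering lemma yields disjoint balls in a small open neighbourhood of \<open>N\<close> whose fivefold
  enlargements cover \<open>N\<close>; enlarging costs a factor \<open>5 ^ DIM('a)\<close>.
\<close>

lemma hcover_negligible:
  fixes N :: "'a::euclidean_space set"
  assumes N: "negligible N" and \<delta>: "\<delta> > 0" and \<eta>: "\<eta> > 0"
  shows "hcover \<delta> N (ennreal \<eta>)"
proof -
  let ?d = "DIM('a)"
  define \<epsilon> where "\<epsilon> = \<eta> / 5 ^ ?d"
  have eps: "\<epsilon> > 0" using \<eta> by (simp add: \<epsilon>_def)
  obtain U where U: "open U" "N \<subseteq> U" "U - N \<in> lmeasurable" "emeasure lebesgue (U - N) < ennreal \<epsilon>"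
    using sets_lebesgue_outer_open[of N \<epsilon>] N eps negligible_imp_sets by blast
  have "emeasure lebesgue ((U - N) \<union> N) = emeasure lebesgue (U - N)"
    using U N negligible_iff_null_sets by (intro emeasure_Un_null_set) auto
  moreover have "(U - N) \<union> N = U" using U(2) by blast
  ultimately have Ueps: "emeasure lebesgue U < ennreal \<epsilon>" using U(4) by simp
  define K where "K = {i :: 'a \<times> real. 0 < snd i \<and> snd i \<le> \<delta> / 10 \<and> cball (fst i) (snd i) \<subseteq> U}"
  have cov: "N \<subseteq> (\<Union>i\<in>K. cball (fst i) (snd i))"
  proof
    fix x assume "x \<in> N"
    then obtain e where e: "e > 0" "cball x e \<subseteq> U" using U open_contains_cball by blast
    have "(x, min e (\<delta> / 10)) \<in> K" using e \<delta> by (auto simp: K_def)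
    moreover have "x \<in> cball x (min e (\<delta> / 10))" using e \<delta> by simp
    ultimately show "x \<in> (\<Union>i\<in>K. cball (fst i) (snd i))" by (intro UN_I) auto
  qed
  obtain C where C: "countable C" "C \<subseteq> K"
     "pairwise (\<lambda>i j. disjnt (cball (fst i) (snd i)) (cball (fst j) (snd j))) C"
     "N \<subseteq> (\<Union>i\<in>C. cball (fst i) (5 * snd i))"
    by (rule Vitali_covering_lemma_cballs[OF cov, of "\<delta> / 10"]) (auto simp: K_def)
  have disj: "disjoint_family_on (\<lambda>i. cball (fst i) (snd i)) C"
    using C(3) unfolding disjoint_family_on_def pairwise_def disjnt_def by blast
  have KC: "0 < snd i" "snd i \<le> \<delta> / 10" "cball (fst i) (snd i) \<subseteq> U" if "i \<in> C" for i
    using C(2) that by (auto simp: K_def)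
  have "hcover \<delta> N (\<integral>\<^sup>+i. ennreal (hvol (cball (fst i) (5 * snd i))) \<partial>count_space C)"
    using C(1,4)
  proof (rule hcover_family)
    fix i assume "i \<in> C"
    from KC(1,2)[OF this] show "bounded (cball (fst i) (5 * snd i)) \<and> diameter (cball (fst i) (5 * snd i)) \<le> \<delta>"
      by (simp only: diameter_cball) simp
  qed
  moreover have "(\<integral>\<^sup>+i. ennreal (hvol (cball (fst i) (5 * snd i))) \<partial>count_space C) \<le> ennreal \<eta>"
  proof -
    have "(\<integral>\<^sup>+i. ennreal (hvol (cball (fst i) (5 * snd i))) \<partial>count_space C)
       = (\<integral>\<^sup>+i. ennreal (5 ^ ?d) * emeasure lebesgue (cball (fst i) (snd i)) \<partial>count_space C)"
    proof (rule nn_integral_cong)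
      fix i assume "i \<in> space (count_space C)"
      then have i: "i \<in> C" by simp
      have "hvol (cball (fst i) (5 * snd i)) = 5 ^ ?d * (unit_ball_vol ?d * snd i ^ ?d)"
        using KC(1)[OF i] by (simp add: hvol_def power_mult_distrib)
      then show "ennreal (hvol (cball (fst i) (5 * snd i))) = ennreal (5 ^ ?d) * emeasure lebesgue (cball (fst i) (snd i))"
        using KC(1)[OF i] by (simp add: emeasure_cball ennreal_mult)
    qed
    also have "\<dots> = ennreal (5 ^ ?d) * (\<integral>\<^sup>+i. emeasure lebesgue (cball (fst i) (snd i)) \<partial>count_space C)"
      by (intro nn_integral_cmult) auto
    also have "(\<integral>\<^sup>+i. emeasure lebesgue (cball (fst i) (snd i)) \<partial>count_space C) = emeasure lebesgue (\<Union>i\<in>C. cball (fst i) (snd i))"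
      using C(1) disj by (intro emeasure_UN_countable[symmetric]) auto
    also have "\<dots> \<le> emeasure lebesgue U" using KC(3) U(1) by (intro emeasure_mono) auto
    also have "\<dots> \<le> ennreal \<epsilon>" using Ueps by simp
    finally have "(\<integral>\<^sup>+i. ennreal (hvol (cball (fst i) (5 * snd i))) \<partial>count_space C) \<le> ennreal (5 ^ ?d) * ennreal \<epsilon>"
      by (simp add: mult_left_mono)
    also have "\<dots> = ennreal \<eta>" using eps by (simp add: \<epsilon>_def flip: ennreal_mult)
    finally show ?thesis .
  qed
  ultimately show ?thesis by (rule hcover_mono[OF _ order_refl])
qed

text \<open>
  By Vitali's theorem almost all of \<open>U\<close> is a disjoint union of small balls.  In each ball lies a scaled
  copy of \<open>E\<close>, which fills the fraction \<open>\<theta>\<close> of the ball and contributes to a covering at most \<open>c\<close> times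
  its Lebesgue measure.  The remainder \<open>U'\<close>, the balls minus the copies, is open again.
\<close>

lemma hcover_packing_step:
  fixes E U :: "'a::euclidean_space set"
  assumes E: "compact E" "measure lebesgue E > 0" "hvol E \<le> c * measure lebesgue E"
    and R: "R > 0" "E \<subseteq> ball 0 R" and \<theta>: "\<theta> = measure lebesgue E / measure lebesgue (ball (0::'a) R)"
    and c: "c \<ge> 0" and U: "open U" "emeasure lebesgue U < \<infinity>" and \<delta>: "\<delta> > 0" and \<eta>: "\<eta> > 0"
  shows "\<exists>U'. open U' \<and> U' \<subseteq> U \<and> measure lebesgue U' \<le> (1 - \<theta>) * measure lebesgue U \<and>
    hcover \<delta> (U - U') (ennreal c * emeasure lebesgue (U - U') + ennreal \<eta>)"
proof -
  let ?d = "DIM('a)"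
  define cp where "cp i = (\<lambda>y. (snd i / R) *\<^sub>R y + fst i) ` E" for i :: "'a \<times> real"
  define K where "K = {i :: 'a \<times> real. ball (fst i) (snd i) \<subseteq> U \<and> 0 < snd i \<and> snd i \<le> \<delta> / 2}"
  obtain C where C: "countable C" "C \<subseteq> K"
    "pairwise (\<lambda>i j. disjnt (ball (fst i) (snd i)) (ball (fst j) (snd j))) C"
    "negligible (U - (\<Union>i\<in>C. ball (fst i) (snd i)))"
  proof (rule Vitali_covering_theorem_balls[of U K fst snd])
    fix x and d :: real assume x: "x \<in> U" and d: "0 < d"
    obtain e where e: "e > 0" "ball x e \<subseteq> U" using U x openE by blast
    define r where "r = min e (min (\<delta>/2) (d/2))"
    have "(x, r) \<in> K" "x \<in> ball x r" "r < d" using e \<delta> d by (auto simp: K_def r_def)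
    then show "\<exists>i. i \<in> K \<and> x \<in> ball (fst i) (snd i) \<and> snd i < d" by (intro exI[of _ "(x, r)"]) auto
  qed
  have KC: "ball (fst i) (snd i) \<subseteq> U" "0 < snd i" "snd i \<le> \<delta> / 2" if "i \<in> C" for i
    using C(2) that by (auto simp: K_def)
  have cpb: "cp i \<subseteq> ball (fst i) (snd i)" if "i \<in> C" for i
  proof
    fix z assume "z \<in> cp i"
    then obtain y where y: "y \<in> E" "z = (snd i / R) *\<^sub>R y + fst i" by (auto simp: cp_def)
    have "norm y < R" using y(1) R(2) by auto
    then have "(snd i / R) * norm y < (snd i / R) * R" using KC(2)[OF that] R(1) by (intro mult_strict_left_mono) auto
    then show "z \<in> ball (fst i) (snd i)" using KC(2)[OF that] R(1) unfolding y(2) by (simp add: dist_norm)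
  qed
  have cpc: "compact (cp i)" for i
    unfolding cp_def by (intro compact_continuous_image continuous_intros E(1))
  have Em: "E \<in> lmeasurable" using E(1) by (rule lmeasurable_compact)
  have cpm: "measure lebesgue (cp i) = (snd i / R) ^ ?d * measure lebesgue E" if "i \<in> C" for i
    unfolding cp_def using KC(2)[OF that] R(1) by (subst measure_lebesgue_affine) simp
  have Rb: "measure lebesgue (ball (0::'a) R) = unit_ball_vol ?d * R ^ ?d" using R(1) by (simp add: content_ball)
  have Rb0: "measure lebesgue (ball (0::'a) R) > 0" using R(1) by (simp add: content_ball_pos)
  have cpm2: "measure lebesgue (cp i) = \<theta> * measure lebesgue (ball (fst i) (snd i))" if "i \<in> C" for i
    unfolding cpm[OF that] \<theta> Rb using KC(2)[OF that] R(1) unit_ball_vol_pos[of "real ?d", THEN less_imp_neq]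
    by (simp add: content_ball power_divide field_simps)
  have th0: "\<theta> \<ge> 0" unfolding \<theta> by simp
  have cpe: "emeasure lebesgue (cp i) = ennreal \<theta> * emeasure lebesgue (ball (fst i) (snd i))" if "i \<in> C" for i
  proof -
    have "\<theta> \<ge> 0" unfolding \<theta> by simp
    moreover have "emeasure lebesgue (cp i) = ennreal (measure lebesgue (cp i))"
      using lmeasurable_compact[OF cpc] by (simp add: emeasure_eq_measure2)
    moreover have "emeasure lebesgue (ball (fst i) (snd i)) = ennreal (measure lebesgue (ball (fst i) (snd i)))"
      using lmeasurable_ball by (subst emeasure_eq_measure2) auto
    ultimately show ?thesis by (simp add: cpm2[OF that] ennreal_mult)
  qed
  have Eb: "bounded E" using E(1) by (rule compact_imp_bounded)
  have diam: "diameter (cp i) \<le> (snd i / R) * diameter E" if "i \<in> C" for i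
  proof (rule diameter_le)
    show "cp i \<noteq> {} \<or> 0 \<le> (snd i / R) * diameter E"
      using KC(2)[OF that] R(1) diameter_ge_0[OF Eb] by simp
    fix x y assume "x \<in> cp i" "y \<in> cp i"
    then obtain u v where uv: "u \<in> E" "v \<in> E" "x = (snd i / R) *\<^sub>R u + fst i" "y = (snd i / R) *\<^sub>R v + fst i"
      by (auto simp: cp_def)
    have "x - y = (snd i / R) *\<^sub>R (u - v)" by (simp add: uv scaleR_diff_right)
    then have "norm (x - y) = (snd i / R) * dist u v" using KC(2)[OF that] R(1) by (simp add: dist_norm)
    also have "\<dots> \<le> (snd i / R) * diameter E"
      using diameter_bounded_bound[OF Eb uv(1,2)] KC(2)[OF that] R(1) by (intro mult_left_mono) auto
    finally show "norm (x - y) \<le> (snd i / R) * diameter E" .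
  qed
  have hv: "hvol (cp i) \<le> c * measure lebesgue (cp i)" if "i \<in> C" for i
  proof -
    have "hvol (cp i) \<le> unit_ball_vol (real ?d) * ((snd i / R) * diameter E / 2) ^ ?d"
      unfolding hvol_def using diam[OF that] diameter_ge_0[OF compact_imp_bounded[OF cpc]]
      by (intro mult_left_mono power_mono) auto
    also have "\<dots> = (snd i / R) ^ ?d * hvol E"
      unfolding hvol_def by (simp add: power_mult_distrib power_divide)
    also have "\<dots> \<le> (snd i / R) ^ ?d * (c * measure lebesgue E)"
      using KC(2)[OF that] R(1) E(3) by (intro mult_left_mono) auto
    finally show ?thesis by (simp add: cpm[OF that] mult_ac)
  qed
  define V where "V = (\<Union>i\<in>C. cp i)"
  define U' where "U' = (\<Union>i\<in>C. ball (fst i) (snd i) - cp i)"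
  let ?N = "U - (\<Union>i\<in>C. ball (fst i) (snd i))"
  have dj: "ball (fst i) (snd i) \<inter> ball (fst j) (snd j) = {}" if "i \<in> C" "j \<in> C" "i \<noteq> j" for i j
    using C(3) that unfolding pairwise_def disjnt_def by blast
  have disj: "disjoint_family_on cp C" "disjoint_family_on (\<lambda>i. ball (fst i) (snd i)) C"
    using dj cpb unfolding disjoint_family_on_def by blast+
  have openU': "open U'"
    unfolding U'_def using cpc by (intro open_UN ballI open_Diff open_ball) (auto simp: compact_imp_closed)
  have U'U: "U' \<subseteq> U" using KC(1) by (auto simp: U'_def)
  have VU: "V \<subseteq> U - U'"
  proof
    fix x assume "x \<in> V"
    then obtain i where i: "i \<in> C" "x \<in> cp i" by (auto simp: V_def)
    have "x \<in> U" using i cpb KC(1) by blast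
    moreover have "x \<notin> U'"
    proof
      assume "x \<in> U'"
      then obtain j where j: "j \<in> C" "x \<in> ball (fst j) (snd j)" "x \<notin> cp j" by (auto simp: U'_def)
      then have "i \<noteq> j" using i by auto
      then show False using dj[OF i(1) j(1)] cpb[OF i(1)] i(2) j(2) by blast
    qed
    ultimately show "x \<in> U - U'" by blast
  qed
  have UU': "U - U' \<subseteq> V \<union> ?N" by (auto simp: U'_def V_def)
  have Vs: "V \<in> sets lebesgue"
    unfolding V_def using C(1) lmeasurable_compact[OF cpc] by (intro sets.countable_UN') auto
  have Vball: "emeasure lebesgue V = ennreal \<theta> * emeasure lebesgue U"
  proof -
    have "emeasure lebesgue V = (\<integral>\<^sup>+i. emeasure lebesgue (cp i) \<partial>count_space C)"
      unfolding V_def using C(1) disj(1) lmeasurable_compact[OF cpc] by (intro emeasure_UN_countable) auto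
    also have "\<dots> = (\<integral>\<^sup>+i. ennreal \<theta> * emeasure lebesgue (ball (fst i) (snd i)) \<partial>count_space C)"
      by (intro nn_integral_cong) (simp add: cpe)
    also have "\<dots> = ennreal \<theta> * (\<integral>\<^sup>+i. emeasure lebesgue (ball (fst i) (snd i)) \<partial>count_space C)"
      by (intro nn_integral_cmult) auto
    also have "(\<integral>\<^sup>+i. emeasure lebesgue (ball (fst i) (snd i)) \<partial>count_space C) = emeasure lebesgue (\<Union>i\<in>C. ball (fst i) (snd i))"
      using C(1) disj(2) by (intro emeasure_UN_countable[symmetric]) auto
    also have "\<dots> = emeasure lebesgue ((\<Union>i\<in>C. ball (fst i) (snd i)) \<union> ?N)"
    proof (rule emeasure_Un_null_set[symmetric])
      show "?N \<in> null_sets lebesgue" using C(4) by (simp only: negligible_iff_null_sets)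
      have "open (\<Union>i\<in>C. ball (fst i) (snd i))" by auto
      then show "(\<Union>i\<in>C. ball (fst i) (snd i)) \<in> sets lebesgue" by (simp add: borel_open)
    qed
    also have "(\<Union>i\<in>C. ball (fst i) (snd i)) \<union> ?N = U"
      by (subst Un_Diff_cancel, rule Un_absorb1, rule UN_least[OF KC(1)])
    finally show ?thesis .
  qed
  have Um: "U \<in> lmeasurable" using U by (auto simp: fmeasurable_def)
  have Vm: "V \<in> lmeasurable" using fmeasurableI2[OF Um _ Vs] VU by blast
  have U'm: "U' \<in> lmeasurable" using fmeasurableI2[OF Um U'U] openU' by auto
  have mV: "measure lebesgue V = \<theta> * measure lebesgue U"
    using Vball th0 unfolding measure_def by (simp add: enn2real_mult)
  have "measure lebesgue U' \<le> measure lebesgue (U - V)"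
    using VU U'U Um Vm U'm by (intro measure_mono_fmeasurable) auto
  also have "\<dots> = measure lebesgue U - measure lebesgue V"
    using VU Um Vm by (intro measurable_measure_Diff) auto
  finally have mU': "measure lebesgue U' \<le> (1 - \<theta>) * measure lebesgue U" by (simp add: mV algebra_simps)
  have "hcover \<delta> V (\<integral>\<^sup>+i. ennreal (hvol (cp i)) \<partial>count_space C)"
  proof (rule hcover_family)
    show "countable C" by (rule C(1))
    show "V \<subseteq> (\<Union>i\<in>C. cp i)" by (simp add: V_def)
    fix i assume i: "i \<in> C"
    have "diameter (cp i) \<le> diameter (ball (fst i) (snd i))"
      using cpb[OF i] by (intro diameter_subset) auto
    also have "\<dots> \<le> \<delta>" using KC(2,3)[OF i] by simp
    finally show "bounded (cp i) \<and> diameter (cp i) \<le> \<delta>" using cpc compact_imp_bounded by blast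
  qed
  moreover have "(\<integral>\<^sup>+i. ennreal (hvol (cp i)) \<partial>count_space C) \<le> ennreal c * emeasure lebesgue (U - U')"
  proof -
    have "(\<integral>\<^sup>+i. ennreal (hvol (cp i)) \<partial>count_space C) \<le> (\<integral>\<^sup>+i. ennreal c * emeasure lebesgue (cp i) \<partial>count_space C)"
    proof (rule nn_integral_mono)
      fix i assume "i \<in> space (count_space C)"
      then have i: "i \<in> C" by simp
      have "ennreal (hvol (cp i)) \<le> ennreal (c * measure lebesgue (cp i))" using hv[OF i] by (rule ennreal_leI)
      also have "\<dots> = ennreal c * emeasure lebesgue (cp i)"
        using c lmeasurable_compact[OF cpc, of i] by (simp add: ennreal_mult emeasure_eq_measure2)
      finally show "ennreal (hvol (cp i)) \<le> ennreal c * emeasure lebesgue (cp i)" .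
    qed
    also have "\<dots> = ennreal c * (\<integral>\<^sup>+i. emeasure lebesgue (cp i) \<partial>count_space C)"
      by (intro nn_integral_cmult) auto
    also have "(\<integral>\<^sup>+i. emeasure lebesgue (cp i) \<partial>count_space C) = emeasure lebesgue V"
      unfolding V_def using C(1) disj(1) lmeasurable_compact[OF cpc] by (intro emeasure_UN_countable[symmetric]) auto
    also have "ennreal c * emeasure lebesgue V \<le> ennreal c * emeasure lebesgue (U - U')"
      using VU U(1) openU' by (intro mult_left_mono emeasure_mono) auto
    finally show ?thesis .
  qed
  ultimately have "hcover \<delta> V (ennreal c * emeasure lebesgue (U - U'))" by (rule hcover_mono[OF _ order_refl])
  then have "hcover \<delta> (V \<union> ?N) (ennreal c * emeasure lebesgue (U - U') + ennreal \<eta>)"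
    by (rule hcover_Un[OF _ hcover_negligible[OF C(4) \<delta> \<eta>]])
  then have "hcover \<delta> (U - U') (ennreal c * emeasure lebesgue (U - U') + ennreal \<eta>)"
    using UU' by (rule hcover_mono) simp
  then show ?thesis using openU' U'U mU' by blast
qed

text \<open>
  Iterating the packing step exhausts \<open>U\<close> up to a set of measure zero, because the remainder shrinks by
  the factor \<open>1 - \<theta>\<close> each time.
\<close>

lemma hcover_open:
  fixes E U :: "'a::euclidean_space set"
  assumes E: "compact E" "measure lebesgue E > 0" "hvol E \<le> c * measure lebesgue E"
    and c: "c \<ge> 0" and U: "open U" "emeasure lebesgue U < \<infinity>" and \<delta>: "\<delta> > 0" and \<eta>: "\<eta> > 0"
  shows "hcover \<delta> U (ennreal c * emeasure lebesgue U + ennreal (2 * \<eta>))"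
proof -
  obtain R where R: "R > 0" "E \<subseteq> ball 0 R"
    using compact_imp_bounded[OF E(1)] bounded_subset_ballD by blast
  define \<theta> where "\<theta> = measure lebesgue E / measure lebesgue (ball (0::'a) R)"
  have Em: "E \<in> lmeasurable" using E(1) by (rule lmeasurable_compact)
  have Rb0: "measure lebesgue (ball (0::'a) R) > 0" using R(1) by (simp add: content_ball_pos)
  have th: "0 < \<theta>" "\<theta> \<le> 1"
  proof -
    have "measure lebesgue E \<le> measure lebesgue (ball (0::'a) R)"
      using Em by (intro measure_mono_fmeasurable[OF R(2)]) auto
    then show "0 < \<theta>" "\<theta> \<le> 1" unfolding \<theta>_def using E(2) Rb0 by (auto simp: divide_le_eq)
  qed
  define step where "step k U U' \<longleftrightarrow> open U' \<and> U' \<subseteq> U \<and> measure lebesgue U' \<le> (1 - \<theta>) * measure lebesgue U \<and>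
    hcover \<delta> (U - U') (ennreal c * emeasure lebesgue (U - U') + ennreal (\<eta> * (1/2) ^ Suc k))" for k and U U' :: "'a set"
  have "\<exists>Us. \<forall>k::nat. (open (Us k) \<and> Us k \<subseteq> U \<and> (k = 0 \<longrightarrow> Us k = U)) \<and> step k (Us k) (Us (Suc k))"
  proof (rule dependent_nat_choice)
    show "\<exists>x. open x \<and> x \<subseteq> U \<and> (0 = (0::nat) \<longrightarrow> x = U)" using U by blast
    fix X and k :: nat assume X: "open X \<and> X \<subseteq> U \<and> (k = 0 \<longrightarrow> X = U)"
    then have "emeasure lebesgue X < \<infinity>"
      using U emeasure_mono[of X U lebesgue] by (auto intro: le_less_trans)
    then obtain X' where "step k X X'"
      using hcover_packing_step[OF E R \<theta>_def c _ _ \<delta>, of X "\<eta> * (1/2) ^ Suc k"] X \<eta> unfolding step_def by auto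
    then show "\<exists>y. (open y \<and> y \<subseteq> U \<and> (Suc k = 0 \<longrightarrow> y = U)) \<and> step k X y"
      using X unfolding step_def by blast
  qed
  then obtain Us where Us: "\<And>k. open (Us k)" "\<And>k. Us k \<subseteq> U" "Us 0 = U" "\<And>k. step k (Us k) (Us (Suc k))" by metis
  have Um: "U \<in> lmeasurable" using U by (auto simp: fmeasurable_def)
  have Usm: "Us k \<in> lmeasurable" for k using fmeasurableI2[OF Um Us(2)] Us(1) by auto
  have dec: "measure lebesgue (Us k) \<le> (1 - \<theta>) ^ k * measure lebesgue U" for k
  proof (induction k)
    case (Suc k)
    have "measure lebesgue (Us (Suc k)) \<le> (1 - \<theta>) * measure lebesgue (Us k)" using Us(4)[of k] unfolding step_def by blast
    also have "\<dots> \<le> (1 - \<theta>) * ((1 - \<theta>) ^ k * measure lebesgue U)" using Suc th by (intro mult_left_mono) auto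
    finally show ?case by simp
  qed (simp add: Us(3))
  let ?N = "\<Inter>k. Us k"
  have Nm: "?N \<in> lmeasurable" using Usm[of 0] Us(1) by (intro fmeasurableI2[OF Usm[of 0]] sets.countable_INT) auto
  have "negligible ?N"
  proof -
    have "(\<lambda>k. (1 - \<theta>) ^ k * measure lebesgue U) \<longlonglongrightarrow> 0 * measure lebesgue U"
      using th by (intro tendsto_mult tendsto_const LIMSEQ_power_zero) auto
    moreover have "measure lebesgue ?N \<le> (1 - \<theta>) ^ k * measure lebesgue U" for k
      using measure_mono_fmeasurable[of ?N "Us k" lebesgue] Nm Usm dec[of k] by (force intro: order_trans)
    ultimately have "measure lebesgue ?N \<le> 0"
      by (intro LIMSEQ_le_const[where X="\<lambda>k. (1 - \<theta>) ^ k * measure lebesgue U"]) auto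
    then have "measure lebesgue ?N = 0" using measure_nonneg[of lebesgue ?N] by linarith
    then show ?thesis using Nm by (simp add: negligible_iff_measure)
  qed
  then have covN: "hcover \<delta> ?N (ennreal \<eta>)" by (rule hcover_negligible[OF _ \<delta> \<eta>])
  have covD: "hcover \<delta> (\<Union>k. Us k - Us (Suc k)) (\<Sum>k. ennreal c * emeasure lebesgue (Us k - Us (Suc k)) + ennreal (\<eta> * (1/2) ^ Suc k))"
    using Us(4) by (intro hcover_Union) (simp add: step_def)
  have anti: "Us (Suc k) \<subseteq> Us k" for k using Us(4)[of k] by (simp add: step_def)
  then have decs: "decseq Us" by (simp add: decseq_Suc_iff)
  have disj: "disjoint_family (\<lambda>k. Us k - Us (Suc k))"
  proof -
    have "(Us m - Us (Suc m)) \<inter> (Us n - Us (Suc n)) = {}" if "m < n" for m n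
      using decseqD[OF decs, of "Suc m" n] that by auto
    then show ?thesis unfolding disjoint_family_on_def
      by (metis Int_commute linorder_neqE_nat)
  qed
  have sum1: "(\<Sum>k. emeasure lebesgue (Us k - Us (Suc k))) = emeasure lebesgue (\<Union>k. Us k - Us (Suc k))"
    using disj Us(1) by (intro suminf_emeasure) auto
  have "(\<Sum>k. ennreal c * emeasure lebesgue (Us k - Us (Suc k)) + ennreal (\<eta> * (1/2) ^ Suc k))
    = (\<Sum>k. ennreal c * emeasure lebesgue (Us k - Us (Suc k))) + (\<Sum>k. ennreal (\<eta> * (1/2) ^ Suc k))"
    by (intro suminf_add[symmetric]) auto
  also have "(\<Sum>k. ennreal (\<eta> * (1/2) ^ Suc k)) = ennreal \<eta>"
  proof -
    have "(\<lambda>k. \<eta> * (1/2) ^ Suc k) sums (\<eta> * 1)" by (intro sums_mult power_half_series)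
    then show ?thesis using \<eta> by (intro suminf_ennreal_eq) auto
  qed
  also have "(\<Sum>k. ennreal c * emeasure lebesgue (Us k - Us (Suc k))) = ennreal c * emeasure lebesgue (\<Union>k. Us k - Us (Suc k))"
    by (simp add: ennreal_suminf_cmult sum1)
  also have "\<dots> \<le> ennreal c * emeasure lebesgue U"
    using Us(1,2) U(1) by (intro mult_left_mono emeasure_mono) auto
  finally have le: "(\<Sum>k. ennreal c * emeasure lebesgue (Us k - Us (Suc k)) + ennreal (\<eta> * (1/2) ^ Suc k)) \<le> ennreal c * emeasure lebesgue U + ennreal \<eta>"
    by (simp add: add_right_mono)
  have "U \<subseteq> (\<Union>k. Us k - Us (Suc k)) \<union> ?N"
  proof
    fix x assume x: "x \<in> U"
    show "x \<in> (\<Union>k. Us k - Us (Suc k)) \<union> ?N"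
    proof (cases "\<exists>k. x \<in> Us k \<and> x \<notin> Us (Suc k)")
      case False
      then have "x \<in> Us k" for k by (induction k) (use x Us(3) in auto)
      then show ?thesis by blast
    qed blast
  qed
  moreover have "ennreal c * emeasure lebesgue U + ennreal \<eta> + ennreal \<eta> = ennreal c * emeasure lebesgue U + ennreal (2 * \<eta>)"
    using \<eta> by (simp add: add.assoc flip: ennreal_plus)
  ultimately show ?thesis
    using hcover_mono[OF hcover_Un[OF hcover_mono[OF covD order_refl le] covN], of U] by (metis order_refl)
qed

abbreviation diameter_ratios :: "'a::euclidean_space itself \<Rightarrow> real set" where
  "diameter_ratios _ \<equiv> {hvol E / measure lebesgue E | E :: 'a set. compact E \<and> measure lebesgue E > 0}"

text \<open>
  The largest \<open>\<kappa>\<close> such that \<open>\<kappa>\<close> times the Lebesgue measure of \<open>E\<close> is at most \<open>hvol E\<close> for all compact \<open>E\<close>.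
\<close>

definition isodiametric_constant :: "'a::euclidean_space itself \<Rightarrow> real" where
  "isodiametric_constant _ = Inf (diameter_ratios TYPE('a))"

lemma hvol_ratio_nonneg: "x \<in> diameter_ratios TYPE('a::euclidean_space) \<Longrightarrow> 0 \<le> x"
proof -
  assume "x \<in> (diameter_ratios TYPE('a))"
  then obtain E :: "'a set" where "x = hvol E / measure lebesgue E" "compact E" by blast
  moreover from this(2) have "hvol E \<ge> 0" by (intro hvol_nonneg compact_imp_bounded)
  ultimately show "0 \<le> x" by simp
qed

lemma isodiametric_constant_nonneg: "isodiametric_constant TYPE('a::euclidean_space) \<ge> 0"
proof -
  have "hvol (cball 0 1 :: 'a set) / measure lebesgue (cball 0 1 :: 'a set) \<in> (diameter_ratios TYPE('a))"
    by (intro CollectI exI[of _ "cball 0 1"]) (auto simp: content_cball_pos)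
  then show ?thesis unfolding isodiametric_constant_def
    by (intro cInf_greatest) (use hvol_ratio_nonneg in blast)+
qed

text \<open>
  The closure of a covering set is compact and has the same diameter, so it satisfies the inequality
  that defines the constant.
\<close>

lemma isodiametric_constant_le_premeasure:
  fixes S :: "'a::euclidean_space set"
  shows "ennreal (isodiametric_constant TYPE('a)) * emeasure lebesgue S \<le> hausdorff_premeasure DIM('a) \<delta> S"
  unfolding hausdorff_premeasure_def
proof (rule INF_greatest)
  fix E :: "nat \<Rightarrow> 'a set"
  assume "E \<in> {E. S \<subseteq> (\<Union>i. E i) \<and> (\<forall>i. bounded (E i) \<and> diameter (E i) \<le> \<delta>)}"
  then have E: "S \<subseteq> (\<Union>i. E i)" "\<And>i. bounded (E i)" by auto
  let ?c = "isodiametric_constant TYPE('a)"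
  have comp: "compact (closure (E i))" for i using E(2) by (simp add: compact_closure)
  have *: "ennreal ?c * emeasure lebesgue (closure (E i)) \<le> ennreal (hvol (E i))" for i
  proof -
    let ?m = "measure lebesgue (closure (E i))"
    have "?c * ?m \<le> hvol (closure (E i))"
    proof (cases "?m > 0")
      case True
      have "?c \<le> hvol (closure (E i)) / ?m"
        unfolding isodiametric_constant_def
      proof (rule cInf_lower)
        show "hvol (closure (E i)) / ?m \<in> (diameter_ratios TYPE('a))"
          using True comp by blast
        show "bdd_below (diameter_ratios TYPE('a))"
          by (rule bdd_belowI[of _ 0]) (rule hvol_ratio_nonneg)
      qed
      then show ?thesis using True by (simp add: field_simps)
    next
      case False
      then have "?m = 0" using measure_nonneg[of lebesgue "closure (E i)"] by linarith
      then show ?thesis using hvol_nonneg[OF compact_imp_bounded[OF comp]] by simp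
    qed
    also have "hvol (closure (E i)) = hvol (E i)" using E(2) by (simp add: hvol_def diameter_closure)
    finally have "ennreal (?c * ?m) \<le> ennreal (hvol (E i))" by (rule ennreal_leI)
    moreover have "emeasure lebesgue (closure (E i)) = ennreal ?m"
      using lmeasurable_compact[OF comp] by (simp add: emeasure_eq_measure2)
    ultimately show ?thesis by (simp add: ennreal_mult isodiametric_constant_nonneg)
  qed
  have "emeasure lebesgue S \<le> emeasure lebesgue (\<Union>i. closure (E i))"
    using E(1) closure_subset by (intro emeasure_mono) (auto intro!: subset_trans[OF E(1)] UN_mono)
  also have "\<dots> \<le> (\<Sum>i. emeasure lebesgue (closure (E i)))"
    by (rule emeasure_subadditive_countably) auto
  finally have "ennreal ?c * emeasure lebesgue S \<le> (\<Sum>i. ennreal ?c * emeasure lebesgue (closure (E i)))"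
    by (simp add: mult_left_mono ennreal_suminf_cmult)
  also have "\<dots> \<le> (\<Sum>i. ennreal (hvol (E i)))" by (intro suminf_le *) auto
  finally show "ennreal ?c * emeasure lebesgue S \<le> (\<Sum>i. ennreal (unit_ball_vol (real DIM('a)) * (diameter (E i) / 2) ^ DIM('a)))"
    by (simp add: hvol_def)
qed

text \<open>
  A set \<open>E\<close> that nearly attains the constant is used to fill a neighbourhood of \<open>C\<close>.
\<close>

lemma premeasure_le_isodiametric_constant:
  fixes C :: "'a::euclidean_space set"
  assumes C: "compact C" and \<delta>: "\<delta> > 0"
  shows "hausdorff_premeasure DIM('a) \<delta> C \<le> ennreal (isodiametric_constant TYPE('a)) * emeasure lebesgue C"
proof -
  let ?c = "isodiametric_constant TYPE('a)"
  define m where "m = measure lebesgue C"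
  have m: "emeasure lebesgue C = ennreal m" "m \<ge> 0"
    using lmeasurable_compact[OF C] by (auto simp: m_def emeasure_eq_measure2)
  have c0: "?c \<ge> 0" by (rule isodiametric_constant_nonneg)
  have bnd: "hausdorff_premeasure DIM('a) \<delta> C \<le> ennreal ((?c + \<epsilon>) * (m + \<epsilon>) + 2 * \<epsilon>)" if eps: "\<epsilon> > 0" for \<epsilon>
  proof -
    have "\<exists>x\<in>(diameter_ratios TYPE('a)). x < ?c + \<epsilon>"
    proof (rule cInf_lessD[unfolded Bex_def[symmetric]])
      have "hvol (cball 0 1 :: 'a set) / measure lebesgue (cball 0 1 :: 'a set) \<in> (diameter_ratios TYPE('a))"
        by (intro CollectI exI[of _ "cball 0 1"]) (auto simp: content_cball_pos)
      then show "(diameter_ratios TYPE('a)) \<noteq> {}" by blast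
      show "Inf (diameter_ratios TYPE('a)) < ?c + \<epsilon>"
        using eps by (simp add: isodiametric_constant_def)
    qed
    then obtain E :: "'a set" where E: "compact E" "measure lebesgue E > 0" "hvol E / measure lebesgue E < ?c + \<epsilon>" by blast
    then have hE: "hvol E \<le> (?c + \<epsilon>) * measure lebesgue E" by (simp add: divide_less_eq)
    obtain U where U: "open U" "C \<subseteq> U" "U - C \<in> lmeasurable" "emeasure lebesgue (U - C) < ennreal \<epsilon>"
      using sets_lebesgue_outer_open[of C \<epsilon>] lmeasurable_compact[OF C] eps by blast
    have "emeasure lebesgue U = emeasure lebesgue C + emeasure lebesgue (U - C)"
    proof -
      have "emeasure lebesgue (C \<union> (U - C)) = emeasure lebesgue C + emeasure lebesgue (U - C)"
        using U(3) lmeasurable_compact[OF C] by (intro plus_emeasure[symmetric]) auto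
      moreover have "C \<union> (U - C) = U" using U(2) by blast
      ultimately show ?thesis by (simp only:)
    qed
    also have "\<dots> \<le> ennreal m + ennreal \<epsilon>" using U(4) m by (intro add_mono) auto
    finally have eU: "emeasure lebesgue U \<le> ennreal (m + \<epsilon>)" using m eps by simp
    then have Ufin: "emeasure lebesgue U < \<infinity>" by (rule le_less_trans) simp
    have "hcover \<delta> U (ennreal (?c + \<epsilon>) * emeasure lebesgue U + ennreal (2 * \<epsilon>))"
      by (rule hcover_open[OF E(1,2) hE _ U(1) Ufin \<delta> eps]) (use c0 eps in simp)
    then have "hausdorff_premeasure DIM('a) \<delta> C \<le> ennreal (?c + \<epsilon>) * emeasure lebesgue U + ennreal (2 * \<epsilon>)"
      using U(2) \<delta> by (intro hausdorff_premeasure_le_if_hcover) (auto intro: hcover_mono)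
    also have "\<dots> \<le> ennreal (?c + \<epsilon>) * ennreal (m + \<epsilon>) + ennreal (2 * \<epsilon>)"
      using eU by (intro add_right_mono mult_left_mono) auto
    also have "\<dots> = ennreal ((?c + \<epsilon>) * (m + \<epsilon>) + 2 * \<epsilon>)"
      using c0 m eps by (subst ennreal_plus) (auto simp: ennreal_mult)
    finally show ?thesis .
  qed
  have lim: "((\<lambda>\<epsilon>. ennreal ((?c + \<epsilon>) * (m + \<epsilon>) + 2 * \<epsilon>)) \<longlongrightarrow> ennreal ((?c + 0) * (m + 0) + 2 * 0)) (at_right 0)"
    by (intro tendsto_intros)
  have "hausdorff_premeasure DIM('a) \<delta> C \<le> ennreal ((?c + 0) * (m + 0) + 2 * 0)"
    by (rule tendsto_lowerbound[OF lim]) (auto simp: eventually_at_right_field intro!: exI[of _ 1] bnd)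
  then show ?thesis using c0 m by (simp add: ennreal_mult)
qed

text \<open>
  Hausdorff measure lies above a multiple of Lebesgue measure and, on compact sets, below the same
  multiple, so the factor cancels.
\<close>

theorem hausdorff_measure_le_if_lebesgue_le:
  fixes C S :: "'a::euclidean_space set"
  assumes C: "compact C" and le: "emeasure lebesgue C \<le> ennreal K * emeasure lebesgue S"
  shows "hausdorff_measure DIM('a) C \<le> ennreal K * hausdorff_measure DIM('a) S"
  unfolding hausdorff_measure_def[of _ C]
proof (rule SUP_least)
  fix \<delta> :: real assume "\<delta> \<in> {0<..}"
  let ?c = "ennreal (isodiametric_constant TYPE('a))"
  have "hausdorff_premeasure DIM('a) \<delta> C \<le> ?c * emeasure lebesgue C"
    using \<open>\<delta> \<in> {0<..}\<close> by (intro premeasure_le_isodiametric_constant C) auto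
  also have "\<dots> \<le> ?c * (ennreal K * emeasure lebesgue S)" by (intro mult_left_mono le) auto
  also have "\<dots> = ennreal K * (?c * emeasure lebesgue S)" by (simp add: mult_ac)
  also have "\<dots> \<le> ennreal K * hausdorff_premeasure DIM('a) \<delta> S"
    by (intro mult_left_mono isodiametric_constant_le_premeasure) auto
  also have "\<dots> \<le> ennreal K * hausdorff_measure DIM('a) S"
    unfolding hausdorff_measure_def using \<open>\<delta> \<in> {0<..}\<close> by (intro mult_left_mono SUP_upper) auto
  finally show "hausdorff_premeasure DIM('a) \<delta> C \<le> ennreal K * hausdorff_measure DIM('a) S" .
qed

section \<open>Eigenvalues at a contact point\<close>

lemma orthonormal_basis_expand:
  fixes b :: "'n::finite \<Rightarrow> real ^ 'n"
  assumes on: "\<And>i j. b i \<bullet> b j = (if i = j then 1 else 0)"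
  shows "v = (\<Sum>i\<in>UNIV. (v \<bullet> b i) *\<^sub>R b i)" "v \<bullet> w = (\<Sum>i\<in>UNIV. (v \<bullet> b i) * (w \<bullet> b i))"
proof -
  have inj: "inj b"
  proof (rule injI)
    fix i j assume "b i = b j"
    then show "i = j" using on[of i j] on[of j j] by (auto split: if_splits)
  qed
  have "0 \<notin> range b"
  proof
    assume "0 \<in> range b"
    then obtain i where "b i = 0" by auto
    then show False using on[of i i] by simp
  qed
  moreover have "pairwise orthogonal (range b)" using on by (auto simp: pairwise_def orthogonal_def)
  ultimately have "independent (range b)" by (intro pairwise_orthogonal_independent)
  moreover have "card (range b) = DIM(real ^ 'n)" using inj by (simp add: card_image)
  ultimately have sp: "span (range b) = UNIV"
    using dim_eq_full[of "range b"] dim_eq_card_independent[of "range b"] by simp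
  show ex: "v = (\<Sum>i\<in>UNIV. (v \<bullet> b i) *\<^sub>R b i)" for v
  proof (rule vector_eq_dot_span[of _ "range b"])
    fix u assume "u \<in> range b"
    then obtain j where u: "u = b j" by auto
    have "(\<Sum>i\<in>UNIV. (v \<bullet> b i) *\<^sub>R b i) \<bullet> b j = (\<Sum>i\<in>UNIV. if i = j then v \<bullet> b i else 0)"
      unfolding inner_sum_left by (intro sum.cong) (auto simp: on)
    then show "u \<bullet> v = u \<bullet> (\<Sum>i\<in>UNIV. (v \<bullet> b i) *\<^sub>R b i)"
      unfolding u by (simp add: inner_commute)
  qed (simp_all add: sp)
  have "v \<bullet> w = (\<Sum>i\<in>UNIV. (v \<bullet> b i) *\<^sub>R b i) \<bullet> w" using ex[of v] by simp
  also have "\<dots> = (\<Sum>i\<in>UNIV. (v \<bullet> b i) * (b i \<bullet> w))" by (simp add: inner_sum_left)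
  also have "\<dots> = (\<Sum>i\<in>UNIV. (v \<bullet> b i) * (w \<bullet> b i))" by (simp only: inner_commute[of w])
  finally show "v \<bullet> w = (\<Sum>i\<in>UNIV. (v \<bullet> b i) * (w \<bullet> b i))" .
qed

lemma self_adjoint_orthonormal_eigenbasis:
  fixes L :: "real ^ 'n \<Rightarrow> real ^ 'n"
  assumes lin: "linear L" and sa: "\<And>v w. L v \<bullet> w = v \<bullet> L w"
  obtains b :: "'n \<Rightarrow> real ^ 'n" and g :: "'n \<Rightarrow> real"
  where "\<And>i j. b i \<bullet> b j = (if i = j then 1 else 0)" "\<And>i. L (b i) = g i *\<^sub>R b i"
proof (rule self_adjoint_eigenbasis[OF lin sa])
  fix B assume B: "finite B" "card B = DIM(real ^ 'n)" "\<And>b. b \<in> B \<Longrightarrow> b \<bullet> b = 1" 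
    "\<And>b b'. b \<in> B \<Longrightarrow> b' \<in> B \<Longrightarrow> b \<noteq> b' \<Longrightarrow> b \<bullet> b' = 0"
    "\<And>b. b \<in> B \<Longrightarrow> L b = (L b \<bullet> b) *\<^sub>R b" "\<And>v. v = (\<Sum>b\<in>B. (v \<bullet> b) *\<^sub>R b)" "independent B"
  obtain b where b: "bij_betw b (UNIV :: 'n set) B"
    using finite_same_card_bij[of "UNIV :: 'n set" B] B(1,2) by auto
  have bB: "b i \<in> B" for i using b by (auto simp: bij_betw_def)
  have "b i \<bullet> b j = (if i = j then 1 else 0)" for i j
    using B(3)[OF bB] B(4)[OF bB bB] b by (auto simp: bij_betw_def inj_eq)
  moreover have "L (b i) = (L (b i) \<bullet> b i) *\<^sub>R b i" for i by (rule B(5)[OF bB])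
  ultimately show thesis by (rule that)
qed

lemma prod_one_minus_ge:
  fixes t :: "'i \<Rightarrow> real"
  assumes "finite A" "\<And>i. i \<in> A \<Longrightarrow> 0 \<le> t i \<and> t i \<le> 1"
  shows "1 - (\<Sum>i\<in>A. t i) \<le> (\<Prod>i\<in>A. 1 - t i)"
  using assms
proof (induction A rule: finite_induct)
  case (insert i A)
  have p1: "(\<Prod>i\<in>A. 1 - t i) \<le> 1" using insert.prems by (intro prod_le_1) auto
  have "t i * (\<Prod>i\<in>A. 1 - t i) \<le> t i * 1" using p1 insert.prems by (intro mult_left_mono) auto
  then show ?case using insert by (simp add: algebra_simps)
qed simp

lemma trace_inequality_eigenvalues:
  fixes b :: "'n::finite \<Rightarrow> real ^ 'n" and \<nu> :: "'n \<Rightarrow> real"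
  assumes on: "\<And>i j. b i \<bullet> b j = (if i = j then 1 else 0)"
    and S: "\<And>v. S v = (\<Sum>i\<in>UNIV. (\<nu> i * (v \<bullet> b i)) *\<^sub>R b i)"
  shows "(\<Sum>i\<in>Basis. S i \<bullet> i) - S q \<bullet> q / G = (\<Sum>i\<in>UNIV. \<nu> i * (1 - (q \<bullet> b i)\<^sup>2 / G))"
proof -
  have Svv: "S v \<bullet> v = (\<Sum>i\<in>UNIV. \<nu> i * (v \<bullet> b i)\<^sup>2)" for v
    unfolding S inner_sum_left by (intro sum.cong) (auto simp: power2_eq_square inner_commute)
  have "(\<Sum>e\<in>Basis. S e \<bullet> e) = (\<Sum>e\<in>Basis. \<Sum>i\<in>UNIV. \<nu> i * (e \<bullet> b i)\<^sup>2)" by (simp add: Svv)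
  also have "\<dots> = (\<Sum>i\<in>UNIV. \<Sum>e\<in>Basis. \<nu> i * (e \<bullet> b i)\<^sup>2)" by (rule sum.swap)
  also have "\<dots> = (\<Sum>i\<in>UNIV. \<nu> i)"
  proof (rule sum.cong[OF refl])
    fix i
    have "(\<Sum>e\<in>Basis. (e \<bullet> b i)\<^sup>2) = b i \<bullet> b i"
      by (subst euclidean_inner[of "b i" "b i"]) (simp add: inner_commute power2_eq_square)
    then show "(\<Sum>e\<in>Basis. \<nu> i * (e \<bullet> b i)\<^sup>2) = \<nu> i" by (simp add: on flip: sum_distrib_left)
  qed
  finally show ?thesis unfolding Svv
    by (simp add: sum_divide_distrib right_diff_distrib sum_subtractf)
qed

text \<open>
  Since the weights \<open>c i\<close> stay away from zero, a bound on the regularised sum that does not depend on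
  \<open>\<epsilon>\<close> keeps every \<open>g i\<close> away from zero, and then \<open>\<epsilon>\<close> may tend to \<open>0\<close>.
\<close>

lemma eigenvalue_bounds_from_regularized_trace:
  fixes g c :: "'n::finite \<Rightarrow> real"
  assumes g: "\<And>i. 0 \<le> g i" "\<And>i. g i \<le> 1" and c: "\<And>i. 1 / G \<le> c i" "\<And>i. c i \<le> 1" and G: "G \<ge> 1" and s: "s \<ge> 0"
    and reg: "\<And>\<epsilon>. \<epsilon> > 0 \<Longrightarrow> (\<Sum>i\<in>UNIV. (1 / (g i + 2 * \<epsilon>) - 2) * c i) \<le> s"
  shows "\<And>i. 0 < g i" "(\<Sum>i\<in>UNIV. (1 / g i - 1) * c i) \<le> real CARD('n) + s"
proof -
  have c0: "c i > 0" for i using c(1)[of i] G by (auto intro: less_le_trans[of 0 "1 / G"])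
  define T where "T = s + 2 * real CARD('n)"
  have T: "T > 0" using s by (simp add: T_def add_nonneg_pos)
  have lb: "1 / (G * T) \<le> g j + 2 * \<epsilon>" if eps: "\<epsilon> > 0" for j \<epsilon>
  proof -
    have pos: "g i + 2 * \<epsilon> > 0" for i using g(1)[of i] eps by simp
    have "1 / (g j + 2 * \<epsilon>) * c j = (\<Sum>i\<in>{j}. 1 / (g i + 2 * \<epsilon>) * c i)" by simp
    also have "\<dots> \<le> (\<Sum>i\<in>UNIV. 1 / (g i + 2 * \<epsilon>) * c i)"
      using pos c0 by (intro sum_mono2) (auto intro!: mult_nonneg_nonneg divide_nonneg_nonneg less_imp_le)
    also have "\<dots> = (\<Sum>i\<in>UNIV. (1 / (g i + 2 * \<epsilon>) - 2) * c i) + 2 * (\<Sum>i\<in>UNIV. c i)"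
      by (simp add: left_diff_distrib sum_subtractf sum_distrib_left)
    also have "\<dots> \<le> s + 2 * real CARD('n)"
      using reg[OF eps] sum_bounded_above[of UNIV c 1] c(2) by simp
    finally have "1 / (g j + 2 * \<epsilon>) * c j \<le> T" by (simp add: T_def)
    moreover have "1 / (g j + 2 * \<epsilon>) * (1 / G) \<le> 1 / (g j + 2 * \<epsilon>) * c j"
      using pos[of j] c(1)[of j] by (intro mult_left_mono) auto
    ultimately have "1 / (g j + 2 * \<epsilon>) * (1 / G) \<le> T" by linarith
    then have "1 / G \<le> T * (g j + 2 * \<epsilon>)" using mult_left_mono[of "1 / (g j + 2 * \<epsilon>) * (1 / G)" T "g j + 2 * \<epsilon>"] pos[of j] by (simp add: mult.commute)
    then show ?thesis using T G by (simp add: field_simps)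
  qed
  have "1 / (G * T) \<le> g j" for j
  proof (rule field_le_epsilon)
    fix e :: real assume "e > 0"
    then show "1 / (G * T) \<le> g j + e" using lb[of "e / 2" j] by simp
  qed
  moreover have "1 / (G * T) > 0" using T G by simp
  ultimately show gpos: "0 < g i" for i by (metis less_le_trans)
  have lim: "((\<lambda>\<epsilon>. \<Sum>i\<in>UNIV. (1 / (g i + 2 * \<epsilon>) - 2) * c i) \<longlongrightarrow> (\<Sum>i\<in>UNIV. (1 / (g i + 2 * 0) - 2) * c i)) (at_right 0)"
    by (intro tendsto_intros) (use gpos in \<open>auto simp: less_imp_neq[symmetric]\<close>)
  have "(\<Sum>i\<in>UNIV. (1 / (g i + 2 * 0) - 2) * c i) \<le> s"
    by (rule tendsto_upperbound[OF lim]) (auto simp: eventually_at_right_field intro!: exI[of _ 1] reg)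
  then have "(\<Sum>i\<in>UNIV. (1 / g i - 1) * c i) \<le> s + (\<Sum>i\<in>UNIV. c i)"
    by (simp add: left_diff_distrib sum_subtractf sum_distrib_left[symmetric])
  also have "\<dots> \<le> s + real CARD('n)" using sum_bounded_above[of UNIV c 1] c(2) by simp
  finally show "(\<Sum>i\<in>UNIV. (1 / g i - 1) * c i) \<le> real CARD('n) + s" by simp
qed

text \<open>
  Since \<open>sqrt G \<le> r \<le> 1 + 2 a\<close> for \<open>r = sqrt (1 + 4 a\<^sup>2)\<close>, one factor \<open>r\<close> of \<open>G \<le> r\<^sup>2\<close> is the root in
  the claim and the other is absorbed by one of the \<open>n\<close> factors of the power.
\<close>

lemma touching_constant_bound:
  fixes h a G :: real and n :: nat
  assumes h: "h \<ge> 0" and a: "a > 0" and n: "n \<ge> 1" and G: "1 \<le> G" "G \<le> 1 + 4 * a\<^sup>2"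
  shows "(real n + h / a * sqrt G) ^ n * G \<le> (2 * real n + 4 * h) ^ n * (1 + a + h / a) ^ n * sqrt (1 + 4 * a\<^sup>2)"
proof -
  define r where "r = sqrt (1 + 4 * a\<^sup>2)"
  define Q where "Q = (2 * real n + 4 * h) * (1 + a + h / a)"
  have r2: "r * r = 1 + 4 * a\<^sup>2" by (simp add: r_def)
  have r1: "1 \<le> r" by (simp add: r_def)
  have ra: "r \<le> 1 + 2 * a"
    unfolding r_def by (rule real_le_lsqrt) (use a in \<open>auto simp: power2_eq_square algebra_simps\<close>)
  have sG: "sqrt G \<le> r" using G by (simp add: r_def)
  have hr: "h / a * sqrt G \<le> h / a + 2 * h"
  proof -
    have "h / a * sqrt G \<le> h / a * (1 + 2 * a)" using sG ra h a by (intro mult_left_mono) auto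
    also have "\<dots> = h / a + 2 * h" using a by (simp add: field_simps)
    finally show ?thesis .
  qed
  define y where "y = real n + h / a * sqrt G"
  have y0: "0 \<le> y" using h a G by (simp add: y_def)
  have "y * r \<le> (real n + (h / a + 2 * h)) * (1 + 2 * a)"
    using hr ra r1 y0 h a by (intro mult_mono) (auto simp: y_def)
  also have "\<dots> = (real n + 4 * h + 2 * real n * a + 4 * a * h + h / a)"
    using a by (simp add: field_simps)
  also have "\<dots> \<le> Q"
  proof -
    have "Q = 2 * real n + 2 * real n * a + 2 * real n * (h / a) + 4 * h + 4 * a * h + 4 * h * (h / a)"
      unfolding Q_def by (simp add: algebra_simps)
    moreover have "h / a \<le> 2 * real n * (h / a)"
      using mult_right_mono[of 1 "2 * real n" "h / a"] n h a by simp
    moreover have "0 \<le> 4 * h * (h / a)" using h a by simp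
    ultimately show ?thesis by simp
  qed
  finally have yr: "y * r \<le> Q" .
  have yQ: "y \<le> Q" using yr mult_left_mono[OF r1 y0] by simp
  obtain m where m: "n = Suc m" using n by (cases n) auto
  have "y ^ n * G \<le> y ^ n * (r * r)" using G y0 r2 by (intro mult_left_mono) auto
  also have "\<dots> = (y ^ m * (y * r)) * r" by (simp add: m)
  also have "\<dots> \<le> (Q ^ m * Q) * r"
    using yr yQ y0 r1 by (intro mult_right_mono mult_mono power_mono) auto
  also have "\<dots> = (2 * real n + 4 * h) ^ n * (1 + a + h / a) ^ n * r" by (simp add: m Q_def power_mult_distrib)
  finally show ?thesis by (simp add: y_def r_def)
qed

text \<open>
  Here \<open>e\<close> stands for the Moreau envelope, \<open>A\<close> for its Hessian at \<open>p = x0 + z'\<close>, with eigenvalues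
  \<open>g i\<close> and eigenvectors \<open>b i\<close>.  For each displacement \<open>k\<close> the hypothesis \<open>upper\<close> at \<open>p + k\<close> bounds the height of
  \<open>\<Gamma>\<close> over \<open>z' + w\<close>.  Into this bound goes the expansion of \<open>e\<close>; the best choice is
  \<open>k = (A + 2 \<epsilon>)\<^sup>-\<^sup>1 w\<close>.  The outcome is a quadratic function of \<open>w\<close> that touches \<open>\<Gamma>\<close> from above at \<open>z\<close>,
  with gradient \<open>q = a (z' - x0)\<close> and Hessian \<open>a (2 - (A + 2 \<epsilon>)\<^sup>-\<^sup>1)\<close>.  The \<open>(n,h)\<close> condition then reads
  \<open>\<Sum> c i (1 / (g i + 2 \<epsilon>) - 2) \<le> (h / a) sqrt G\<close> with \<open>G = 1 + norm q ^ 2\<close> and the weights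
  \<open>c i = 1 - (q \<bullet> b i)\<^sup>2 / G\<close>, whose product is at least \<open>1 / G\<close>.  In the limit each term
  \<open>c i (1 / g i - 1)\<close> is at most \<open>n + (h / a) sqrt G\<close>, so the product of the \<open>1 / g i - 1\<close> is at most
  the \<open>n\<close>-th power of this number times \<open>G\<close>.
\<close>

theorem contact_eigenvalue_product:
  fixes \<Gamma> :: "((real ^ 'n) \<times> real) set" and e :: "real ^ 'n \<Rightarrow> real" and b :: "'n \<Rightarrow> real ^ 'n"
  assumes h: "h \<ge> 0" and a: "a > 0" and nh: "nh_subset h \<Omega> \<Gamma>" and z: "z \<in> \<Gamma>"
    and on: "\<And>i j. b i \<bullet> b j = (if i = j then 1 else 0)"
    and g: "\<And>i. 0 \<le> g i" "\<And>i. g i \<le> 1"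
    and A: "linear A" "\<And>i. A (b i) = g i *\<^sub>R b i"
    and upper: "\<And>y p. y \<in> \<Gamma> \<Longrightarrow> snd y / a - fst y \<bullet> fst y \<le> e p - fst y \<bullet> p"
    and eq: "snd z / a - fst z \<bullet> fst z = e (x0 + fst z) - fst z \<bullet> (x0 + fst z)"
    and expand: "\<And>\<epsilon>. \<epsilon> > 0 \<Longrightarrow> \<exists>d>0. \<forall>k. norm k < d \<longrightarrow>
      e (x0 + fst z + k) \<le> e (x0 + fst z) + fst z \<bullet> k + (A k \<bullet> k) / 2 + \<epsilon> * (k \<bullet> k)"
    and near: "norm (fst z - x0) \<le> 2"
  shows "\<And>i. 0 < g i"
    "(\<Prod>i\<in>UNIV. 1 - g i) \<le> ((2 * real CARD('n) + 4 * h) ^ CARD('n) * (1 + a + h / a) ^ CARD('n) * sqrt (1 + 4 * a\<^sup>2)) * (\<Prod>i\<in>UNIV. g i)"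
proof -
  define q where "q = a *\<^sub>R (fst z - x0)"
  define G where "G = 1 + q \<bullet> q"
  define c where "c i = 1 - (q \<bullet> b i)\<^sup>2 / G" for i
  have G1: "G \<ge> 1" by (simp add: G_def)
  have qq: "q \<bullet> q = (\<Sum>i\<in>UNIV. (q \<bullet> b i)\<^sup>2)"
    using orthonormal_basis_expand(2)[OF on, of q q] by (simp add: power2_eq_square)
  have qb: "(q \<bullet> b i)\<^sup>2 \<le> q \<bullet> q" for i
    unfolding qq by (rule member_le_sum) auto
  have c1: "1 / G \<le> c i" and c2: "c i \<le> 1" for i
  proof -
    have "(q \<bullet> b i)\<^sup>2 / G \<le> (G - 1) / G" using qb[of i] G1 by (intro divide_right_mono) (auto simp: G_def)
    also have "\<dots> = 1 - 1 / G" using G1 by (simp add: diff_divide_distrib)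
    finally show "1 / G \<le> c i" by (simp add: c_def)
    show "c i \<le> 1" using G1 by (simp add: c_def)
  qed
  define s where "s = h / a * sqrt G"
  have s0: "s \<ge> 0" using h a G1 by (simp add: s_def)
  interpret A: linear A by (rule A(1))
  have reg: "(\<Sum>i\<in>UNIV. (1 / (g i + 2 * \<epsilon>) - 2) * c i) \<le> s" if eps: "\<epsilon> > 0" for \<epsilon>
  proof -
    have pos: "g i + 2 * \<epsilon> > 0" for i using g(1)[of i] eps by simp
    \<comment> \<open>The operator \<open>N\<close> is the inverse of \<open>A + 2 \<epsilon>\<close>.\<close>
    define N where "N v = (\<Sum>i\<in>UNIV. (1 / (g i + 2 * \<epsilon>) * (v \<bullet> b i)) *\<^sub>R b i)" for v
    define S where "S v = a *\<^sub>R (N v - 2 *\<^sub>R v)" for v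
    have S_eig: "S v = (\<Sum>i\<in>UNIV. ((a * (1 / (g i + 2 * \<epsilon>) - 2)) * (v \<bullet> b i)) *\<^sub>R b i)" for v
    proof -
      have "2 *\<^sub>R v = 2 *\<^sub>R (\<Sum>i\<in>UNIV. (v \<bullet> b i) *\<^sub>R b i)"
        using orthonormal_basis_expand(1)[OF on, of v] by (rule arg_cong)
      also have "\<dots> = (\<Sum>i\<in>UNIV. (2 * (v \<bullet> b i)) *\<^sub>R b i)" by (simp add: scaleR_sum_right)
      finally have "N v - 2 *\<^sub>R v = (\<Sum>i\<in>UNIV. ((1 / (g i + 2 * \<epsilon>) - 2) * (v \<bullet> b i)) *\<^sub>R b i)"
        by (simp only: N_def sum_subtractf[symmetric] scaleR_left_diff_distrib[symmetric] left_diff_distrib)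
      then show ?thesis unfolding S_def by (simp only: scaleR_sum_right scaleR_scaleR mult.assoc)
    qed
    have linN: "linear N"
    proof (rule linearI)
      show "N (v + w) = N v + N w" for v w
        by (simp only: N_def inner_add_left distrib_left scaleR_add_left sum.distrib)
      show "N (t *\<^sub>R v) = t *\<^sub>R N v" for t v
        by (simp only: N_def inner_scaleR_left scaleR_sum_right scaleR_scaleR mult.left_commute)
    qed
    have linS: "linear S"
      unfolding S_def by (intro linear_compose_scale_right linear_compose_sub linN linear_scaleR)
    have Nsa: "N v \<bullet> w = v \<bullet> N w" for v w
      unfolding N_def inner_sum_left inner_sum_right by (intro sum.cong) (auto simp: inner_commute)
    have saS: "S v \<bullet> w = v \<bullet> S w" for v w by (simp add: S_def inner_diff_left inner_diff_right Nsa)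
    have AN: "A (N v) + (2 * \<epsilon>) *\<^sub>R N v = v" for v
    proof -
      have "A (N v) + (2 * \<epsilon>) *\<^sub>R N v = (\<Sum>i\<in>UNIV. (1 / (g i + 2 * \<epsilon>) * (v \<bullet> b i)) *\<^sub>R A (b i) + (2 * \<epsilon>) *\<^sub>R ((1 / (g i + 2 * \<epsilon>) * (v \<bullet> b i)) *\<^sub>R b i))"
        by (simp add: N_def A.sum A.scale scaleR_sum_right sum.distrib)
      also have "\<dots> = (\<Sum>i\<in>UNIV. (v \<bullet> b i) *\<^sub>R b i)"
      proof (rule sum.cong[OF refl])
        fix i
        have "1 / (g i + 2 * \<epsilon>) * (v \<bullet> b i) * g i + (2 * \<epsilon>) * (1 / (g i + 2 * \<epsilon>) * (v \<bullet> b i)) = v \<bullet> b i"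
        proof -
          have "1 / X * t * (X - 2 * \<epsilon>) + (2 * \<epsilon>) * (1 / X * t) = t" if "X > 0" for X t
            using that by (simp add: field_simps)
          from this[OF pos[of i]] show ?thesis by simp
        qed
        then show "(1 / (g i + 2 * \<epsilon>) * (v \<bullet> b i)) *\<^sub>R A (b i) + (2 * \<epsilon>) *\<^sub>R ((1 / (g i + 2 * \<epsilon>) * (v \<bullet> b i)) *\<^sub>R b i) = (v \<bullet> b i) *\<^sub>R b i"
          unfolding A(2) scaleR_scaleR scaleR_add_left[symmetric] by simp
      qed
      also have "\<dots> = v" using orthonormal_basis_expand(1)[OF on, of v] by simp
      finally show ?thesis .
    qed
    obtain B where B: "B > 0" "\<And>v. norm (N v) \<le> B * norm v"
      using linear_bounded_pos[OF linN] by blast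
    obtain d where d: "d > 0" "\<And>k. norm k < d \<Longrightarrow>
      e (x0 + fst z + k) \<le> e (x0 + fst z) + fst z \<bullet> k + (A k \<bullet> k) / 2 + \<epsilon> * (k \<bullet> k)"
      using expand[OF eps] by blast
    have "(\<Sum>i\<in>Basis. S i \<bullet> i) - S q \<bullet> q / (1 + q \<bullet> q) \<le> h * sqrt (1 + q \<bullet> q)"
    proof (rule nh_subset_touching_trace[OF nh z linS saS])
      show "d / B > 0" using d(1) B(1) by simp
      fix y assume y: "y \<in> \<Gamma>" "dist y z < d / B"
      define w where "w = fst y - fst z"
      define k where "k = N w"
      have "norm w \<le> dist y z" using dist_fst_le[of y z] by (simp add: w_def dist_norm)
      then have "B * norm w \<le> B * dist y z" using B(1) by (intro mult_left_mono) auto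
      also have "\<dots> < d" using y(2) B(1) by (simp add: pos_less_divide_eq mult.commute)
      finally have "B * norm w < d" .
      then have kd: "norm k < d" using B(2)[of w] by (simp add: k_def)
      have "A k + (2 * \<epsilon>) *\<^sub>R k = w" using AN[of w] by (simp add: k_def)
      then have "(A k + (2 * \<epsilon>) *\<^sub>R k) \<bullet> k = w \<bullet> k" by simp
      then have quad: "(A k \<bullet> k) / 2 + \<epsilon> * (k \<bullet> k) = (w \<bullet> k) / 2" by (simp add: inner_add_left)
      have fy: "fst y = fst z + w" by (simp add: w_def)
      have "snd y / a - fst y \<bullet> fst y \<le> e (x0 + fst z + k) - fst y \<bullet> (x0 + fst z + k)" using upper[OF y(1)] .
      also have "\<dots> \<le> e (x0 + fst z) + fst z \<bullet> k + (w \<bullet> k) / 2 - fst y \<bullet> (x0 + fst z + k)"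
        using d(2)[OF kd] quad by linarith
      also have "e (x0 + fst z) = snd z / a - fst z \<bullet> fst z + fst z \<bullet> (x0 + fst z)" using eq by simp
      finally have "snd y / a \<le> snd z / a + (fst z - x0) \<bullet> w + w \<bullet> w - (w \<bullet> k) / 2"
        unfolding fy by (simp add: inner_add_left inner_add_right inner_diff_left inner_diff_right inner_commute)
      then have "a * (snd y / a) \<le> a * (snd z / a + (fst z - x0) \<bullet> w + w \<bullet> w - (w \<bullet> k) / 2)"
        using a by (intro mult_left_mono) auto
      then have "snd y \<le> snd z + a * ((fst z - x0) \<bullet> w) + a * (w \<bullet> w) - a * (w \<bullet> k) / 2"
        using a by (simp add: distrib_left right_diff_distrib)
      moreover have "q \<bullet> w = a * ((fst z - x0) \<bullet> w)" by (simp add: q_def)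
      moreover have "S w \<bullet> w / 2 = a * (w \<bullet> k) / 2 - a * (w \<bullet> w)"
        by (simp add: S_def k_def inner_diff_left right_diff_distrib diff_divide_distrib inner_commute[of w "N w"])
      ultimately show "snd y \<le> snd z + q \<bullet> (fst y - fst z) - S (fst y - fst z) \<bullet> (fst y - fst z) / 2"
        unfolding w_def[symmetric] by linarith
    qed
    then have "(\<Sum>i\<in>UNIV. (a * (1 / (g i + 2 * \<epsilon>) - 2)) * c i) \<le> h * sqrt G"
      using trace_inequality_eigenvalues[OF on S_eig, of q G] unfolding c_def G_def by simp
    then have "a * (\<Sum>i\<in>UNIV. (1 / (g i + 2 * \<epsilon>) - 2) * c i) \<le> h * sqrt G"
      by (simp add: sum_distrib_left mult.assoc)
    then show ?thesis using a by (simp add: s_def field_simps)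
  qed
  note bounds = eigenvalue_bounds_from_regularized_trace[OF g c1 c2 G1 s0 reg]
  show gpos: "0 < g i" for i by (rule bounds(1))
  define m where "m i = 1 / g i - 1" for i
  have m0: "m i \<ge> 0" for i using gpos[of i] g(2)[of i] by (simp add: m_def)
  have c0: "c i > 0" for i using c1[of i] G1 by (auto intro: less_le_trans[of 0 "1 / G"])
  have "m i * c i \<le> real CARD('n) + s" for i
  proof -
    have "m i * c i \<le> (\<Sum>i\<in>UNIV. m i * c i)" using m0 c0 by (intro member_le_sum) (auto simp: less_imp_le)
    then show ?thesis using bounds(2) by (simp add: m_def)
  qed
  then have "(\<Prod>i\<in>UNIV. m i * c i) \<le> (\<Prod>i\<in>(UNIV::'n set). real CARD('n) + s)"
    using m0 c0 by (intro prod_mono) (auto simp: less_imp_le)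
  then have up: "(\<Prod>i\<in>UNIV. m i) * (\<Prod>i\<in>UNIV. c i) \<le> (real CARD('n) + s) ^ CARD('n)" by (simp add: prod.distrib)
  have cG: "1 / G \<le> (\<Prod>i\<in>UNIV. c i)"
  proof -
    have "1 - (\<Sum>i\<in>UNIV. (q \<bullet> b i)\<^sup>2 / G) \<le> (\<Prod>i\<in>UNIV. c i)"
      unfolding c_def using c0 G1 by (intro prod_one_minus_ge) (auto simp: c_def less_imp_le)
    moreover have "(\<Sum>i\<in>UNIV. (q \<bullet> b i)\<^sup>2 / G) = (G - 1) / G" by (simp add: sum_divide_distrib[symmetric] qq[symmetric] G_def)
    ultimately show ?thesis using G1 by (simp add: field_simps)
  qed
  have M0: "(\<Prod>i\<in>UNIV. m i) \<ge> 0" using m0 by (intro prod_nonneg) auto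
  have "(\<Prod>i\<in>UNIV. m i) * (1 / G) \<le> (real CARD('n) + s) ^ CARD('n)"
    using mult_left_mono[OF cG M0] up by linarith
  then have Mle: "(\<Prod>i\<in>UNIV. m i) \<le> (real CARD('n) + s) ^ CARD('n) * G"
    using G1 by (simp add: field_simps)
  have G4: "G \<le> 1 + 4 * a\<^sup>2"
  proof -
    have "norm q \<le> a * 2" unfolding q_def using near a by simp
    then have "(norm q)\<^sup>2 \<le> (a * 2)\<^sup>2" by (intro power_mono) auto
    then show ?thesis by (simp add: G_def power2_norm_eq_inner power_mult_distrib)
  qed
  let ?K = "(2 * real CARD('n) + 4 * h) ^ CARD('n) * (1 + a + h / a) ^ CARD('n) * sqrt (1 + 4 * a\<^sup>2)"
  have "(\<Prod>i\<in>UNIV. m i) \<le> ?K"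
    using Mle touching_constant_bound[OF h a _ G1 G4, of "CARD('n)"] by (simp add: s_def Suc_leI)
  then have "(\<Prod>i\<in>UNIV. m i) * (\<Prod>i\<in>UNIV. g i) \<le> ?K * (\<Prod>i\<in>UNIV. g i)"
    using gpos by (intro mult_right_mono prod_nonneg) (auto simp: less_imp_le)
  moreover have "(\<Prod>i\<in>UNIV. m i) * (\<Prod>i\<in>UNIV. g i) = (\<Prod>i\<in>UNIV. 1 - g i)"
    unfolding prod.distrib[symmetric]
  proof (rule prod.cong[OF refl])
    fix i show "m i * g i = 1 - g i" using gpos[of i] by (simp add: m_def field_simps)
  qed
  ultimately show "(\<Prod>i\<in>UNIV. 1 - g i) \<le> ?K * (\<Prod>i\<in>UNIV. g i)" by simp
qed

section \<open>The contact relation\<close>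

lemma hausdorff_measure_mono: "A \<subseteq> B \<Longrightarrow> hausdorff_measure d A \<le> hausdorff_measure d B"
  unfolding hausdorff_measure_def hausdorff_premeasure_def
  by (intro SUP_subset_mono INF_superset_mono) auto

definition contact :: "real \<Rightarrow> ('a::euclidean_space \<times> real) set \<Rightarrow> 'a \<Rightarrow> 'a \<times> real \<Rightarrow> bool" where
  "contact a K x z \<longleftrightarrow> z \<in> K \<and> (\<forall>y\<in>K. snd y - a / 2 * (norm (fst y - x))\<^sup>2 \<le> snd z - a / 2 * (norm (fst z - x))\<^sup>2)"

lemma contact_iff_touches:
  "contact a K x z \<longleftrightarrow> (\<exists>t. touches_from_above (paraboloid a x t) K \<and> z \<in> graph_of (paraboloid a x t) \<inter> K)"
proof
  assume c: "contact a K x z"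
  show "\<exists>t. touches_from_above (paraboloid a x t) K \<and> z \<in> graph_of (paraboloid a x t) \<inter> K"
  proof (intro exI conjI)
    let ?t = "snd z - a / 2 * (norm (fst z - x))\<^sup>2"
    show g: "z \<in> graph_of (paraboloid a x ?t) \<inter> K"
      using c by (cases z) (simp add: contact_def graph_of_def paraboloid_def)
    have "supergraph (paraboloid a x ?t) \<inter> K = {}"
      using c by (force simp: contact_def supergraph_def paraboloid_def)
    then show "touches_from_above (paraboloid a x ?t) K" using g unfolding touches_from_above_def by blast
  qed
next
  assume "\<exists>t. touches_from_above (paraboloid a x t) K \<and> z \<in> graph_of (paraboloid a x t) \<inter> K"
  then obtain t where "touches_from_above (paraboloid a x t) K" "z \<in> graph_of (paraboloid a x t) \<inter> K" by blast
  then have t: "supergraph (paraboloid a x t) \<inter> K = {}" "z \<in> K" "snd z = a / 2 * (norm (fst z - x))\<^sup>2 + t"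
    by (auto simp: touches_from_above_def graph_of_def paraboloid_def)
  show "contact a K x z" unfolding contact_def
  proof (intro conjI ballI t(2))
    fix y assume "y \<in> K"
    then have "y \<notin> supergraph (paraboloid a x t)" using t(1) by blast
    then have "snd y \<le> a / 2 * (norm (fst y - x))\<^sup>2 + t" by (cases y) (simp add: supergraph_def paraboloid_def)
    then show "snd y - a / 2 * (norm (fst y - x))\<^sup>2 \<le> snd z - a / 2 * (norm (fst z - x))\<^sup>2" using t(3) by linarith
  qed
qed

lemma graph_normal_exists:
  fixes f :: "'a::euclidean_space \<Rightarrow> real"
  assumes "(f has_derivative (\<lambda>v. q \<bullet> v)) (at (fst z))"
  shows "\<exists>\<eta>. normal_to_graph f z \<eta> \<and> norm \<eta> = 1 \<and> snd \<eta> > 0"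
proof -
  let ?N = "(- q, 1 :: real)"
  have fd: "frechet_derivative f (at (fst z)) = (\<lambda>v. q \<bullet> v)"
    using frechet_derivative_at[OF assms] by simp
  have N0: "norm ?N > 0" by (simp add: zero_prod_def)
  show ?thesis
  proof (intro exI[of _ "(1 / norm ?N) *\<^sub>R ?N"] conjI)
    show "normal_to_graph f z ((1 / norm ?N) *\<^sub>R ?N)"
      unfolding normal_to_graph_def fd by simp
    show "norm ((1 / norm ?N) *\<^sub>R ?N) = 1" using N0 by (simp only: norm_scaleR) simp
    show "snd ((1 / norm ?N) *\<^sub>R ?N) > 0" using N0 by simp
  qed
qed

lemma paraboloid_normal_exists:
  fixes x :: "real ^ 'n"
  shows "\<exists>\<eta>. normal_to_graph (paraboloid a x t) z \<eta> \<and> norm \<eta> = 1 \<and> snd \<eta> > 0"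
proof (rule graph_normal_exists)
  have "((\<lambda>y. a / 2 * ((y - x) \<bullet> (y - x)) + t) has_derivative (\<lambda>v. (a *\<^sub>R (fst z - x)) \<bullet> v)) (at (fst z))"
    by (rule derivative_eq_intros | simp add: inner_commute algebra_simps)+
  then show "(paraboloid a x t has_derivative (\<lambda>v. (a *\<^sub>R (fst z - x)) \<bullet> v)) (at (fst z))"
    unfolding paraboloid_def power2_norm_eq_inner .
qed

text \<open>
  It remains to set up the convex function \<open>W\<close> whose subgradients are the projected contact points, and
  to pass from the contact set over \<open>C\<close> to its part where \<open>resid\<close> is differentiable.
\<close>

theorem corollary1p3:
  fixes \<Gamma> :: "((real ^ 'n) \<times> real) set" and C :: "(real ^ 'n) set" and h a :: real
  assumes "h \<ge> 0" and "a > 0"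
    and "nh_subset h unit_cylinder \<Gamma>"
    and "hausdorff_measure CARD('n) \<Gamma> < \<infinity>"
    and "closed C" and "C \<subseteq> cball 0 1"
    and "touching_set a \<Gamma> C \<noteq> {}"
    and "touching_set a \<Gamma> C \<subseteq> \<Gamma> \<times> sphere 0 1"
  shows "hausdorff_measure CARD('n) C
    \<le> ennreal ((2 * real CARD('n) + 4 * h) ^ CARD('n) * (1 + a + h / a) ^ CARD('n)
                 * sqrt (1 + 4 * a\<^sup>2))
      * hausdorff_measure CARD('n) (touching_set_proj a \<Gamma> C)"
proof -
  note h = assms(1) and a = assms(2) and nh = assms(3)
  let ?K = "closure \<Gamma>"
  let ?c = "(2 * real CARD('n) + 4 * h) ^ CARD('n) * (1 + a + h / a) ^ CARD('n) * sqrt (1 + 4 * a\<^sup>2)"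
  have c0: "?c \<ge> 0" using h a by simp
  have contact_mem: "z \<in> \<Gamma>" "fst z \<in> touching_set_proj a \<Gamma> C" if "contact a ?K x z" "x \<in> C" for x z
  proof -
    obtain t where t: "touches_from_above (paraboloid a x t) ?K" "z \<in> graph_of (paraboloid a x t) \<inter> ?K"
      using \<open>contact a ?K x z\<close> contact_iff_touches by blast
    obtain \<eta> where eta: "normal_to_graph (paraboloid a x t) z \<eta>" "norm \<eta> = 1" "snd \<eta> > 0"
      using paraboloid_normal_exists by blast
    have mem: "(z, \<eta>) \<in> touching_set a \<Gamma> C"
      unfolding touching_set_def using t eta \<open>x \<in> C\<close> by blast
    then show "z \<in> \<Gamma>" using assms(8) by auto
    show "fst z \<in> touching_set_proj a \<Gamma> C"
      unfolding touching_set_proj_def using mem eta(2) by (intro CollectI exI[of _ z]) auto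
  qed
  have Gcyl: "\<Gamma> \<subseteq> unit_cylinder" using nh unfolding nh_subset_def closedin_def by simp
  have K1: "norm (fst z) \<le> 1" if "z \<in> ?K" for z
  proof -
    have "closed {z :: (real ^ 'n) \<times> real. norm (fst z) \<le> 1}"
      by (intro closed_Collect_le continuous_intros)
    moreover have "\<Gamma> \<subseteq> {z. norm (fst z) \<le> 1}" using Gcyl by (auto simp: unit_cylinder_def)
    ultimately have "?K \<subseteq> {z. norm (fst z) \<le> 1}" by (rule closure_minimal[rotated])
    then show ?thesis using that by blast
  qed
  define v where "v z = snd z / a - (fst z \<bullet> fst z) / 2" for z :: "(real ^ 'n) \<times> real"
  have contact_v: "contact a ?K x z \<longleftrightarrow> z \<in> ?K \<and> (\<forall>y\<in>?K. v y + fst y \<bullet> x \<le> v z + fst z \<bullet> x)" for x z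
  proof -
    have key: "snd y - a / 2 * (norm (fst y - x))\<^sup>2 = a * (v y + fst y \<bullet> x - (x \<bullet> x) / 2)" for y
      using a by (simp add: v_def power2_norm_eq_inner inner_diff_left inner_diff_right inner_commute field_simps)
    show ?thesis unfolding contact_def key using a by simp
  qed
  obtain z1 x1 where z1: "contact a ?K x1 z1" "x1 \<in> C"
    using assms(7) contact_iff_touches unfolding touching_set_def by blast
  have z1K: "z1 \<in> ?K" using z1(1) by (simp add: contact_def)
  define M where "M = v z1 + fst z1 \<bullet> x1 + norm x1"
  have inn: "\<bar>fst y \<bullet> x\<bar> \<le> norm x" if "y \<in> ?K" for x y
    using Cauchy_Schwarz_ineq2[of "fst y" x] K1[OF that] mult_right_mono[of "norm (fst y)" 1 "norm x"] by simp
  have vM: "v y \<le> M" if "y \<in> ?K" for y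
  proof -
    have "v y + fst y \<bullet> x1 \<le> v z1 + fst z1 \<bullet> x1" using z1(1) that unfolding contact_v by blast
    then show ?thesis using inn[OF that, of x1] unfolding M_def by linarith
  qed
  \<comment> \<open>The support function of the contact problem; \<open>W x - norm x ^ 2 / 2\<close> is \<open>1 / a\<close> times the touching height.\<close>
  define W where "W x = (SUP y\<in>?K. v y + fst y \<bullet> x)" for x
  have bdd: "bdd_above ((\<lambda>y. v y + fst y \<bullet> x) ` ?K)" for x
  proof (rule bdd_aboveI2)
    fix y assume "y \<in> ?K"
    then show "v y + fst y \<bullet> x \<le> M + norm x" using vM[of y] inn[of y x] by linarith
  qed
  have Wge: "v y + fst y \<bullet> x \<le> W x" if "y \<in> ?K" for x y
    unfolding W_def using bdd that by (intro cSUP_upper)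
  have Wle: "W x \<le> B" if "\<And>y. y \<in> ?K \<Longrightarrow> v y + fst y \<bullet> x \<le> B" for x B
    unfolding W_def using that z1K by (intro cSUP_least) auto
  have Wconv: "convex_on UNIV W"
  proof (rule convex_onI)
    fix t :: real and x y assume t: "0 < t" "t < 1"
    show "W ((1 - t) *\<^sub>R x + t *\<^sub>R y) \<le> (1 - t) * W x + t * W y"
    proof (rule Wle)
      fix z assume z: "z \<in> ?K"
      have "v z + fst z \<bullet> ((1 - t) *\<^sub>R x + t *\<^sub>R y) = (1 - t) * (v z + fst z \<bullet> x) + t * (v z + fst z \<bullet> y)"
        by (simp add: inner_add_right algebra_simps)
      also have "\<dots> \<le> (1 - t) * W x + t * W y" using Wge[OF z] t by (intro add_mono mult_left_mono) auto
      finally show "v z + fst z \<bullet> ((1 - t) *\<^sub>R x + t *\<^sub>R y) \<le> (1 - t) * W x + t * W y" .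
    qed
  qed simp
  have Wlip1: "W x \<le> W y + norm (x - y)" for x y
  proof (rule Wle)
    fix z assume z: "z \<in> ?K"
    have "v z + fst z \<bullet> x = v z + fst z \<bullet> y + fst z \<bullet> (x - y)" by (simp add: inner_diff_right)
    then show "v z + fst z \<bullet> x \<le> W y + norm (x - y)" using Wge[OF z, of y] inn[OF z, of "x - y"] by linarith
  qed
  have Wlip: "1-lipschitz_on UNIV W"
  proof (rule lipschitz_onI)
    show "dist (W x) (W y) \<le> 1 * dist x y" for x y
      using Wlip1[of x y] Wlip1[of y x] by (simp add: dist_real_def dist_norm norm_minus_commute abs_le_iff)
  qed simp
  interpret Moreau W 1 by unfold_locales (rule Wconv, rule Wlip)
  have contW: "contact a ?K x z \<longleftrightarrow> z \<in> ?K \<and> W x = v z + fst z \<bullet> x" for x z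
  proof
    assume "contact a ?K x z"
    then have "z \<in> ?K" "\<And>y. y \<in> ?K \<Longrightarrow> v y + fst y \<bullet> x \<le> v z + fst z \<bullet> x" unfolding contact_v by auto
    then show "z \<in> ?K \<and> W x = v z + fst z \<bullet> x" using Wge[of z x] Wle[of x] by (simp add: antisym)
  next
    assume "z \<in> ?K \<and> W x = v z + fst z \<bullet> x"
    then show "contact a ?K x z" using Wge[of _ x] unfolding contact_v by auto
  qed
  have contv: "continuous_on A v" for A
    unfolding v_def using a by (intro continuous_intros) auto
  have bddset: "bounded {z \<in> ?K. b \<le> v z}" for b
  proof (rule bounded_subset)
    show "bounded (cball (0 :: real ^ 'n) 1 \<times> {a * b .. a * (M + 1)})" by (intro bounded_Times bounded_cball bounded_closed_interval)
    show "{z \<in> ?K. b \<le> v z} \<subseteq> cball 0 1 \<times> {a * b .. a * (M + 1)}"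
    proof
      fix z assume "z \<in> {z \<in> ?K. b \<le> v z}"
      then have z: "z \<in> ?K" "b \<le> v z" by auto
      have n: "norm (fst z) \<le> 1" by (rule K1[OF z(1)])
      have "(norm (fst z))\<^sup>2 \<le> 1" using power_mono[OF n, of 2] by simp
      then have "fst z \<bullet> fst z \<le> 1" "fst z \<bullet> fst z \<ge> 0" by (simp_all add: power2_norm_eq_inner)
      then have "b \<le> snd z / a" "snd z / a \<le> M + 1" using z(2) vM[OF z(1)] unfolding v_def by linarith+
      then have "a * b \<le> snd z" "snd z \<le> a * (M + 1)" using a by (simp_all add: field_simps)
      then show "z \<in> cball 0 1 \<times> {a * b .. a * (M + 1)}" using n by (cases z) auto
    qed
  qed
  have ex_contact: "\<exists>z. contact a ?K x z" for x
  proof -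
    \<comment> \<open>Points with smaller \<open>v\<close> lie below \<open>z1\<close> for the center \<open>x\<close>, because \<open>norm (fst z) \<le> 1\<close> on the closure.\<close>
    let ?b = "v z1 - 2 * norm x"
    let ?S = "{z \<in> ?K. ?b \<le> v z}"
    have "closed ?S" by (intro closed_Collect_conj closed_Collect_le continuous_intros contv) (auto simp: closed_def)
    then have "compact ?S" using bddset compact_eq_bounded_closed by blast
    moreover have z1S: "z1 \<in> ?S" using z1K by simp
    moreover have "continuous_on ?S (\<lambda>z. v z + fst z \<bullet> x)" by (intro continuous_intros contv)
    ultimately obtain z where z: "z \<in> ?S" "\<And>y. y \<in> ?S \<Longrightarrow> v y + fst y \<bullet> x \<le> v z + fst z \<bullet> x"
      using continuous_attains_sup[of ?S "\<lambda>z. v z + fst z \<bullet> x"] by blast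
    have "v y + fst y \<bullet> x \<le> v z + fst z \<bullet> x" if y: "y \<in> ?K" for y
    proof (cases "y \<in> ?S")
      case False
      then have "v y < v z1 - 2 * norm x" using y by simp
      then show ?thesis using inn[OF y, of x] inn[OF z1K, of x] z(2)[OF z1S] by linarith
    qed (rule z(2))
    then show ?thesis using z(1) unfolding contact_v by blast
  qed
  have contact_prox: "prox (x + fst z) = x" "resid (x + fst z) = fst z" if "contact a ?K x z" for x z
  proof -
    have z: "z \<in> ?K" "W x = v z + fst z \<bullet> x" using that by (simp_all add: contW)
    show p: "prox (x + fst z) = x"
    proof (rule prox_eqI)
      fix y show "W x + (x + fst z - x) \<bullet> (y - x) \<le> W y"
        using Wge[OF z(1), of y] z(2) by (simp add: inner_diff_right)
    qed
    show "resid (x + fst z) = fst z" by (simp add: resid_def p)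
  qed
  have env_ge: "snd y / a - fst y \<bullet> fst y \<le> env p - fst y \<bullet> p" if y: "y \<in> ?K" for y p
  proof -
    have "0 \<le> (norm (prox p - p + fst y))\<^sup>2" by simp
    then have "0 \<le> (norm (prox p - p))\<^sup>2 + 2 * (fst y \<bullet> (prox p - p)) + fst y \<bullet> fst y"
      unfolding power2_norm_eq_inner by (simp add: inner_add_left inner_add_right inner_commute)
    then show ?thesis using Wge[OF y, of "prox p"] unfolding env_def v_def by (simp add: inner_diff_right)
  qed
  have env_eq: "snd z / a - fst z \<bullet> fst z = env (x + fst z) - fst z \<bullet> (x + fst z)" if c: "contact a ?K x z" for x z
  proof -
    have "W x = v z + fst z \<bullet> x" using c by (simp add: contW)
    then show ?thesis by (simp add: env_def contact_prox[OF c] v_def power2_norm_eq_inner inner_add_right)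
  qed
  \<comment> \<open>The contact relation over \<open>C\<close>, parametrised by \<open>p = x + fst z\<close>.\<close>
  define D where "D = (\<lambda>(x, z). x + fst z) ` {(x, z). x \<in> C \<and> contact a ?K x z}"
  have compC: "compact C" using assms(5,6) bounded_subset[OF bounded_cball] compact_eq_bounded_closed by blast
  have compD: "compact D"
    unfolding D_def
  proof (rule compact_continuous_image)
    show "continuous_on {(x, z). x \<in> C \<and> contact a ?K x z} (\<lambda>(x, z). x + fst z)"
      by (auto simp: case_prod_beta intro!: continuous_intros)
    let ?b = "v z1 - 2"
    let ?S = "{z \<in> ?K. ?b \<le> v z}"
    have cW: "continuous_on A W" for A using lipschitz_on_continuous_on[OF Wlip] continuous_on_subset by blast
    have "closed ?S" by (intro closed_Collect_conj closed_Collect_le continuous_intros contv) (auto simp: closed_def)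
    then have "compact ?S" using bddset compact_eq_bounded_closed by blast
    then have cp: "compact (C \<times> ?S)" using compC by (intro compact_Times)
    have eq: "{(x, z). x \<in> C \<and> contact a ?K x z} = (C \<times> ?S) \<inter> {p. W (fst p) = v (snd p) + fst (snd p) \<bullet> fst p}"
    proof -
      have "v z1 - 2 \<le> v z" if "x \<in> C" "contact a ?K x z" for x z
      proof -
        have z: "z \<in> ?K" "v z1 + fst z1 \<bullet> x \<le> v z + fst z \<bullet> x" using that(2) z1K unfolding contact_v by auto
        have "norm x \<le> 1" using that(1) assms(6) by auto
        then show ?thesis using z inn[OF z(1), of x] inn[OF z1K, of x] by linarith
      qed
      then show ?thesis by (auto simp: contW)
    qed
    have "closed {p :: (real ^ 'n) \<times> ((real ^ 'n) \<times> real). W (fst p) = v (snd p) + fst (snd p) \<bullet> fst p}"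
      by (intro closed_Collect_eq continuous_intros continuous_on_compose2[OF cW] continuous_on_compose2[OF contv]) auto
    then show "compact {(x, z). x \<in> C \<and> contact a ?K x z}" unfolding eq by (intro compact_Int_closed cp)
  qed
  define D1 where "D1 = {p \<in> D. resid differentiable (at p)}"
  have negD: "negligible (D - D1)"
    by (rule negligible_subset[OF Rademacher[OF resid_lipschitz]]) (auto simp: D1_def)
  have "D1 = D - (D - D1)" by (auto simp: D1_def)
  then have D1s: "D1 \<in> sets lebesgue"
    using compD negD by (metis compact_imp_closed lmeasurable_compact fmeasurableD negligible_imp_sets sets.Diff)
  define A where "A p = frechet_derivative resid (at p)" for p
  have derA: "(resid has_derivative A p) (at p)" if "p \<in> D1" for p
    using that unfolding A_def D1_def by (simp add: frechet_derivative_works)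
  have derJ: "(prox has_derivative (\<lambda>v. v - A p v)) (at p)" if "p \<in> D1" for p
  proof -
    have "((\<lambda>p. p - resid p) has_derivative (\<lambda>v. v - A p v)) (at p)"
      by (intro has_derivative_diff has_derivative_ident derA that)
    then show ?thesis by (simp add: resid_def)
  qed
  have eig: "\<exists>b g. (\<forall>i j. b i \<bullet> b j = (if i = j then 1 else 0)) \<and> (\<forall>i :: 'n. A p (b i) = g i *\<^sub>R b i \<and> 0 < g i \<and> g i \<le> 1)
      \<and> (\<Prod>i\<in>UNIV. 1 - g i) \<le> ?c * (\<Prod>i\<in>UNIV. g i)" if p: "p \<in> D1" for p
  proof -
    obtain x z where xz: "x \<in> C" "contact a ?K x z" "p = x + fst z"
      using p by (auto simp: D1_def D_def)
    have linA: "linear (A p)" using derA[OF p] by (rule has_derivative_linear)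
    have saA: "A p u \<bullet> w = u \<bullet> A p w" for u w
      using second_derivative_symmetric[OF env_derivative derA[OF p], of u w] by (simp add: inner_commute)
    obtain b g where b: "\<And>i j. b i \<bullet> b j = (if i = j then 1 else 0)" "\<And>i :: 'n. A p (b i) = g i *\<^sub>R b i"
      using self_adjoint_orthonormal_eigenbasis[OF linA saA] by blast
    have gg: "g i * g i \<le> g i" for i
      using resid_derivative_firm[OF derA[OF p], of "b i"] by (simp add: b)
    have g0: "0 \<le> g i" for i using gg[of i] zero_le_square[of "g i"] by linarith
    have g1: "g i \<le> 1" for i
    proof (rule ccontr)
      assume "\<not> g i \<le> 1"
      then have "g i * 1 < g i * g i" by (intro mult_strict_left_mono) auto
      then show False using gg[of i] by simp
    qed
    have zG: "z \<in> \<Gamma>" by (rule contact_mem(1)[OF xz(2,1)])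
    have upper: "snd y / a - fst y \<bullet> fst y \<le> env q - fst y \<bullet> q" if "y \<in> \<Gamma>" for y q
      using env_ge that closure_subset by blast
    have expand: "\<exists>d>0. \<forall>k. norm k < d \<longrightarrow>
      env (x + fst z + k) \<le> env (x + fst z) + fst z \<bullet> k + (A p k \<bullet> k) / 2 + \<epsilon> * (k \<bullet> k)" if eps: "\<epsilon> > 0" for \<epsilon>
    proof -
      obtain d where d: "d > 0" "\<And>k. norm k < d \<Longrightarrow> \<bar>env (p + k) - env p - resid p \<bullet> k - (A p k \<bullet> k) / 2\<bar> \<le> \<epsilon> * (k \<bullet> k)"
        using second_order_expansion[OF env_derivative derA[OF p] eps] by blast
      have "resid p = fst z" using contact_prox(2)[OF xz(2)] xz(3) by simp
      then have "env (x + fst z + k) \<le> env (x + fst z) + fst z \<bullet> k + (A p k \<bullet> k) / 2 + \<epsilon> * (k \<bullet> k)" if "norm k < d" for k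
        using d(2)[OF that] unfolding xz(3)[symmetric] by (simp add: abs_le_iff)
      then show ?thesis using d(1) by blast
    qed
    have "norm (fst z - x) \<le> norm (fst z) + norm x" by (rule norm_triangle_ineq4)
    also have "\<dots> \<le> 1 + 1" using K1[of z] xz(1,2) assms(6) by (intro add_mono) (auto simp: contact_def)
    finally have near: "norm (fst z - x) \<le> 2" by simp
    note prod = contact_eigenvalue_product[OF h a nh zG b(1) g0 g1 linA b(2) upper env_eq[OF xz(2)] expand near]
    show ?thesis using b prod g1 by blast
  qed
  have injG: "inj_on resid D1"
  proof (rule inj_onI)
    fix q p assume q: "q \<in> D1" and p: "p \<in> D1" and eq: "resid q = resid p"
    obtain b g where b: "\<And>i j. b i \<bullet> b j = (if i = j then 1 else 0)" "\<And>i :: 'n. A p (b i) = g i *\<^sub>R b i" "\<And>i. 0 < g i"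
      using eig[OF p] by blast
    show "q = p"
    proof (rule resid_inj_at[OF derA[OF p] _ eq])
      fix u assume u: "A p u = 0"
      have linA: "linear (A p)" using derA[OF p] by (rule has_derivative_linear)
      have "A p u = A p (\<Sum>i\<in>UNIV. (u \<bullet> b i) *\<^sub>R b i)" using orthonormal_basis_expand(1)[OF b(1), of u] by simp
      also have "\<dots> = (\<Sum>i\<in>UNIV. (u \<bullet> b i * g i) *\<^sub>R b i)" by (simp add: linear_sum[OF linA] linear_scale[OF linA] b)
      finally have "(\<Sum>i\<in>UNIV. (u \<bullet> b i * g i) *\<^sub>R b i) = 0" using u by simp
      then have "(\<Sum>i\<in>UNIV. (u \<bullet> b i * g i) *\<^sub>R b i) \<bullet> b j = 0" for j by simp
      moreover have "(\<Sum>i\<in>UNIV. (u \<bullet> b i * g i) *\<^sub>R b i) \<bullet> b j = (\<Sum>i\<in>UNIV. if i = j then u \<bullet> b i * g i else 0)" for j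
        unfolding inner_sum_left by (intro sum.cong) (auto simp: b)
      ultimately have "u \<bullet> b j * g j = 0" for j by simp
      then have "u \<bullet> b j = 0" for j using b(3)[of j] by (metis mult_eq_0_iff less_irrefl)
      then show "u = 0" using orthonormal_basis_expand(1)[OF b(1), of u] by simp
    qed
  qed
  let ?S = "resid ` D1"
  have S_sub: "?S \<subseteq> touching_set_proj a \<Gamma> C"
    using contact_mem(2) contact_prox(2) by (auto simp: D1_def D_def)
  have S_meas: "?S \<in> lmeasurable"
  proof -
    have "resid differentiable_on D1"
      unfolding differentiable_on_def D1_def by (auto intro: differentiable_at_withinI)
    then have "?S \<in> sets lebesgue" by (intro differentiable_image_in_sets_lebesgue D1s) auto
    moreover have "?S \<subseteq> cball 0 1"
      using contact_prox(2) K1 by (auto simp: D1_def D_def contact_def)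
    ultimately show ?thesis by (metis bounded_cball bounded_set_imp_lmeasurable bounded_subset)
  qed
  have "emeasure lebesgue (prox ` D1) \<le> ennreal ?c * emeasure lebesgue ?S"
  proof (rule emeasure_image_le_eigenvalues[OF D1s _ _ injG S_meas c0])
    show "(prox has_derivative (\<lambda>v. v - A p v)) (at p within D1)" if "p \<in> D1" for p
      using derJ[OF that] by (rule has_derivative_at_withinI)
    show "(resid has_derivative A p) (at p within D1)" if "p \<in> D1" for p
      using derA[OF that] by (rule has_derivative_at_withinI)
    fix p assume "p \<in> D1"
    from eig[OF this] obtain b g where b: "\<And>i j. b i \<bullet> b j = (if i = j then 1 else 0)" "\<And>i :: 'n. A p (b i) = g i *\<^sub>R b i"
      "\<And>i. 0 < g i" "\<And>i. g i \<le> 1" "(\<Prod>i\<in>UNIV. 1 - g i) \<le> ?c * (\<Prod>i\<in>UNIV. g i)" by blast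
    have p1: "\<bar>\<Prod>i\<in>UNIV. 1 - g i\<bar> = (\<Prod>i\<in>UNIV. 1 - g i)" using b(4) by (intro abs_of_nonneg prod_nonneg) auto
    have p2: "\<bar>\<Prod>i\<in>UNIV. g i\<bar> = (\<Prod>i\<in>UNIV. g i)" using b(3) by (intro abs_of_nonneg prod_nonneg) (auto simp: less_imp_le)
    show "\<exists>b c d. (\<forall>i j. b i \<bullet> b j = (if i = j then 1 else 0)) \<and>
       (\<forall>i :: 'n. b i - A p (b i) = c i *\<^sub>R b i \<and> A p (b i) = d i *\<^sub>R b i) \<and>
       \<bar>\<Prod>i\<in>UNIV. c i\<bar> \<le> ?c * \<bar>\<Prod>i\<in>UNIV. d i\<bar>"
      using b by (intro exI[of _ b] exI[of _ "\<lambda>i. 1 - g i"] exI[of _ g]) (simp add: p1 p2 scaleR_diff_left)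
  qed
  moreover have "emeasure lebesgue C \<le> emeasure lebesgue (prox ` D1)"
  proof -
    have "C \<subseteq> prox ` D"
    proof
      fix x assume x: "x \<in> C"
      obtain z where z: "contact a ?K x z" using ex_contact by blast
      then have "x + fst z \<in> D" using x unfolding D_def by (intro image_eqI[of _ _ "(x, z)"]) auto
      then show "x \<in> prox ` D" using contact_prox(1)[OF z] by (metis imageI)
    qed
    then have sub: "C \<subseteq> prox ` D1 \<union> prox ` (D - D1)" by blast
    have proxlip: "norm (prox y - prox x) \<le> 2 * norm (y - x)" for x y
    proof -
      have "norm (resid y - resid x) \<le> norm (y - x)" using lipschitz_onD[OF resid_lipschitz, of y x] by (simp add: dist_norm)
      moreover have "prox y - prox x = (y - x) - (resid y - resid x)" by (simp add: resid_def)
      ultimately show ?thesis using norm_triangle_ineq4[of "y - x" "resid y - resid x"] by simp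
    qed
    have neg: "negligible (prox ` (D - D1))"
    proof (rule negligible_locally_Lipschitz_image[OF _ negD])
      fix x show "\<exists>T B. open T \<and> x \<in> T \<and> (\<forall>y\<in>(D - D1) \<inter> T. norm (prox y - prox x) \<le> B * norm (y - x))"
        using proxlip by (intro exI[of _ UNIV] exI[of _ 2]) auto
    qed simp
    have "prox differentiable_on D1"
      unfolding differentiable_on_def using derJ by (auto intro: has_derivative_at_withinI differentiableI)
    then have P: "prox ` D1 \<in> sets lebesgue" by (intro differentiable_image_in_sets_lebesgue D1s) auto
    have "emeasure lebesgue C \<le> emeasure lebesgue (prox ` D1 \<union> prox ` (D - D1))"
      using sub P negligible_imp_sets[OF neg] by (intro emeasure_mono sets.Un)
    also have "\<dots> = emeasure lebesgue (prox ` D1)"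
      using P neg by (intro emeasure_Un_null_set) (simp_all only: negligible_iff_null_sets)
    finally show ?thesis .
  qed
  ultimately have "emeasure lebesgue C \<le> ennreal ?c * emeasure lebesgue ?S" by (rule order_trans[rotated])
  then have "hausdorff_measure DIM(real ^ 'n) C \<le> ennreal ?c * hausdorff_measure DIM(real ^ 'n) ?S"
    by (rule hausdorff_measure_le_if_lebesgue_le[OF compC])
  also have "\<dots> \<le> ennreal ?c * hausdorff_measure DIM(real ^ 'n) (touching_set_proj a \<Gamma> C)"
    by (intro mult_left_mono hausdorff_measure_mono S_sub) auto
  finally show ?thesis by simp
qed

end
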